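(* For all $r,\Delta\in\mathbb{N}$ there exists $C$ such that the following holds for every $n$ and every $p>0$: if $G$ is a graph on $Cn$ vertices which is $\big(p,\tfrac1C p^{\max(4,(3\Delta+1)/2)}n\big)$-bijumbled, then $G$ is $r$-partition universal for $\mathcal{H}(n,\Delta)$.
   Context: A graph $\Gamma$ is $(p,\beta)$-bijumbled if for all $X,Y\subseteq V(\Gamma)$ we have $\big|e_\Gamma(X,Y)-p|X||Y|\big|\le\beta\sqrt{|X||Y|}$, where $e_\Gamma(X,Y)$ is the number of edges with one endvertex in $X$ and the other in $Y$. $\mathcal{H}(n,\Delta)$ is the class of $n$-vertex graphs with maximum degree at most $\Delta$. $G$ is $r$-partition universal for $\mathcal{H}$ if for every $r$-colouring of $E(G)$ some colour class contains a copy of every $H\in\mathcal{H}$.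
   Formalization: The density is restricted to 0 < p ≤ 1, since for large p > 1 the empty graph on Cn vertices satisfies the bijumbledness condition and the claim fails; also r is at least 1, C is a positive integer, and graphs are finite with natural numbers as vertices. *)

theory Defs
  imports Complex_Main
begin

text \<open>A graph is a pair of a vertex set and a set of edges, the edges being two-element
  sets of vertices.\<close>

type_synonym 'a graph = "'a set \<times> 'a set set"

abbreviation verts :: "'a graph \<Rightarrow> 'a set" where "verts G \<equiv> fst G"
abbreviation edges :: "'a graph \<Rightarrow> 'a set set" where "edges G \<equiv> snd G"

definition simple_graph :: "'a graph \<Rightarrow> bool" where
  "simple_graph G \<longleftrightarrow> finite (verts G) \<and> (\<forall>e\<in>edges G. e \<subseteq> verts G \<and> card e = 2)"

definition degree :: "'a graph \<Rightarrow> 'a \<Rightarrow> nat" where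
  "degree G v = card {e \<in> edges G. v \<in> e}"

text \<open>As usual for bijumbled graphs, an edge with both endvertices in \<open>X \<inter> Y\<close> contributes twice
  to \<open>e(X,Y)\<close>, once for each way of assigning its endvertices to \<open>X\<close> and \<open>Y\<close>; for disjoint
  \<open>X\<close> and \<open>Y\<close> this is just the number of edges between them. Counting such edges only once
  would force \<open>e(V,V)\<close> to be about \<open>p |V|\<^sup>2 / 2\<close>, far from \<open>p |V|\<^sup>2\<close>.\<close>

definition edge_count :: "'a graph \<Rightarrow> 'a set \<Rightarrow> 'a set \<Rightarrow> nat" where
  "edge_count G X Y = card {(x, y). x \<in> X \<and> y \<in> Y \<and> {x, y} \<in> edges G}"

definition bijumbled :: "real \<Rightarrow> real \<Rightarrow> 'a graph \<Rightarrow> bool" where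
  "bijumbled p \<beta> G \<longleftrightarrow>
     (\<forall>X Y. X \<subseteq> verts G \<longrightarrow> Y \<subseteq> verts G \<longrightarrow>
        \<bar>real (edge_count G X Y) - p * real (card X) * real (card Y)\<bar>
          \<le> \<beta> * sqrt (real (card X) * real (card Y)))"

text \<open>A copy is a subgraph that need not be induced.\<close>

definition contains_copy :: "'a graph \<Rightarrow> 'b graph \<Rightarrow> bool" where
  "contains_copy G H \<longleftrightarrow>
     (\<exists>f. inj_on f (verts H) \<and> f ` verts H \<subseteq> verts G \<and> (\<forall>e\<in>edges H. f ` e \<in> edges G))"

definition bounded_degree_graphs :: "nat \<Rightarrow> nat \<Rightarrow> 'a graph set" where
  "bounded_degree_graphs n \<Delta> =
     {H. simple_graph H \<and> card (verts H) = n \<and> (\<forall>v\<in>verts H. degree H v \<le> \<Delta>)}"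

definition colour_class :: "'a graph \<Rightarrow> ('a set \<Rightarrow> nat) \<Rightarrow> nat \<Rightarrow> 'a graph" where
  "colour_class G c i = (verts G, {e \<in> edges G. c e = i})"

text \<open>One and the same colour class has to contain all members of the family.\<close>

definition partition_universal :: "nat \<Rightarrow> 'a graph \<Rightarrow> 'b graph set \<Rightarrow> bool" where
  "partition_universal r G \<H> \<longleftrightarrow>
     (\<forall>c. (\<forall>e\<in>edges G. c e < r) \<longrightarrow>
        (\<exists>i<r. \<forall>H\<in>\<H>. contains_copy (colour_class G c i) H))"

end

theory Submission
  imports Defs "HOL-Analysis.Convex"
begin

text \<open>The argument avoids the sparse regularity lemma. If a colour class \<open>R\<close> is dense between all
  pairs of large disjoint sets, then one finds boundedly many large sets that are pairwise regular
  in \<open>R\<close>, in the sense that the number of 4-cycles weighted by \<open>R - d E\<close> is small (\<open>E\<close> is the ambient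
  jumbled graph). This notion of regularity passes to arbitrary subsets and, on average over a
  vertex \<open>x\<close>, to the neighbourhoods of \<open>x\<close>, by nothing but the jumbledness of \<open>E\<close>. So a bounded degree
  graph \<open>H\<close> can be embedded vertex by vertex, keeping a candidate set for every vertex not yet
  embedded. Candidate sets can be much smaller than \<open>H\<close>; that they are not used up is ensured by
  processing the colour classes of the square of \<open>H\<close> one after the other and by choosing images that
  do not increase exponential potentials.

  Hence a colour class missing some \<open>H\<close> is sparse between two large sets, and, by iteration, between
  any two of many disjoint sets of equal size, so it is sparse inside their union. Doing this for
  one colour after the other, with the densities fixed in the opposite order, leads to a large set
  on which all colours are sparse, contradicting jumbledness.\<close>

section \<open>Counting in jumbled graphs\<close>

text \<open>Two quantitative points shape the proof. The first is the exponent. A candidate set with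
  \<open>k\<close> embedded neighbours has size of order \<open>p ^ k\<close> times linear. Passing
  regularity to one neighbourhood needs \<open>\<beta>\<close> below \<open>p ^ 3\<close> times the
  sizes; the vertices concerned still have an unembedded neighbour, so the sizes are at least of
  order \<open>p ^ (\<Delta> - 1)\<close>. Passing to two neighbourhoods at once needs
  \<open>p ^ 4\<close>, but occurs only in triangles of unembedded vertices, where the sizes are at
  least of order \<open>p ^ (\<Delta> - 2)\<close>. Both lead to \<open>p ^ (\<Delta> + 2)\<close>,
  and for \<open>D = max 2 \<Delta>\<close> the number \<open>D + 2\<close> is at most
  \<open>max 4 ((3 * \<Delta> + 1) / 2)\<close>. The second is that nothing relates \<open>p\<close>
  to \<open>n\<close>, although the exponential potentials work only if candidate sets are large
  compared with \<open>ln n\<close>. The relation comes from the absence of loops: a single vertex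
  has no edge to itself, so bijumbledness forces \<open>p \<le> \<beta>\<close>. Hence
  \<open>p ^ (\<Delta> + 1) * n\<close> is at least a large constant, and
  \<open>p ^ \<Delta> * n\<close> exceeds any prescribed multiple of \<open>ln n\<close>.\<close>

abbreviation cd :: "'a set \<Rightarrow> real" where "cd X \<equiv> real (card X)"

text \<open>Splitting \<open>A\<close> by the sign of \<open>w\<close> leaves two sums over subsets.
  This turns bounds for all subsets, the form in which jumbledness and cut regularity are given,
  into bounds on sums of absolute values.\<close>

lemma sum_abs_le_twice:
  fixes w :: "'a \<Rightarrow> real"
  assumes "finite A" and B: "\<And>S. S \<subseteq> A \<Longrightarrow> \<bar>sum w S\<bar> \<le> B"
  shows "(\<Sum>x\<in>A. \<bar>w x\<bar>) \<le> 2 * B"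
proof -
  let ?P = "{x\<in>A. 0 \<le> w x}" and ?N = "{x\<in>A. \<not> 0 \<le> w x}"
  have "(\<Sum>x\<in>A. \<bar>w x\<bar>) = (\<Sum>x\<in>?P. \<bar>w x\<bar>) + (\<Sum>x\<in>?N. \<bar>w x\<bar>)"
  proof -
    have "A = ?P \<union> ?N" by blast
    then show ?thesis
      using assms(1) by (metis (no_types, lifting) sum.union_disjoint finite_Un disjoint_iff mem_Collect_eq)
  qed
  also have "(\<Sum>x\<in>?P. \<bar>w x\<bar>) = sum w ?P" by (intro sum.cong) auto
  also have "(\<Sum>x\<in>?N. \<bar>w x\<bar>) = (\<Sum>x\<in>?N. - w x)" by (intro sum.cong) auto
  also have "\<dots> = - sum w ?N" by (rule sum_negf)
  also have "sum w ?P + - sum w ?N \<le> 2 * B"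
    using B[of ?P] B[of ?N] by auto
  finally show ?thesis .
qed

text \<open>Arithmetic-geometric mean with a free weight. Later the square roots contain degrees or
  codegrees, for which only first and second moments are available; \<open>t\<close> is chosen
  separately for each use.\<close>

lemma sqrt_mult_le_weighted:
  fixes x y t :: real
  assumes "0 \<le> x" "0 \<le> y" "0 < t"
  shows "sqrt (x * y) \<le> (t * x + y / t) / 2"
proof -
  have "sqrt (x * y) = sqrt ((t * x) * (y / t))"
    using assms by simp
  also have "\<dots> \<le> (t * x + y / t) / 2"
    using assms by (intro arith_geo_mean_sqrt) auto
  finally show ?thesis .
qed

lemma card_filter_eq_sum: "finite Z \<Longrightarrow> cd {z\<in>Z. P z} = (\<Sum>z\<in>Z. of_bool (P z))"
  by (simp add: of_bool_def sum.If_cases Int_def)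

text \<open>Both sides sum, over all \<open>y, y', z, z'\<close>, the product of \<open>f\<close> at
  \<open>(y, z)\<close> and \<open>(y', z)\<close> with \<open>g\<close> at \<open>(y, z')\<close>
  and \<open>(y', z')\<close>. For \<open>f = g\<close> this counts 4-cycles from either
  side.\<close>

lemma sum_swap_square:
  fixes f g :: "'a \<Rightarrow> 'b \<Rightarrow> real"
  shows "(\<Sum>y\<in>Y. \<Sum>y'\<in>Y. (\<Sum>z\<in>Z. f y z * f y' z) * (\<Sum>z\<in>Z. g y z * g y' z))
       = (\<Sum>z\<in>Z. \<Sum>z'\<in>Z. (\<Sum>y\<in>Y. f y z * g y z')\<^sup>2)"
proof -
  have "(\<Sum>z\<in>Z. \<Sum>z'\<in>Z. (\<Sum>y\<in>Y. f y z * g y z')\<^sup>2)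
      = (\<Sum>z\<in>Z. \<Sum>z'\<in>Z. \<Sum>y\<in>Y. \<Sum>y'\<in>Y. f y z * f y' z * (g y z' * g y' z'))"
    by (simp add: power2_eq_square sum_product mult_ac)
  also have "\<dots> = (\<Sum>z\<in>Z. \<Sum>y\<in>Y. \<Sum>z'\<in>Z. \<Sum>y'\<in>Y. f y z * f y' z * (g y z' * g y' z'))"
    by (rule sum.cong[OF refl], rule sum.swap)
  also have "\<dots> = (\<Sum>y\<in>Y. \<Sum>z\<in>Z. \<Sum>z'\<in>Z. \<Sum>y'\<in>Y. f y z * f y' z * (g y z' * g y' z'))"
    by (rule sum.swap)
  also have "\<dots> = (\<Sum>y\<in>Y. \<Sum>z\<in>Z. \<Sum>y'\<in>Y. \<Sum>z'\<in>Z. f y z * f y' z * (g y z' * g y' z'))"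
    by (rule sum.cong[OF refl], rule sum.cong[OF refl], rule sum.swap)
  also have "\<dots> = (\<Sum>y\<in>Y. \<Sum>y'\<in>Y. \<Sum>z\<in>Z. \<Sum>z'\<in>Z. f y z * f y' z * (g y z' * g y' z'))"
    by (rule sum.cong[OF refl], rule sum.swap)
  also have "\<dots> = (\<Sum>y\<in>Y. \<Sum>y'\<in>Y. (\<Sum>z\<in>Z. f y z * f y' z) * (\<Sum>z\<in>Z. g y z * g y' z))"
    by (simp add: sum_product)
  finally show ?thesis by simp
qed

locale jumbled =
  fixes V :: "'a set" and E :: "'a \<Rightarrow> 'a \<Rightarrow> bool" and p \<beta> :: real
  assumes finV: "finite V" and symE: "E x y \<Longrightarrow> E y x"
    and p_pos: "0 < p" and p_le: "p \<le> 1" and beta_nonneg: "0 \<le> \<beta>"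
    and jumbled_sum: "X \<subseteq> V \<Longrightarrow> Y \<subseteq> V \<Longrightarrow>
      \<bar>\<Sum>x\<in>X. \<Sum>y\<in>Y. of_bool (E x y) - p\<bar> \<le> \<beta> * sqrt (cd X * cd Y)"
begin

abbreviation a :: "'a \<Rightarrow> 'a \<Rightarrow> real" where "a x y \<equiv> of_bool (E x y)"

lemma a_sym: "a x y = a y x"
  using symE by (auto simp: of_bool_def)

lemma fin: "X \<subseteq> V \<Longrightarrow> finite X"
  using finV finite_subset by blast

lemma abs_deviation_sum:
  assumes A: "A \<subseteq> V" and D: "D \<subseteq> V" and \<phi>: "\<And>y. y \<in> D \<Longrightarrow> \<bar>\<phi> y\<bar> \<le> 1"
  shows "(\<Sum>x\<in>A. \<bar>\<Sum>y\<in>D. (a x y - p) * \<phi> y\<bar>) \<le> 4 * \<beta> * sqrt (cd A * cd D)"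
proof -
  have "(\<Sum>x\<in>A. \<bar>\<Sum>y\<in>D. (a x y - p) * \<phi> y\<bar>) \<le> 2 * (2 * (\<beta> * sqrt (cd A * cd D)))"
  proof (rule sum_abs_le_twice)
    fix S assume S: "S \<subseteq> A"
    have "\<bar>\<Sum>x\<in>S. \<Sum>y\<in>D. (a x y - p) * \<phi> y\<bar> = \<bar>\<Sum>y\<in>D. \<phi> y * (\<Sum>x\<in>S. a x y - p)\<bar>"
      by (subst sum.swap) (simp add: sum_distrib_left mult_ac)
    also have "\<dots> \<le> (\<Sum>y\<in>D. \<bar>\<phi> y\<bar> * \<bar>\<Sum>x\<in>S. a x y - p\<bar>)"
      by (rule order.trans[OF sum_abs]) (simp add: abs_mult)
    also have "\<dots> \<le> (\<Sum>y\<in>D. \<bar>\<Sum>x\<in>S. a x y - p\<bar>)"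
      using \<phi> by (intro sum_mono) (simp add: mult_left_le_one_le)
    also have "\<dots> \<le> 2 * (\<beta> * sqrt (cd A * cd D))"
    proof (rule sum_abs_le_twice)
      fix T assume T: "T \<subseteq> D"
      have "\<bar>\<Sum>y\<in>T. \<Sum>x\<in>S. a x y - p\<bar> \<le> \<beta> * sqrt (cd S * cd T)"
        using S T A D by (subst sum.swap, intro jumbled_sum) auto
      also have "\<dots> \<le> \<beta> * sqrt (cd A * cd D)"
        using S T A D beta_nonneg fin
        by (intro mult_left_mono real_sqrt_le_mono mult_mono) (auto intro!: card_mono)
      finally show "\<bar>\<Sum>y\<in>T. \<Sum>x\<in>S. a x y - p\<bar> \<le> \<beta> * sqrt (cd A * cd D)" .
    qed (use D fin in auto)
    finally show "\<bar>\<Sum>x\<in>S. \<Sum>y\<in>D. (a x y - p) * \<phi> y\<bar> \<le> 2 * (\<beta> * sqrt (cd A * cd D))" .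
  qed (use A fin in auto)
  then show ?thesis by simp
qed

text \<open>The gain is that the bound sees only the number of \<open>z\<close> with
  \<open>P z\<close>. With a common neighbourhood as support, this is typically smaller than
  \<open>cd Z\<close> by a factor \<open>p ^ 2\<close>.\<close>

lemma abs_deviation_sum_supp:
  assumes A: "A \<subseteq> V" and Z: "Z \<subseteq> V" and \<phi>: "\<And>z. z \<in> Z \<Longrightarrow> \<bar>\<phi> z\<bar> \<le> of_bool (P z)"
  shows "(\<Sum>x\<in>A. \<bar>(\<Sum>z\<in>Z. (a x z - p) * \<phi> z)\<bar>)
     \<le> 4 * \<beta> * sqrt (cd A * (\<Sum>z\<in>Z. of_bool (P z)))"
proof -
  let ?D = "{z\<in>Z. P z}"
  have "(\<Sum>z\<in>Z. (a x z - p) * \<phi> z) = (\<Sum>z\<in>?D. (a x z - p) * \<phi> z)" for x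
  proof (rule sum.mono_neutral_right)
    show "\<forall>z\<in>Z - ?D. (a x z - p) * \<phi> z = 0"
    proof
      fix z assume "z \<in> Z - ?D"
      then show "(a x z - p) * \<phi> z = 0" using \<phi>[of z] by simp
    qed
  qed (use Z fin in auto)
  moreover have "(\<Sum>x\<in>A. \<bar>(\<Sum>z\<in>?D. (a x z - p) * \<phi> z)\<bar>) \<le> 4 * \<beta> * sqrt (cd A * cd ?D)"
  proof (rule abs_deviation_sum[OF A])
    show "\<bar>\<phi> z\<bar> \<le> 1" if "z \<in> ?D" for z using \<phi>[of z] that by auto
  qed (use Z in auto)
  ultimately show ?thesis
    using Z fin by (simp add: card_filter_eq_sum)
qed

text \<open>Let \<open>b x\<close> be the inner sum, \<open>m\<close> its expected value and
  \<open>e x = b x - m\<close>. Then \<open>b^2 = m^2 + e * (b + m)\<close>, and \<open>b\<close>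
  and \<open>m\<close> are at most \<open>t\<close> in absolute value, so a bound on the first
  moment of \<open>e\<close> suffices.\<close>

lemma second_moment:
  assumes A: "A \<subseteq> V" and Z: "Z \<subseteq> V" and \<phi>: "\<And>z. z \<in> Z \<Longrightarrow> \<bar>\<phi> z\<bar> \<le> of_bool (P z)"
    and t: "t = (\<Sum>z\<in>Z. of_bool (P z))"
  shows "(\<Sum>x\<in>A. (\<Sum>z\<in>Z. a x z * \<phi> z)\<^sup>2) \<le> cd A * (p * (\<Sum>z\<in>Z. \<phi> z))\<^sup>2 + 8 * \<beta> * t * sqrt (cd A * t)"
    and "(\<Sum>x\<in>A. (\<Sum>z\<in>Z. (a x z - p) * \<phi> z)\<^sup>2) \<le> 8 * \<beta> * t * sqrt (cd A * t)"
proof -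
  define m where "m = p * (\<Sum>z\<in>Z. \<phi> z)"
  define b where "b x = (\<Sum>z\<in>Z. a x z * \<phi> z)" for x
  define e where "e x = (\<Sum>z\<in>Z. (a x z - p) * \<phi> z)" for x
  have e: "e x = b x - m" for x
    unfolding e_def b_def m_def by (simp add: sum_distrib_left sum_subtractf left_diff_distrib)
  have t0: "t \<ge> 0" unfolding t by (intro sum_nonneg) auto
  have ph: "(\<Sum>z\<in>Z. \<bar>\<phi> z\<bar>) \<le> t"
    unfolding t using \<phi> by (intro sum_mono)
  have bt: "\<bar>b x\<bar> \<le> t" for x
  proof -
    have "\<bar>b x\<bar> \<le> (\<Sum>z\<in>Z. \<bar>a x z * \<phi> z\<bar>)" unfolding b_def by (rule sum_abs)
    also have "\<dots> \<le> (\<Sum>z\<in>Z. \<bar>\<phi> z\<bar>)" by (intro sum_mono) (auto simp: abs_mult)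
    finally show ?thesis using ph by linarith
  qed
  have mt: "\<bar>m\<bar> \<le> t"
  proof -
    have "\<bar>m\<bar> \<le> p * (\<Sum>z\<in>Z. \<bar>\<phi> z\<bar>)"
      unfolding m_def using p_pos by (simp add: abs_mult)
    also have "\<dots> \<le> 1 * t" using p_pos p_le ph by (intro mult_mono) (auto intro: sum_nonneg)
    finally show ?thesis by simp
  qed
  have S: "(\<Sum>x\<in>A. \<bar>e x\<bar>) \<le> 4 * \<beta> * sqrt (cd A * t)"
    unfolding e_def t using abs_deviation_sum_supp[OF A Z \<phi>] by simp
  have "(\<Sum>x\<in>A. (b x)\<^sup>2) \<le> (\<Sum>x\<in>A. m\<^sup>2 + 2 * t * \<bar>e x\<bar>)"
  proof (intro sum_mono)
    fix x
    have "(b x)\<^sup>2 = m\<^sup>2 + e x * (b x + m)" unfolding e by (simp add: power2_eq_square algebra_simps)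
    also have "e x * (b x + m) \<le> \<bar>e x\<bar> * \<bar>b x + m\<bar>" by (metis abs_ge_self abs_mult)
    also have "\<dots> \<le> \<bar>e x\<bar> * (2 * t)" using bt[of x] mt by (intro mult_left_mono) auto
    finally show "(b x)\<^sup>2 \<le> m\<^sup>2 + 2 * t * \<bar>e x\<bar>" by (simp add: mult_ac)
  qed
  also have "\<dots> = cd A * m\<^sup>2 + 2 * t * (\<Sum>x\<in>A. \<bar>e x\<bar>)"
    by (simp add: sum.distrib sum_distrib_left)
  also have "\<dots> \<le> cd A * m\<^sup>2 + 2 * t * (4 * \<beta> * sqrt (cd A * t))"
    using S t0 by (intro add_left_mono mult_left_mono) auto
  finally show "(\<Sum>x\<in>A. (\<Sum>z\<in>Z. a x z * \<phi> z)\<^sup>2) \<le> cd A * (p * (\<Sum>z\<in>Z. \<phi> z))\<^sup>2 + 8 * \<beta> * t * sqrt (cd A * t)"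
    unfolding b_def m_def by (simp add: mult_ac)
  have "(\<Sum>x\<in>A. (e x)\<^sup>2) \<le> (\<Sum>x\<in>A. 2 * t * \<bar>e x\<bar>)"
  proof (intro sum_mono)
    fix x
    have "\<bar>e x\<bar> \<le> 2 * t" unfolding e using bt[of x] mt by auto
    then have "\<bar>e x\<bar> * \<bar>e x\<bar> \<le> (2 * t) * \<bar>e x\<bar>" by (intro mult_right_mono) auto
    then show "(e x)\<^sup>2 \<le> 2 * t * \<bar>e x\<bar>" by (simp add: power2_eq_square)
  qed
  also have "\<dots> = 2 * t * (\<Sum>x\<in>A. \<bar>e x\<bar>)"
    by (simp add: sum_distrib_left)
  also have "\<dots> \<le> 2 * t * (4 * \<beta> * sqrt (cd A * t))"
    using S t0 by (intro mult_left_mono) auto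
  finally show "(\<Sum>x\<in>A. (\<Sum>z\<in>Z. (a x z - p) * \<phi> z)\<^sup>2) \<le> 8 * \<beta> * t * sqrt (cd A * t)"
    unfolding e_def by (simp add: mult_ac)
qed

lemma edge_sum:
  assumes "Y \<subseteq> V" "Z \<subseteq> V"
  shows "\<bar>(\<Sum>y\<in>Y. \<Sum>z\<in>Z. a y z) - p * cd Y * cd Z\<bar> \<le> \<beta> * sqrt (cd Y * cd Z)"
  using jumbled_sum[OF assms] by (simp add: sum_subtractf mult_ac)

lemma degree_square_sum:
  assumes "Y \<subseteq> V" "Z \<subseteq> V"
  shows "(\<Sum>y\<in>Y. (\<Sum>z\<in>Z. a y z)\<^sup>2) \<le> p\<^sup>2 * cd Y * (cd Z)\<^sup>2 + 8 * \<beta> * cd Z * sqrt (cd Y * cd Z)"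
    "(\<Sum>y\<in>Y. ((\<Sum>z\<in>Z. a y z) - p * cd Z)\<^sup>2) \<le> 8 * \<beta> * cd Z * sqrt (cd Y * cd Z)"
  using second_moment[OF assms, of "\<lambda>_. 1" "\<lambda>_. True" "cd Z"] assms fin
  by (simp_all add: power_mult_distrib mult_ac sum_subtractf)

definition cod :: "'a set \<Rightarrow> 'a \<Rightarrow> 'a \<Rightarrow> real" where
  "cod Z y y' = (\<Sum>z\<in>Z. a y z * a y' z)"

lemma cod_nonneg: "0 \<le> cod Z y y'"
  unfolding cod_def by (intro sum_nonneg) auto

lemma cod_eq: "cod Z y y' = (\<Sum>z\<in>Z. of_bool (E y z \<and> E y' z))"
  unfolding cod_def by (simp add: of_bool_conj)

text \<open>For fixed \<open>y\<close> the numbers \<open>cod Z y y'\<close> are the inner sums of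
  \<open>second_moment\<close>, with the neighbourhood of \<open>y\<close> as support. Summing over
  \<open>y\<close> then needs only the first two moments of the degrees. The factor
  \<open>p ^ 3\<close> in the bound on \<open>\<beta>\<close> keeps the error below a multiple of
  \<open>\<delta>\<close> of the random value.\<close>

lemma codegree_square_sum:
  assumes Y: "Y \<subseteq> V" and Z: "Z \<subseteq> V" and \<delta>: "0 \<le> \<delta>" "\<delta> \<le> 1 / 24"
    and \<beta>: "\<beta> \<le> \<delta> * p ^ 3 * sqrt (cd Y * cd Z)"
  shows "(\<Sum>y\<in>Y. \<Sum>y'\<in>Y. (cod Z y y')\<^sup>2) \<le> (1 + 24 * \<delta>) * p ^ 4 * (cd Y)\<^sup>2 * (cd Z)\<^sup>2"
proof (cases "cd Y * cd Z = 0")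
  case True
  then show ?thesis using Y Z fin by (auto simp: cod_def)
next
  case False
  then have pos: "0 < cd Y" "0 < cd Z" by auto
  define s where "s = sqrt (cd Y * cd Z)"
  have s: "s\<^sup>2 = cd Y * cd Z" "s > 0" unfolding s_def using pos by auto
  define d where "d y = (\<Sum>z\<in>Z. a y z)" for y
  have d0: "d y \<ge> 0" for y unfolding d_def by (intro sum_nonneg) auto
  have bs: "\<beta> * s \<le> \<delta> * p ^ 3 * (cd Y * cd Z)"
  proof -
    have "\<beta> * s \<le> \<delta> * p ^ 3 * s * s"
      using \<beta> s by (intro mult_right_mono) (auto simp: s_def)
    then show ?thesis using s(1) by (simp add: power2_eq_square mult.assoc)
  qed
  have p31: "p ^ 3 \<le> p\<^sup>2" "p ^ 3 \<le> p"
    using p_pos p_le power_decreasing[of 2 3 p] power_decreasing[of 1 3 p] by auto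
  have d2: "(\<Sum>y\<in>Y. (d y)\<^sup>2) \<le> (1 + 8 * \<delta>) * p\<^sup>2 * cd Y * (cd Z)\<^sup>2"
  proof -
    have "(\<Sum>y\<in>Y. (d y)\<^sup>2) \<le> p\<^sup>2 * cd Y * (cd Z)\<^sup>2 + 8 * cd Z * (\<beta> * s)"
      using degree_square_sum(1)[OF Y Z] unfolding d_def s_def by (simp add: mult_ac)
    also have "\<dots> \<le> p\<^sup>2 * cd Y * (cd Z)\<^sup>2 + 8 * cd Z * (\<delta> * p\<^sup>2 * (cd Y * cd Z))"
      using bs p31 \<delta> by (intro add_left_mono mult_left_mono order.trans[OF bs] mult_right_mono) auto
    finally show ?thesis by (simp add: algebra_simps power2_eq_square)
  qed
  have d1: "(\<Sum>y\<in>Y. d y) \<le> 2 * p * (cd Y * cd Z)"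
  proof -
    have "(\<Sum>y\<in>Y. d y) \<le> p * cd Y * cd Z + \<beta> * s"
      using edge_sum[OF Y Z] unfolding d_def s_def by (auto simp: abs_le_iff)
    also have "\<dots> \<le> p * cd Y * cd Z + 1 * p * (cd Y * cd Z)"
      using bs p31 \<delta> p_pos by (intro add_left_mono order.trans[OF bs] mult_right_mono mult_mono) auto
    finally show ?thesis by simp
  qed
  have "(\<Sum>y\<in>Y. \<Sum>y'\<in>Y. (cod Z y y')\<^sup>2)
     \<le> (\<Sum>y\<in>Y. cd Y * (p * d y)\<^sup>2 + 8 * \<beta> * d y * sqrt (cd Y * d y))"
  proof (rule sum_mono)
    fix y assume "y \<in> Y"
    have "(\<Sum>y'\<in>Y. (\<Sum>z\<in>Z. a y' z * a y z)\<^sup>2) \<le> cd Y * (p * d y)\<^sup>2 + 8 * \<beta> * d y * sqrt (cd Y * d y)"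
      unfolding d_def by (rule second_moment(1)[OF Y Z, where P = "E y"]) auto
    then show "(\<Sum>y'\<in>Y. (cod Z y y')\<^sup>2) \<le> cd Y * (p * d y)\<^sup>2 + 8 * \<beta> * d y * sqrt (cd Y * d y)"
      unfolding cod_def by (simp add: mult.commute)
  qed
  also have "\<dots> \<le> (\<Sum>y\<in>Y. cd Y * p\<^sup>2 * (d y)\<^sup>2 + 4 * \<beta> * (s * d y + (cd Y / s) * (d y)\<^sup>2))"
  proof (rule sum_mono)
    fix y
    \<comment> \<open>This weight is balanced at \<open>d y = cd Z\<close> and not at the typical
      degree \<open>p * cd Z\<close>; the loss is covered by the factor \<open>p ^ 3\<close> in the
      bound on \<open>\<beta>\<close>.\<close>
    have "sqrt (cd Y * d y) \<le> ((s / cd Y) * cd Y + d y / (s / cd Y)) / 2"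
      using s pos d0 by (intro sqrt_mult_le_weighted) auto
    then have "8 * \<beta> * d y * sqrt (cd Y * d y) \<le> 8 * \<beta> * d y * ((s + d y * cd Y / s) / 2)"
      using beta_nonneg d0 pos by (intro mult_left_mono) auto
    also have "\<dots> = 4 * \<beta> * (s * d y + (cd Y / s) * (d y)\<^sup>2)"
      using s(2) by (simp add: power2_eq_square field_simps)
    finally show "cd Y * (p * d y)\<^sup>2 + 8 * \<beta> * d y * sqrt (cd Y * d y)
       \<le> cd Y * p\<^sup>2 * (d y)\<^sup>2 + 4 * \<beta> * (s * d y + (cd Y / s) * (d y)\<^sup>2)"
      by (simp add: power_mult_distrib)
  qed
  also have "\<dots> = cd Y * p\<^sup>2 * (\<Sum>y\<in>Y. (d y)\<^sup>2) + 4 * \<beta> * (s * (\<Sum>y\<in>Y. d y) + (cd Y / s) * (\<Sum>y\<in>Y. (d y)\<^sup>2))"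
    by (simp add: sum.distrib sum_distrib_left distrib_left)
  also have "\<dots> \<le> cd Y * p\<^sup>2 * ((1 + 8 * \<delta>) * p\<^sup>2 * cd Y * (cd Z)\<^sup>2)
     + 4 * \<beta> * (s * (2 * p * (cd Y * cd Z)) + (cd Y / s) * (2 * p * cd Y * (cd Z)\<^sup>2))"
  proof -
    have "(1 + 8 * \<delta>) * p\<^sup>2 * cd Y * (cd Z)\<^sup>2 \<le> 2 * p * cd Y * (cd Z)\<^sup>2"
      using \<delta> p_pos p_le by (intro mult_right_mono mult_mono) (auto simp: power2_eq_square mult_left_le)
    then show ?thesis
      using d1 d2 s beta_nonneg by (intro add_mono mult_left_mono) auto
  qed
  also have "(cd Y / s) * (2 * p * cd Y * (cd Z)\<^sup>2) = s * (2 * p * (cd Y * cd Z))"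
  proof -
    have "(cd Y / s) * (2 * p * cd Y * (cd Z)\<^sup>2) = 2 * p * (s\<^sup>2)\<^sup>2 / s"
      unfolding s(1) by (simp add: power2_eq_square)
    also have "\<dots> = 2 * p * s * s\<^sup>2" using s(2) by (simp add: power2_eq_square)
    finally show ?thesis unfolding s(1) by simp
  qed
  also have "4 * \<beta> * (s * (2 * p * (cd Y * cd Z)) + s * (2 * p * (cd Y * cd Z)))
     = 16 * p * (cd Y * cd Z) * (\<beta> * s)" by (simp add: algebra_simps)
  also have "cd Y * p\<^sup>2 * ((1 + 8 * \<delta>) * p\<^sup>2 * cd Y * (cd Z)\<^sup>2) + 16 * p * (cd Y * cd Z) * (\<beta> * s)
     \<le> cd Y * p\<^sup>2 * ((1 + 8 * \<delta>) * p\<^sup>2 * cd Y * (cd Z)\<^sup>2) + 16 * p * (cd Y * cd Z) * (\<delta> * p ^ 3 * (cd Y * cd Z))"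
    using bs p_pos by (intro add_left_mono mult_left_mono) auto
  also have "\<dots> = (1 + 24 * \<delta>) * p ^ 4 * (cd Y)\<^sup>2 * (cd Z)\<^sup>2"
    by (simp add: algebra_simps power2_eq_square power3_eq_cube power4_eq_xxxx)
  finally show ?thesis .
qed

end

section \<open>Weighted 4-cycles and their inheritance by neighbourhoods\<close>

text \<open>The fourth power, not normalised, of the box norm (the bipartite Gowers
  \<open>U2\<close> norm) of \<open>g\<close> on \<open>Y \<times> Z\<close>: the weighted number of
  4-cycles, degenerate ones included.\<close>

definition C4 :: "('a \<Rightarrow> 'a \<Rightarrow> real) \<Rightarrow> 'a set \<Rightarrow> 'a set \<Rightarrow> real" where
  "C4 g Y Z = (\<Sum>y\<in>Y. \<Sum>y'\<in>Y. (\<Sum>z\<in>Z. g y z * g y' z)\<^sup>2)"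

lemma C4_nonneg: "0 \<le> C4 g Y Z"
  unfolding C4_def by (intro sum_nonneg) auto

lemma C4_swap: "C4 g Y Z = (\<Sum>z\<in>Z. \<Sum>z'\<in>Z. (\<Sum>y\<in>Y. g y z * g y z')\<^sup>2)"
  unfolding C4_def using sum_swap_square[where f = g and g = g and Y = Y and Z = Z] by (simp add: power2_eq_square)

lemma C4_commute:
  assumes "\<And>x y. g x y = g y x"
  shows "C4 g Y Z = C4 g Z Y"
  by (subst C4_swap) (simp add: C4_def assms)

text \<open>The correlations inside the squares may have either sign, so a set can be shrunk only
  where it is the range of the outer sums, whose terms are squares. \<open>C4_swap\<close> puts the
  second set into that position.\<close>

lemma C4_mono:
  assumes "Y' \<subseteq> Y" "Z' \<subseteq> Z" "finite Y" "finite Z"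
  shows "C4 g Y' Z' \<le> C4 g Y Z"
proof -
  have "C4 g Y' Z' \<le> C4 g Y Z'"
    unfolding C4_def using assms
    by (intro order.trans[OF sum_mono2[of Y Y'] sum_mono] sum_mono2 sum_nonneg) auto
  also have "\<dots> \<le> C4 g Y Z"
    unfolding C4_swap using assms
    by (intro order.trans[OF sum_mono2[of Z Z'] sum_mono] sum_mono2 sum_nonneg) auto
  finally show ?thesis .
qed

lemma double_sum_squared_le:
  fixes P :: "'a \<Rightarrow> 'a \<Rightarrow> real"
  shows "(\<Sum>y\<in>Y. \<Sum>y'\<in>Y. P y y')\<^sup>2 \<le> (cd Y)\<^sup>2 * (\<Sum>y\<in>Y. \<Sum>y'\<in>Y. (P y y')\<^sup>2)"
proof -
  have "(\<Sum>y\<in>Y. \<Sum>y'\<in>Y. P y y')\<^sup>2 \<le> (\<Sum>y\<in>Y. (\<Sum>y'\<in>Y. P y y')\<^sup>2) * cd Y"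
    by (rule sum_squared_le_sum_of_squares)
  also have "\<dots> \<le> (\<Sum>y\<in>Y. (\<Sum>y'\<in>Y. (P y y')\<^sup>2) * cd Y) * cd Y"
    by (intro mult_right_mono sum_mono sum_squared_le_sum_of_squares) auto
  also have "\<dots> = (cd Y)\<^sup>2 * (\<Sum>y\<in>Y. \<Sum>y'\<in>Y. (P y y')\<^sup>2)"
    by (simp add: sum_distrib_right[symmetric] power2_eq_square[of "cd Y"])
  finally show ?thesis .
qed

text \<open>Cauchy-Schwarz over \<open>z\<close>, then over the pairs \<open>y, y'\<close>.\<close>

lemma cut_le_C4: "(\<Sum>y\<in>Y. \<Sum>z\<in>Z. g y z) ^ 4 \<le> (cd Y)\<^sup>2 * (cd Z)\<^sup>2 * C4 g Y Z"
proof -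
  let ?S = "\<Sum>y\<in>Y. \<Sum>y'\<in>Y. \<Sum>z\<in>Z. g y z * g y' z"
  have eq: "(\<Sum>z\<in>Z. (\<Sum>y\<in>Y. g y z)\<^sup>2) = ?S"
  proof -
    have "(\<Sum>z\<in>Z. (\<Sum>y\<in>Y. g y z)\<^sup>2) = (\<Sum>z\<in>Z. \<Sum>y\<in>Y. \<Sum>y'\<in>Y. g y z * g y' z)"
      by (simp add: power2_eq_square sum_product)
    also have "\<dots> = (\<Sum>y\<in>Y. \<Sum>z\<in>Z. \<Sum>y'\<in>Y. g y z * g y' z)" by (rule sum.swap)
    also have "\<dots> = ?S" by (rule sum.cong[OF refl], rule sum.swap)
    finally show ?thesis .
  qed
  have "(\<Sum>y\<in>Y. \<Sum>z\<in>Z. g y z)\<^sup>2 = (\<Sum>z\<in>Z. \<Sum>y\<in>Y. g y z)\<^sup>2" by (subst sum.swap) simp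
  also have "\<dots> \<le> (\<Sum>z\<in>Z. (\<Sum>y\<in>Y. g y z)\<^sup>2) * cd Z" by (rule sum_squared_le_sum_of_squares)
  finally have 1: "(\<Sum>y\<in>Y. \<Sum>z\<in>Z. g y z)\<^sup>2 \<le> ?S * cd Z" unfolding eq .
  have "(\<Sum>y\<in>Y. \<Sum>z\<in>Z. g y z) ^ 4 = ((\<Sum>y\<in>Y. \<Sum>z\<in>Z. g y z)\<^sup>2)\<^sup>2" by simp
  also have "\<dots> \<le> (?S * cd Z)\<^sup>2" using 1 by (intro power_mono) auto
  also have "\<dots> = (cd Z)\<^sup>2 * ?S\<^sup>2" by (simp add: power_mult_distrib)
  also have "\<dots> \<le> (cd Z)\<^sup>2 * ((cd Y)\<^sup>2 * C4 g Y Z)"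
    unfolding C4_def by (intro mult_left_mono double_sum_squared_le) auto
  finally show ?thesis by (simp add: mult_ac)
qed

lemma sum_filter_of_bool:
  fixes f :: "'a \<Rightarrow> real"
  shows "finite Z \<Longrightarrow> (\<Sum>z\<in>{z\<in>Z. P z}. f z) = (\<Sum>z\<in>Z. of_bool (P z) * f z)"
  by (simp add: sum.inter_filter of_bool_def if_distrib if_distribR cong: if_cong)

context jumbled
begin

lemma cod_sum:
  assumes Y: "Y \<subseteq> V" and Z: "Z \<subseteq> V" and \<delta>: "0 \<le> \<delta>" "\<delta> \<le> 1 / 24"
    and \<beta>: "\<beta> \<le> \<delta> * p ^ 3 * sqrt (cd Y * cd Z)"
  shows "(\<Sum>y\<in>Y. \<Sum>y'\<in>Y. (cod Z y y')\<^sup>2) \<le> 2 * p ^ 4 * (cd Y)\<^sup>2 * (cd Z)\<^sup>2"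
    and "(\<Sum>y\<in>Y. \<Sum>y'\<in>Y. cod Z y y') \<le> 2 * p\<^sup>2 * (cd Y)\<^sup>2 * cd Z"
proof -
  have "(\<Sum>y\<in>Y. \<Sum>y'\<in>Y. (cod Z y y')\<^sup>2) \<le> (1 + 24 * \<delta>) * p ^ 4 * (cd Y)\<^sup>2 * (cd Z)\<^sup>2"
    by (rule codegree_square_sum[OF assms])
  also have "\<dots> \<le> 2 * p ^ 4 * (cd Y)\<^sup>2 * (cd Z)\<^sup>2"
    using \<delta> p_pos by (intro mult_right_mono) auto
  finally show 1: "(\<Sum>y\<in>Y. \<Sum>y'\<in>Y. (cod Z y y')\<^sup>2) \<le> 2 * p ^ 4 * (cd Y)\<^sup>2 * (cd Z)\<^sup>2" .
  have "(\<Sum>y\<in>Y. \<Sum>y'\<in>Y. cod Z y y')\<^sup>2 \<le> (cd Y)\<^sup>2 * (2 * p ^ 4 * (cd Y)\<^sup>2 * (cd Z)\<^sup>2)"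
    by (rule order.trans[OF double_sum_squared_le]) (intro mult_left_mono 1, simp)
  also have "\<dots> \<le> (2 * p\<^sup>2 * (cd Y)\<^sup>2 * cd Z)\<^sup>2"
    using p_pos by (simp add: power_mult_distrib power2_eq_square power4_eq_xxxx mult_ac)
  finally show "(\<Sum>y\<in>Y. \<Sum>y'\<in>Y. cod Z y y') \<le> 2 * p\<^sup>2 * (cd Y)\<^sup>2 * cd Z"
    by (rule power2_le_imp_le) (use p_pos in auto)
qed

lemma beta_sqrt_le:
  assumes "\<beta> \<le> c * sqrt (cd X * cd Y)"
  shows "\<beta> * sqrt (cd X * cd Y) \<le> c * (cd X * cd Y)"
proof -
  have "\<beta> * sqrt (cd X * cd Y) \<le> c * sqrt (cd X * cd Y) * sqrt (cd X * cd Y)"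
    using assms by (intro mult_right_mono) auto
  then show ?thesis by (simp add: mult.assoc)
qed

text \<open>For every pair \<open>y, y'\<close> the weight \<open>g y z * g y' z\<close> is
  supported on the common neighbourhood, so \<open>second_moment\<close> applies to the sum over
  \<open>x\<close>. Its main term contributes the factor \<open>p ^ 2\<close>; its error terms add
  up to codegree moments of \<open>E\<close>, which do not involve \<open>g\<close>.\<close>

lemma C4_inherit_one:
  assumes X: "X \<subseteq> V" and Y: "Y \<subseteq> V" and Z: "Z \<subseteq> V" and \<delta>: "0 \<le> \<delta>" "\<delta> \<le> 1 / 24"
    and XZ: "\<beta> \<le> \<delta> * p ^ 3 * sqrt (cd X * cd Z)"
    and YZ: "\<beta> \<le> \<delta> * p ^ 3 * sqrt (cd Y * cd Z)"
    and g: "\<And>x y. \<bar>g x y\<bar> \<le> a x y"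
  shows "(\<Sum>x\<in>X. C4 g Y {z\<in>Z. E x z})
     \<le> p\<^sup>2 * cd X * C4 g Y Z + 16 * \<delta> * p ^ 6 * cd X * (cd Y)\<^sup>2 * (cd Z)\<^sup>2"
proof (cases "cd X * cd Z = 0")
  case True
  then have "X = {} \<or> Z = {}" using X Z fin by auto
  then show ?thesis by (auto simp: C4_def)
next
  case False
  then have pos: "0 < cd X" "0 < cd Z" by auto
  define s where "s = sqrt (cd X * cd Z)"
  have s: "s * s = cd X * cd Z" "s > 0" unfolding s_def using pos by auto
  have bs: "\<beta> * s \<le> \<delta> * p ^ 3 * (cd X * cd Z)"
    unfolding s_def using XZ by (rule beta_sqrt_le)
  have "(\<Sum>x\<in>X. C4 g Y {z\<in>Z. E x z})
     = (\<Sum>x\<in>X. \<Sum>y\<in>Y. \<Sum>y'\<in>Y. (\<Sum>z\<in>Z. a x z * (g y z * g y' z))\<^sup>2)"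
    unfolding C4_def using fin[OF Z] by (simp add: sum_filter_of_bool)
  also have "\<dots> = (\<Sum>y\<in>Y. \<Sum>x\<in>X. \<Sum>y'\<in>Y. (\<Sum>z\<in>Z. a x z * (g y z * g y' z))\<^sup>2)"
    by (rule sum.swap)
  also have "\<dots> = (\<Sum>y\<in>Y. \<Sum>y'\<in>Y. \<Sum>x\<in>X. (\<Sum>z\<in>Z. a x z * (g y z * g y' z))\<^sup>2)"
    by (rule sum.cong[OF refl], rule sum.swap)
  also have "\<dots> \<le> (\<Sum>y\<in>Y. \<Sum>y'\<in>Y. cd X * (p * (\<Sum>z\<in>Z. g y z * g y' z))\<^sup>2
       + 8 * \<beta> * cod Z y y' * sqrt (cd X * cod Z y y'))"
  proof (intro sum_mono second_moment(1)[OF X Z _ cod_eq])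
    fix y y' z
    have "\<bar>g y z * g y' z\<bar> \<le> a y z * a y' z"
      unfolding abs_mult by (intro mult_mono g) auto
    then show "\<bar>g y z * g y' z\<bar> \<le> of_bool (E y z \<and> E y' z)" by (simp add: of_bool_conj)
  qed
  also have "\<dots> \<le> (\<Sum>y\<in>Y. \<Sum>y'\<in>Y. cd X * p\<^sup>2 * (\<Sum>z\<in>Z. g y z * g y' z)\<^sup>2
       + (4 * \<beta> * p * s * cod Z y y' + 4 * \<beta> * (cd X / (p * s)) * (cod Z y y')\<^sup>2))"
  proof (intro sum_mono)
    fix y y'
    let ?t = "cod Z y y'"
    \<comment> \<open>The two terms agree at \<open>?t = p ^ 2 * cd Z\<close>, the typical
      codegree.\<close>
    have "sqrt (cd X * ?t) \<le> ((p * s / cd X) * cd X + ?t / (p * s / cd X)) / 2"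
      using s pos p_pos cod_nonneg by (intro sqrt_mult_le_weighted) auto
    then have "8 * \<beta> * ?t * sqrt (cd X * ?t) \<le> 8 * \<beta> * ?t * ((p * s + ?t * cd X / (p * s)) / 2)"
      using beta_nonneg cod_nonneg pos by (intro mult_left_mono) auto
    also have "\<dots> = 4 * \<beta> * p * s * ?t + 4 * \<beta> * (cd X / (p * s)) * ?t\<^sup>2"
      using s(2) p_pos by (simp add: power2_eq_square field_simps)
    finally show "cd X * (p * (\<Sum>z\<in>Z. g y z * g y' z))\<^sup>2 + 8 * \<beta> * ?t * sqrt (cd X * ?t)
      \<le> cd X * p\<^sup>2 * (\<Sum>z\<in>Z. g y z * g y' z)\<^sup>2
       + (4 * \<beta> * p * s * ?t + 4 * \<beta> * (cd X / (p * s)) * ?t\<^sup>2)"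
      by (simp add: power_mult_distrib)
  qed
  also have "\<dots> = p\<^sup>2 * cd X * C4 g Y Z + (4 * \<beta> * p * s * (\<Sum>y\<in>Y. \<Sum>y'\<in>Y. cod Z y y')
      + 4 * \<beta> * (cd X / (p * s)) * (\<Sum>y\<in>Y. \<Sum>y'\<in>Y. (cod Z y y')\<^sup>2))"
    unfolding C4_def sum.distrib sum_distrib_left by (simp only: mult.commute[of "p\<^sup>2"])
  also have "\<dots> \<le> p\<^sup>2 * cd X * C4 g Y Z + (4 * \<beta> * p * s * (2 * p\<^sup>2 * (cd Y)\<^sup>2 * cd Z)
      + 4 * \<beta> * (cd X / (p * s)) * (2 * p ^ 4 * (cd Y)\<^sup>2 * (cd Z)\<^sup>2))"
    using cod_sum[OF Y Z \<delta> YZ] beta_nonneg p_pos s by (intro add_left_mono add_mono mult_left_mono) auto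
  also have "(cd X / (p * s)) * (2 * p ^ 4 * (cd Y)\<^sup>2 * (cd Z)\<^sup>2) = 2 * p ^ 3 * s * (cd Y)\<^sup>2 * cd Z"
  proof -
    have "(cd X / (p * s)) * (2 * p ^ 4 * (cd Y)\<^sup>2 * (cd Z)\<^sup>2)
      = 2 * p ^ 3 * (cd Y)\<^sup>2 * cd Z * (cd X * cd Z) / s"
      using p_pos s(2) by (simp add: field_simps power2_eq_square power3_eq_cube power4_eq_xxxx)
    also have "\<dots> = 2 * p ^ 3 * s * (cd Y)\<^sup>2 * cd Z"
      unfolding s(1)[symmetric] using s(2) by simp
    finally show ?thesis .
  qed
  then have "4 * \<beta> * (cd X / (p * s)) * (2 * p ^ 4 * (cd Y)\<^sup>2 * (cd Z)\<^sup>2) = 4 * \<beta> * (2 * p ^ 3 * s * (cd Y)\<^sup>2 * cd Z)"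
    by (simp only: mult.assoc)
  also have "4 * \<beta> * p * s * (2 * p\<^sup>2 * (cd Y)\<^sup>2 * cd Z) + 4 * \<beta> * (2 * p ^ 3 * s * (cd Y)\<^sup>2 * cd Z)
     = 16 * p ^ 3 * (cd Y)\<^sup>2 * cd Z * (\<beta> * s)"
    by (simp add: algebra_simps power2_eq_square power3_eq_cube)
  also have "\<dots> \<le> 16 * p ^ 3 * (cd Y)\<^sup>2 * cd Z * (\<delta> * p ^ 3 * (cd X * cd Z))"
    using bs p_pos by (intro mult_left_mono) auto
  also have "\<dots> = 16 * \<delta> * p ^ 6 * cd X * (cd Y)\<^sup>2 * (cd Z)\<^sup>2"
    by (simp add: power2_eq_square eval_nat_numeral mult_ac)
  finally show ?thesis by simp
qed

text \<open>Counted from the side of \<open>Z\<close>, a pair \<open>z, z'\<close> involves only the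
  common neighbours \<open>x\<close> of \<open>z\<close> and \<open>z'\<close>. Applying
  \<open>second_moment\<close> to these \<open>x\<close> takes care of the restriction of
  \<open>Y\<close> and yields one factor \<open>p ^ 2\<close>; what remains is the situation of
  \<open>C4_inherit_one\<close>, which yields the other.\<close>

lemma C4_inherit_two:
  assumes X: "X \<subseteq> V" and Y: "Y \<subseteq> V" and Z: "Z \<subseteq> V" and \<delta>: "0 \<le> \<delta>" "\<delta> \<le> 1 / 24"
    and XY: "\<beta> \<le> \<delta> * p ^ 4 * sqrt (cd X * cd Y)"
    and XZ: "\<beta> \<le> \<delta> * p ^ 3 * sqrt (cd X * cd Z)"
    and YZ: "\<beta> \<le> \<delta> * p ^ 3 * sqrt (cd Y * cd Z)"
    and g: "\<And>x y. \<bar>g x y\<bar> \<le> a x y"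
  shows "(\<Sum>x\<in>X. C4 g {y\<in>Y. E x y} {z\<in>Z. E x z})
     \<le> p ^ 4 * cd X * C4 g Y Z + 32 * \<delta> * p ^ 8 * cd X * (cd Y)\<^sup>2 * (cd Z)\<^sup>2"
proof (cases "cd X * cd Y = 0")
  case True
  then have "X = {} \<or> Y = {}" using X Y fin by auto
  then show ?thesis by (auto simp: C4_def)
next
  case False
  then have pos: "0 < cd X" "0 < cd Y" by auto
  define s where "s = sqrt (cd X * cd Y)"
  have s: "s * s = cd X * cd Y" "s > 0" unfolding s_def using pos by auto
  have bs: "\<beta> * s \<le> \<delta> * p ^ 4 * (cd X * cd Y)"
    unfolding s_def using XY by (rule beta_sqrt_le)
  define \<phi> where "\<phi> z z' = (\<lambda>y. g y z * g y z')" for z z'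
  have cardA: "cd {x\<in>X. E x z \<and> E x z'} = cod X z z'" for z z'
    using fin[OF X] a_sym by (simp add: card_filter_eq_sum cod_def of_bool_conj)
  \<comment> \<open>The right-hand side is the main term that \<open>second_moment\<close> will
    produce below, up to \<open>p ^ 2\<close>. Recognising it as the one-sided sum is what allows
    \<open>C4_inherit_one\<close> to be reused.\<close>
  have one: "(\<Sum>x\<in>X. C4 g Y {z\<in>Z. E x z}) = (\<Sum>z\<in>Z. \<Sum>z'\<in>Z. cod X z z' * (\<Sum>y\<in>Y. \<phi> z z' y)\<^sup>2)"
  proof -
    have "(\<Sum>x\<in>X. C4 g Y {z\<in>Z. E x z})
       = (\<Sum>x\<in>X. \<Sum>z\<in>Z. \<Sum>z'\<in>Z. a x z * a x z' * (\<Sum>y\<in>Y. \<phi> z z' y)\<^sup>2)"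
      unfolding C4_swap \<phi>_def
      by (simp only: sum_filter_of_bool[OF fin[OF Z]] sum_distrib_left mult.assoc)
    also have "\<dots> = (\<Sum>z\<in>Z. \<Sum>x\<in>X. \<Sum>z'\<in>Z. a x z * a x z' * (\<Sum>y\<in>Y. \<phi> z z' y)\<^sup>2)"
      by (rule sum.swap)
    also have "\<dots> = (\<Sum>z\<in>Z. \<Sum>z'\<in>Z. \<Sum>x\<in>X. a x z * a x z' * (\<Sum>y\<in>Y. \<phi> z z' y)\<^sup>2)"
      by (rule sum.cong[OF refl], rule sum.swap)
    finally show ?thesis using a_sym by (simp add: cod_def sum_distrib_right)
  qed
  have "(\<Sum>x\<in>X. C4 g {y\<in>Y. E x y} {z\<in>Z. E x z})
     = (\<Sum>x\<in>X. \<Sum>z\<in>Z. \<Sum>z'\<in>Z. of_bool (E x z \<and> E x z') * (\<Sum>y\<in>Y. a x y * \<phi> z z' y)\<^sup>2)"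
    unfolding C4_swap \<phi>_def
    by (simp only: sum_filter_of_bool[OF fin[OF Y]] sum_filter_of_bool[OF fin[OF Z]]
        sum_distrib_left mult.assoc of_bool_conj)
  also have "\<dots> = (\<Sum>z\<in>Z. \<Sum>x\<in>X. \<Sum>z'\<in>Z. of_bool (E x z \<and> E x z') * (\<Sum>y\<in>Y. a x y * \<phi> z z' y)\<^sup>2)"
    by (rule sum.swap)
  also have "\<dots> = (\<Sum>z\<in>Z. \<Sum>z'\<in>Z. \<Sum>x\<in>X. of_bool (E x z \<and> E x z') * (\<Sum>y\<in>Y. a x y * \<phi> z z' y)\<^sup>2)"
    by (rule sum.cong[OF refl], rule sum.swap)
  also have "\<dots> = (\<Sum>z\<in>Z. \<Sum>z'\<in>Z. \<Sum>x\<in>{x\<in>X. E x z \<and> E x z'}. (\<Sum>y\<in>Y. a x y * \<phi> z z' y)\<^sup>2)"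
    using fin[OF X] by (simp add: sum_filter_of_bool)
  also have "\<dots> \<le> (\<Sum>z\<in>Z. \<Sum>z'\<in>Z. cod X z z' * (p * (\<Sum>y\<in>Y. \<phi> z z' y))\<^sup>2
       + 8 * \<beta> * cod Y z z' * sqrt (cod X z z' * cod Y z z'))"
  proof (intro sum_mono)
    fix z z'
    show "(\<Sum>x\<in>{x\<in>X. E x z \<and> E x z'}. (\<Sum>y\<in>Y. a x y * \<phi> z z' y)\<^sup>2)
      \<le> cod X z z' * (p * (\<Sum>y\<in>Y. \<phi> z z' y))\<^sup>2 + 8 * \<beta> * cod Y z z' * sqrt (cod X z z' * cod Y z z')"
      unfolding cardA[symmetric]
    proof (rule second_moment(1)[OF _ Y _ cod_eq])
      fix y
      have "\<bar>\<phi> z z' y\<bar> \<le> a z y * a z' y"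
        unfolding abs_mult \<phi>_def by (intro mult_mono) (use g a_sym in auto)
      then show "\<bar>\<phi> z z' y\<bar> \<le> of_bool (E z y \<and> E z' y)" by (simp add: of_bool_conj)
    qed (use X in auto)
  qed
  also have "\<dots> \<le> (\<Sum>z\<in>Z. \<Sum>z'\<in>Z. p\<^sup>2 * (cod X z z' * (\<Sum>y\<in>Y. \<phi> z z' y)\<^sup>2)
       + (2 * \<beta> * s / cd X * (cd Y / cd X * (cod X z z')\<^sup>2 + cd X / cd Y * (cod Y z z')\<^sup>2)
        + 4 * \<beta> * (cd X / s) * (cod Y z z')\<^sup>2))"
  proof (intro sum_mono)
    fix z z'
    let ?t = "cod Y z z'" and ?u = "cod X z z'"
    \<comment> \<open>Balanced when \<open>?t / ?u = cd Y / cd X\<close>, the typical ratio of the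
      two codegrees. The product \<open>?u * ?t\<close> is split with the same ratio, since only
      separate second moments of the codegrees are at hand.\<close>
    have "sqrt (?u * ?t) \<le> ((s / cd X) * ?u + ?t / (s / cd X)) / 2"
      using s pos p_pos cod_nonneg by (intro sqrt_mult_le_weighted) auto
    then have "8 * \<beta> * ?t * sqrt (?u * ?t) \<le> 8 * \<beta> * ?t * (((s / cd X) * ?u + ?t / (s / cd X)) / 2)"
      using beta_nonneg cod_nonneg pos by (intro mult_left_mono) auto
    also have "\<dots> = 4 * \<beta> * s / cd X * (?u * ?t) + 4 * \<beta> * (cd X / s) * ?t\<^sup>2"
      using s(2) pos by (simp add: power2_eq_square field_simps)
    also have "4 * \<beta> * s / cd X * (?u * ?t) \<le> 4 * \<beta> * s / cd X * ((cd Y / cd X * ?u\<^sup>2 + cd X / cd Y * ?t\<^sup>2) / 2)"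
    proof (rule mult_left_mono)
      have "?u * ?t = sqrt (?u\<^sup>2 * ?t\<^sup>2)" using cod_nonneg by (simp add: real_sqrt_mult)
      also have "\<dots> \<le> ((cd Y / cd X) * ?u\<^sup>2 + ?t\<^sup>2 / (cd Y / cd X)) / 2"
        using pos by (intro sqrt_mult_le_weighted) auto
      finally show "?u * ?t \<le> (cd Y / cd X * ?u\<^sup>2 + cd X / cd Y * ?t\<^sup>2) / 2" by (simp add: mult.commute)
    qed (use beta_nonneg s in auto)
    also have "4 * \<beta> * s / cd X * ((cd Y / cd X * ?u\<^sup>2 + cd X / cd Y * ?t\<^sup>2) / 2)
      = 2 * \<beta> * s / cd X * (cd Y / cd X * ?u\<^sup>2 + cd X / cd Y * ?t\<^sup>2)"
      by simp
    finally show "?u * (p * (\<Sum>y\<in>Y. \<phi> z z' y))\<^sup>2 + 8 * \<beta> * ?t * sqrt (?u * ?t)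
      \<le> p\<^sup>2 * (?u * (\<Sum>y\<in>Y. \<phi> z z' y)\<^sup>2)
       + (2 * \<beta> * s / cd X * (cd Y / cd X * ?u\<^sup>2 + cd X / cd Y * ?t\<^sup>2) + 4 * \<beta> * (cd X / s) * ?t\<^sup>2)"
      by (simp only: power_mult_distrib mult.left_commute[of "cod X z z'"] add_mono add_left_mono)
  qed
  also have "\<dots> = p\<^sup>2 * (\<Sum>x\<in>X. C4 g Y {z\<in>Z. E x z})
     + (2 * \<beta> * s / cd X * (cd Y / cd X * (\<Sum>z\<in>Z. \<Sum>z'\<in>Z. (cod X z z')\<^sup>2) + cd X / cd Y * (\<Sum>z\<in>Z. \<Sum>z'\<in>Z. (cod Y z z')\<^sup>2))
      + 4 * \<beta> * (cd X / s) * (\<Sum>z\<in>Z. \<Sum>z'\<in>Z. (cod Y z z')\<^sup>2))"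
    unfolding one sum.distrib sum_distrib_left distrib_left mult.assoc ..
  also have "\<dots> \<le> p\<^sup>2 * (p\<^sup>2 * cd X * C4 g Y Z + 16 * \<delta> * p ^ 6 * cd X * (cd Y)\<^sup>2 * (cd Z)\<^sup>2)
     + (2 * \<beta> * s / cd X * (cd Y / cd X * (2 * p ^ 4 * (cd Z)\<^sup>2 * (cd X)\<^sup>2) + cd X / cd Y * (2 * p ^ 4 * (cd Z)\<^sup>2 * (cd Y)\<^sup>2))
      + 4 * \<beta> * (cd X / s) * (2 * p ^ 4 * (cd Z)\<^sup>2 * (cd Y)\<^sup>2))"
  proof -
    have 1: "(\<Sum>z\<in>Z. \<Sum>z'\<in>Z. (cod X z z')\<^sup>2) \<le> 2 * p ^ 4 * (cd Z)\<^sup>2 * (cd X)\<^sup>2"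
      using XZ by (intro cod_sum(1)[OF Z X \<delta>]) (simp add: mult.commute[of "cd Z"])
    have 2: "(\<Sum>z\<in>Z. \<Sum>z'\<in>Z. (cod Y z z')\<^sup>2) \<le> 2 * p ^ 4 * (cd Z)\<^sup>2 * (cd Y)\<^sup>2"
      using YZ by (intro cod_sum(1)[OF Z Y \<delta>]) (simp add: mult.commute[of "cd Z"])
    show ?thesis
      using s p_pos beta_nonneg 1 2
      by (intro add_mono mult_left_mono C4_inherit_one[OF X Y Z \<delta> XZ YZ g]) auto
  qed
  also have "\<dots> = p ^ 4 * cd X * C4 g Y Z + 16 * \<delta> * p ^ 8 * cd X * (cd Y)\<^sup>2 * (cd Z)\<^sup>2
     + 16 * p ^ 4 * (cd Z)\<^sup>2 * cd Y * (\<beta> * s)"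
  proof -
    have "4 * \<beta> * (cd X / s) * (2 * p ^ 4 * (cd Z)\<^sup>2 * (cd Y)\<^sup>2) = 8 * p ^ 4 * (cd Z)\<^sup>2 * cd Y * \<beta> * (cd X * cd Y) / s"
      by (simp add: power2_eq_square)
    also have "\<dots> = 8 * p ^ 4 * (cd Z)\<^sup>2 * cd Y * (\<beta> * s)"
      unfolding s(1)[symmetric] using s(2) by simp
    finally have 1: "4 * \<beta> * (cd X / s) * (2 * p ^ 4 * (cd Z)\<^sup>2 * (cd Y)\<^sup>2) = 8 * p ^ 4 * (cd Z)\<^sup>2 * cd Y * (\<beta> * s)" .
    have 2: "2 * \<beta> * s / cd X * (cd Y / cd X * (2 * p ^ 4 * (cd Z)\<^sup>2 * (cd X)\<^sup>2) + cd X / cd Y * (2 * p ^ 4 * (cd Z)\<^sup>2 * (cd Y)\<^sup>2))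
       = 8 * p ^ 4 * (cd Z)\<^sup>2 * cd Y * (\<beta> * s)"
      using pos by (simp add: power2_eq_square field_simps)
    show ?thesis unfolding 1 2 by (simp add: algebra_simps power_add[symmetric])
  qed
  also have "\<dots> \<le> p ^ 4 * cd X * C4 g Y Z + 16 * \<delta> * p ^ 8 * cd X * (cd Y)\<^sup>2 * (cd Z)\<^sup>2
     + 16 * p ^ 4 * (cd Z)\<^sup>2 * cd Y * (\<delta> * p ^ 4 * (cd X * cd Y))"
    using bs p_pos by (intro add_left_mono mult_left_mono) auto
  also have "\<dots> = p ^ 4 * cd X * C4 g Y Z + 32 * \<delta> * p ^ 8 * cd X * (cd Y)\<^sup>2 * (cd Z)\<^sup>2"
    by (simp add: algebra_simps power2_eq_square power_add[symmetric])
  finally show ?thesis .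
qed

text \<open>The exceptional set has at least twice the expected number of edges to \<open>X\<close>,
  so jumbledness gives \<open>p * sqrt (cd ?O * cd X) \<le> \<beta>\<close>. The lemma is what makes
  it affordable for \<open>shrink\<close> to discard these vertices.\<close>

lemma few_large_degrees:
  assumes X: "X \<subseteq> V" and Y: "Y \<subseteq> V" and \<delta>: "0 \<le> \<delta>" "\<delta> \<le> 1"
    and \<beta>: "\<beta> \<le> \<delta> * p ^ 3 * sqrt (cd X * cd Y)"
  shows "cd {q\<in>Y. 2 * p * cd X < (\<Sum>x\<in>X. a q x)} \<le> \<delta> * p * cd Y"
proof (cases "cd X * cd {q\<in>Y. 2 * p * cd X < (\<Sum>x\<in>X. a q x)} = 0")
  case True
  then have "X = {} \<or> cd {q\<in>Y. 2 * p * cd X < (\<Sum>x\<in>X. a q x)} = 0"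
    using fin[OF X] by auto
  then show ?thesis using \<delta> p_pos by auto
next
  case False
  let ?O = "{q\<in>Y. 2 * p * cd X < (\<Sum>x\<in>X. a q x)}"
  have pos: "0 < cd X" "0 < cd ?O" using False by auto
  have "cd ?O * (2 * p * cd X) \<le> (\<Sum>q\<in>?O. \<Sum>x\<in>X. a q x)"
    using sum_bounded_below[of ?O "2 * p * cd X" "\<lambda>q. \<Sum>x\<in>X. a q x"] by auto
  also have "\<dots> \<le> p * cd ?O * cd X + \<beta> * sqrt (cd ?O * cd X)"
  proof -
    have "?O \<subseteq> V" using Y by auto
    from edge_sum[OF this X] show ?thesis by linarith
  qed
  finally have "p * (cd ?O * cd X) \<le> \<beta> * sqrt (cd ?O * cd X)" by (simp add: algebra_simps)
  then have "(p * sqrt (cd ?O * cd X)) * sqrt (cd ?O * cd X) \<le> \<beta> * sqrt (cd ?O * cd X)"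
    by (simp add: mult.assoc)
  then have "p * sqrt (cd ?O * cd X) \<le> \<beta>"
    using pos by (subst (asm) mult_le_cancel_right_pos) auto
  also note \<beta>
  finally have "p * sqrt (cd ?O * cd X) \<le> p * (\<delta> * p\<^sup>2 * sqrt (cd X * cd Y))"
    by (simp add: power2_eq_square power3_eq_cube mult_ac)
  then have "sqrt (cd ?O * cd X) \<le> \<delta> * p\<^sup>2 * sqrt (cd X * cd Y)"
    using p_pos by (subst (asm) mult_le_cancel_left_pos)
  then have "(sqrt (cd ?O * cd X))\<^sup>2 \<le> (\<delta> * p\<^sup>2 * sqrt (cd X * cd Y))\<^sup>2"
    by (intro power_mono) auto
  then have "cd X * cd ?O \<le> cd X * ((\<delta> * p\<^sup>2)\<^sup>2 * cd Y)"
    by (simp add: power_mult_distrib mult_ac)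
  then have "cd ?O \<le> (\<delta> * p\<^sup>2)\<^sup>2 * cd Y"
    using pos by (subst (asm) mult_le_cancel_left_pos)
  also have "\<dots> \<le> \<delta> * p * cd Y"
  proof (rule mult_right_mono)
    have "(\<delta> * p\<^sup>2)\<^sup>2 = (\<delta> * p) * (\<delta> * p ^ 3)" by (simp add: power2_eq_square power3_eq_cube)
    also have "\<dots> \<le> (\<delta> * p) * (1 * 1)"
      using \<delta> p_pos p_le by (intro mult_left_mono mult_mono power_le_one) auto
    finally show "(\<delta> * p\<^sup>2)\<^sup>2 \<le> \<delta> * p" by simp
  qed simp
  finally show ?thesis .
qed

end

section \<open>Regularity of a subgraph\<close>

locale jumbled_subgraph = jumbled +
  fixes R :: "'a \<Rightarrow> 'a \<Rightarrow> bool"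
  assumes R_E: "R x y \<Longrightarrow> E x y" and R_sym: "R x y \<Longrightarrow> R y x"
begin

abbreviation ra :: "'a \<Rightarrow> 'a \<Rightarrow> real" where "ra x y \<equiv> of_bool (R x y)"

text \<open>Subtracting \<open>d * a x y\<close> rather than \<open>d * p\<close> makes the weights vanish outside \<open>E\<close>.\<close>

definition excess :: "real \<Rightarrow> 'a \<Rightarrow> 'a \<Rightarrow> real" where
  "excess d x y = ra x y - d * a x y"

lemma excess_sym: "excess d x y = excess d y x"
  unfolding excess_def using R_sym symE by (auto simp: of_bool_def)

lemma excess_le: "0 \<le> d \<Longrightarrow> d \<le> 1 \<Longrightarrow> \<bar>excess d x y\<bar> \<le> a x y"
  unfolding excess_def using R_E[of x y] by (auto simp: of_bool_def)

lemma excess_sum: "(\<Sum>x\<in>X. \<Sum>y\<in>Y. excess d x y) = (\<Sum>x\<in>X. \<Sum>y\<in>Y. ra x y) - d * (\<Sum>x\<in>X. \<Sum>y\<in>Y. a x y)"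
  unfolding excess_def by (simp add: sum_subtractf sum_distrib_left)

text \<open>Let \<open>B\<close> be the exceptional set. If it were larger, then \<open>E\<close>
  would have at least \<open>3 / 4\<close> of the expected edges between \<open>B\<close> and
  \<open>Y\<close>, of which \<open>R\<close> has a share of at most \<open>d / 2\<close> of the
  expectation; the deficit is at least \<open>d / 4\<close> of the expectation. Its fourth power
  contradicts \<open>cut_le_C4\<close>. One factor \<open>(cd B)^2\<close> cancels there, whence
  \<open>\<theta>^2\<close> and not \<open>\<theta>^4\<close> in the bound on
  \<open>\<kappa>\<close>.\<close>

lemma few_small_degrees:
  assumes X: "X \<subseteq> V" and Y: "Y \<subseteq> V" and d: "0 < d" "d \<le> 1" and \<theta>: "0 < \<theta>" "\<theta> \<le> 1"
    and ne: "X \<noteq> {}" "Y \<noteq> {}"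
    and \<beta>: "\<beta> \<le> \<theta> / 4 * p * sqrt (cd X * cd Y)"
    and C: "C4 (excess d) X Y \<le> \<kappa> * p ^ 4 * (cd X)\<^sup>2 * (cd Y)\<^sup>2" and \<kappa>: "\<kappa> \<le> (d / 4) ^ 4 * \<theta>\<^sup>2"
  shows "cd {x\<in>X. (\<Sum>y\<in>Y. ra x y) < d / 2 * p * cd Y} \<le> \<theta> * cd X"
proof (rule ccontr)
  define B where "B = {x\<in>X. (\<Sum>y\<in>Y. ra x y) < d / 2 * p * cd Y}"
  assume "\<not> ?thesis"
  then have B: "\<theta> * cd X < cd B" unfolding B_def by simp
  have BX: "B \<subseteq> X" unfolding B_def by auto
  have Xp: "0 < cd X" "0 < cd Y" using ne X Y fin by (auto simp: card_gt_0_iff)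
  have Bp: "0 < cd B" using B Xp \<theta> by (smt (verit) mult_pos_pos)
  have 1: "(\<Sum>x\<in>B. \<Sum>y\<in>Y. ra x y) \<le> cd B * (d / 2 * p * cd Y)"
    using sum_bounded_above[of B "\<lambda>x. \<Sum>y\<in>Y. ra x y" "d / 2 * p * cd Y"]
    unfolding B_def by (auto simp: less_imp_le)
  have 2: "p * cd B * cd Y - \<beta> * sqrt (cd B * cd Y) \<le> (\<Sum>x\<in>B. \<Sum>y\<in>Y. a x y)"
    using edge_sum[OF order.trans[OF BX X] Y] by linarith
  have 3: "\<beta> * sqrt (cd B * cd Y) \<le> p * cd B * cd Y / 4"
  proof -
    have "\<beta> * sqrt (cd B * cd Y) \<le> \<theta> / 4 * p * sqrt (cd X * cd Y) * sqrt (cd B * cd Y)"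
      using \<beta> by (intro mult_right_mono) auto
    also have "\<dots> = p * cd Y / 4 * (\<theta> * sqrt (cd X * cd B))"
      by (simp add: real_sqrt_mult)
    also have "\<dots> \<le> p * cd Y / 4 * cd B"
    proof (rule mult_left_mono)
      have "\<theta> * sqrt (cd X * cd B) = sqrt (\<theta>\<^sup>2 * (cd X * cd B))"
        using \<theta> by (simp add: real_sqrt_mult)
      also have "\<dots> \<le> sqrt (cd B * cd B)"
      proof (rule real_sqrt_le_mono)
        have "\<theta>\<^sup>2 * (cd X * cd B) = \<theta> * (\<theta> * cd X) * cd B" by (simp add: power2_eq_square)
        also have "\<dots> \<le> 1 * cd B * cd B" using \<theta> B by (intro mult_right_mono mult_mono) auto
        finally show "\<theta>\<^sup>2 * (cd X * cd B) \<le> cd B * cd B" by simp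
      qed
      finally show "\<theta> * sqrt (cd X * cd B) \<le> cd B" by simp
    qed (use p_pos in auto)
    finally show ?thesis by (simp add: mult_ac)
  qed
  have "(\<Sum>x\<in>B. \<Sum>y\<in>Y. excess d x y) \<le> cd B * (d / 2 * p * cd Y) - d * (p * cd B * cd Y - p * cd B * cd Y / 4)"
    unfolding excess_sum using 1 2 3 d by (intro diff_mono mult_left_mono) auto
  also have "\<dots> = - (d / 4 * p * cd B * cd Y)" by (simp add: algebra_simps)
  finally have "d / 4 * p * cd B * cd Y \<le> - (\<Sum>x\<in>B. \<Sum>y\<in>Y. excess d x y)" by simp
  then have "(d / 4 * p * cd B * cd Y) ^ 4 \<le> (- (\<Sum>x\<in>B. \<Sum>y\<in>Y. excess d x y)) ^ 4"
    using d p_pos by (intro power_mono) auto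
  also have "\<dots> = (\<Sum>x\<in>B. \<Sum>y\<in>Y. excess d x y) ^ 4" by simp
  also have "\<dots> \<le> (cd B)\<^sup>2 * (cd Y)\<^sup>2 * C4 (excess d) B Y" by (rule cut_le_C4)
  also have "\<dots> \<le> (cd B)\<^sup>2 * (cd Y)\<^sup>2 * (\<kappa> * p ^ 4 * (cd X)\<^sup>2 * (cd Y)\<^sup>2)"
    using C4_mono[OF BX order.refl fin[OF X] fin[OF Y], of "excess d"] C by (intro mult_left_mono) auto
  finally have "((cd B)\<^sup>2 * (cd Y) ^ 4 * p ^ 4) * ((d / 4) ^ 4 * (cd B)\<^sup>2) \<le> ((cd B)\<^sup>2 * (cd Y) ^ 4 * p ^ 4) * (\<kappa> * (cd X)\<^sup>2)"
    by (simp add: power_mult_distrib power2_eq_square power4_eq_xxxx mult_ac)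
  then have "(d / 4) ^ 4 * (cd B)\<^sup>2 \<le> \<kappa> * (cd X)\<^sup>2"
    using Bp Xp p_pos by (subst (asm) mult_le_cancel_left_pos) auto
  also have "\<dots> \<le> (d / 4) ^ 4 * \<theta>\<^sup>2 * (cd X)\<^sup>2" using \<kappa> by (intro mult_right_mono) auto
  finally have "(d / 4) ^ 4 * (cd B)\<^sup>2 \<le> (d / 4) ^ 4 * (\<theta> * cd X)\<^sup>2" by (simp add: power_mult_distrib)
  then have "(cd B)\<^sup>2 \<le> (\<theta> * cd X)\<^sup>2" using d by (subst (asm) mult_le_cancel_left_pos) auto
  then have "cd B \<le> \<theta> * cd X" by (rule power2_le_imp_le) (use \<theta> in auto)
  with B show False by simp
qed

text \<open>Regularity as a cut norm bound. Density increments produce regularity in this form,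
  while inheritance is available only for \<open>C4\<close>; hence the conversion in
  \<open>cut_regular_imp_C4\<close>.\<close>

definition cut_regular :: "real \<Rightarrow> real \<Rightarrow> 'a set \<Rightarrow> 'a set \<Rightarrow> bool" where
  "cut_regular \<kappa> d Y Z \<longleftrightarrow> (\<forall>S T. S \<subseteq> Y \<longrightarrow> T \<subseteq> Z \<longrightarrow>
     \<bar>\<Sum>y\<in>S. \<Sum>z\<in>T. excess d y z\<bar> \<le> \<kappa> * p * cd Y * cd Z)"

text \<open>Signs can be absorbed by the same double splitting as in
  \<open>abs_deviation_sum\<close>.\<close>

lemma cut_regular_signs:
  assumes reg: "cut_regular \<kappa> d Y Z" and Y: "finite Y" and Z: "finite Z" and s: "\<And>y. s y \<in> {-1, 1}"
  shows "(\<Sum>z\<in>Z. \<bar>\<Sum>y\<in>Y. s y * excess d y z\<bar>) \<le> 4 * \<kappa> * p * cd Y * cd Z"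
proof -
  have "(\<Sum>z\<in>Z. \<bar>\<Sum>y\<in>Y. s y * excess d y z\<bar>) \<le> 2 * (2 * (\<kappa> * p * cd Y * cd Z))"
  proof (rule sum_abs_le_twice[OF Z])
    fix T assume T: "T \<subseteq> Z"
    have "\<bar>\<Sum>z\<in>T. \<Sum>y\<in>Y. s y * excess d y z\<bar> = \<bar>\<Sum>y\<in>Y. s y * (\<Sum>z\<in>T. excess d y z)\<bar>"
      by (subst sum.swap) (simp add: sum_distrib_left)
    also have "\<dots> \<le> (\<Sum>y\<in>Y. \<bar>\<Sum>z\<in>T. excess d y z\<bar>)"
    proof (rule order.trans[OF sum_abs], rule sum_mono)
      fix y show "\<bar>s y * (\<Sum>z\<in>T. excess d y z)\<bar> \<le> \<bar>\<Sum>z\<in>T. excess d y z\<bar>"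
        using s[of y] by (auto simp: abs_mult)
    qed
    also have "\<dots> \<le> 2 * (\<kappa> * p * cd Y * cd Z)"
      using reg T unfolding cut_regular_def by (intro sum_abs_le_twice[OF Y]) auto
    finally show "\<bar>\<Sum>z\<in>T. \<Sum>y\<in>Y. s y * excess d y z\<bar> \<le> 2 * (\<kappa> * p * cd Y * cd Z)" .
  qed
  then show ?thesis by simp
qed

text \<open>The squares of the signed codegrees \<open>P y y'\<close> are to be summed. Since
  \<open>P\<close> is bounded by the codegree \<open>D\<close> of \<open>E\<close>, and
  \<open>D\<close> is concentrated around \<open>q = p ^ 2 * cd Z\<close>, it is enough to bound the
  sum of their absolute values. With the signs of \<open>P\<close> collected in \<open>h\<close>,
  that sum is a correlation of \<open>excess d\<close> with \<open>h\<close>. Cauchy-Schwarz over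
  the edges of \<open>E\<close>, followed by jumbledness, replaces it by an unrestricted second
  moment of \<open>h\<close>, which cut regularity makes small.\<close>

lemma cut_regular_imp_C4:
  assumes Y: "Y \<subseteq> V" and Z: "Z \<subseteq> V" and d: "0 \<le> d" "d \<le> 1" and \<delta>: "0 \<le> \<delta>" "\<delta> \<le> 1 / 24"
    and \<beta>: "\<beta> \<le> \<delta> * p ^ 3 * sqrt (cd Y * cd Z)"
    and reg: "cut_regular \<kappa> d Y Z" and \<kappa>: "0 \<le> \<kappa>"
    and ne: "Y \<noteq> {}" "Z \<noteq> {}"
  shows "C4 (excess d) Y Z \<le> (2 * sqrt (16 * \<kappa> + 76 * \<delta>) + 112 * \<delta>) * p ^ 4 * (cd Y)\<^sup>2 * (cd Z)\<^sup>2"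
proof -
  have pos: "0 < cd Y" "0 < cd Z" using ne Y Z fin by (auto simp: card_gt_0_iff)
  have finY: "finite Y" and finZ: "finite Z" using Y Z fin by auto
  have \<beta>': "\<beta> \<le> \<delta> * p ^ 3 * sqrt (cd Z * cd Y)" using \<beta> by (simp add: mult.commute)
  define s where "s = sqrt (cd Y * cd Z)"
  have s: "s * s = cd Y * cd Z" "s > 0" unfolding s_def using pos by auto
  have bs: "\<beta> * s \<le> \<delta> * p ^ 3 * (cd Y * cd Z)"
    unfolding s_def using \<beta> by (rule beta_sqrt_le)
  have p31: "p ^ 3 \<le> p\<^sup>2" "p ^ 3 \<le> p"
    using p_pos p_le power_decreasing[of 2 3 p] power_decreasing[of 1 3 p] by auto
  let ?g = "excess d"
  have gb: "\<bar>?g x y\<bar> \<le> a x y" for x y using excess_le d by auto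
  define P where "P y y' = (\<Sum>z\<in>Z. ?g y z * ?g y' z)" for y y'
  define D where "D y y' = cod Z y y'" for y y'
  have PD: "\<bar>P y y'\<bar> \<le> D y y'" for y y'
  proof -
    have "\<bar>P y y'\<bar> \<le> (\<Sum>z\<in>Z. \<bar>?g y z * ?g y' z\<bar>)" unfolding P_def by (rule sum_abs)
    also have "\<dots> \<le> D y y'"
      unfolding D_def cod_def abs_mult by (intro sum_mono mult_mono gb) auto
    finally show ?thesis .
  qed
  define sg where "sg y y' = (if P y y' \<ge> 0 then 1 else - 1 :: real)" for y y'
  define h where "h y z = (\<Sum>y'\<in>Y. sg y y' * ?g y' z)" for y z
  define dg where "dg z = (\<Sum>y\<in>Y. a z y)" for z
  have dg0: "dg z \<ge> 0" for z unfolding dg_def by (intro sum_nonneg) auto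
  have h_cut: "(\<Sum>z\<in>Z. \<bar>h y z\<bar>) \<le> 4 * \<kappa> * p * cd Y * cd Z" for y
    unfolding h_def by (rule cut_regular_signs[OF reg finY finZ]) (auto simp: sg_def)
  have h_dg: "\<bar>h y z\<bar> \<le> dg z" for y z
  proof -
    have "\<bar>h y z\<bar> \<le> (\<Sum>y'\<in>Y. \<bar>sg y y' * ?g y' z\<bar>)" unfolding h_def by (rule sum_abs)
    also have "\<dots> \<le> dg z"
      unfolding dg_def using gb a_sym by (intro sum_mono) (auto simp: sg_def abs_mult)
    finally show ?thesis .
  qed
  have e2: "(\<Sum>y\<in>Y. \<Sum>z\<in>Z. a y z) \<le> 2 * p * (cd Y * cd Z)"
  proof -
    have "(\<Sum>y\<in>Y. \<Sum>z\<in>Z. a y z) \<le> p * cd Y * cd Z + \<beta> * s"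
      using edge_sum[OF Y Z] unfolding s_def by (auto simp: abs_le_iff)
    also have "\<dots> \<le> p * cd Y * cd Z + 1 * p * (cd Y * cd Z)"
      using bs p31 \<delta> p_pos by (intro add_left_mono order.trans[OF bs] mult_right_mono mult_mono) auto
    finally show ?thesis by simp
  qed
  \<comment> \<open>\<open>h\<close> is bounded by the degree \<open>dg z\<close>. Where this is at
    most twice its mean, one factor of \<open>h\<close> is estimated by \<open>2 * p * cd Y\<close>
    and the other by cut regularity; elsewhere \<open>dg z\<close> is at most twice its deviation
    from the mean, and the variance of the degrees takes over.\<close>
  have hsq: "(\<Sum>y\<in>Y. \<Sum>z\<in>Z. (h y z)\<^sup>2) \<le> (8 * \<kappa> + 32 * \<delta>) * p\<^sup>2 * (cd Y) ^ 3 * cd Z"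
  proof -
    have "(\<Sum>z\<in>Z. (h y z)\<^sup>2) \<le> 2 * p * cd Y * (4 * \<kappa> * p * cd Y * cd Z) + 4 * (8 * \<delta> * p\<^sup>2 * (cd Y)\<^sup>2 * cd Z)" for y
    proof -
      have "(\<Sum>z\<in>Z. (h y z)\<^sup>2) \<le> (\<Sum>z\<in>Z. 2 * p * cd Y * \<bar>h y z\<bar> + 4 * (dg z - p * cd Y)\<^sup>2)"
      proof (rule sum_mono)
        fix z
        have hh: "(h y z)\<^sup>2 \<le> dg z * \<bar>h y z\<bar>"
          using mult_right_mono[OF h_dg[of y z], of "\<bar>h y z\<bar>"] by (simp add: power2_eq_square)
        show "(h y z)\<^sup>2 \<le> 2 * p * cd Y * \<bar>h y z\<bar> + 4 * (dg z - p * cd Y)\<^sup>2"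
        proof (cases "dg z \<le> 2 * p * cd Y")
          case True
          then have "dg z * \<bar>h y z\<bar> \<le> 2 * p * cd Y * \<bar>h y z\<bar>" by (intro mult_right_mono) auto
          with hh show ?thesis by (smt (verit) zero_le_power2)
        next
          case False
          then have "(dg z)\<^sup>2 \<le> (2 * (dg z - p * cd Y))\<^sup>2"
            using dg0[of z] by (intro power_mono) auto
          then have "(dg z)\<^sup>2 \<le> 4 * (dg z - p * cd Y)\<^sup>2" by (simp only: power_mult_distrib) simp
          moreover have "dg z * \<bar>h y z\<bar> \<le> (dg z)\<^sup>2"
            unfolding power2_eq_square using h_dg dg0 by (intro mult_left_mono) auto
          moreover have "0 \<le> 2 * p * cd Y * \<bar>h y z\<bar>" using p_pos by auto
          ultimately show ?thesis using hh by linarith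
        qed
      qed
      also have "\<dots> = 2 * p * cd Y * (\<Sum>z\<in>Z. \<bar>h y z\<bar>) + 4 * (\<Sum>z\<in>Z. (dg z - p * cd Y)\<^sup>2)"
        by (simp add: sum.distrib sum_distrib_left)
      also have "\<dots> \<le> 2 * p * cd Y * (4 * \<kappa> * p * cd Y * cd Z) + 4 * (8 * \<delta> * p\<^sup>2 * (cd Y)\<^sup>2 * cd Z)"
      proof (intro add_mono mult_left_mono h_cut)
        have "(\<Sum>z\<in>Z. (dg z - p * cd Y)\<^sup>2) \<le> 8 * cd Y * (\<beta> * s)"
          using degree_square_sum(2)[OF Z Y] unfolding dg_def s_def by (simp add: mult_ac)
        also have "\<dots> \<le> 8 * cd Y * (\<delta> * p\<^sup>2 * (cd Y * cd Z))"
          using bs p31 \<delta> by (intro mult_left_mono order.trans[OF bs] mult_right_mono) auto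
        finally show "(\<Sum>z\<in>Z. (dg z - p * cd Y)\<^sup>2) \<le> 8 * \<delta> * p\<^sup>2 * (cd Y)\<^sup>2 * cd Z"
          by (simp add: power2_eq_square mult_ac)
      qed (use p_pos in auto)
      finally show ?thesis .
    qed
    then have "(\<Sum>y\<in>Y. \<Sum>z\<in>Z. (h y z)\<^sup>2)
      \<le> (\<Sum>y\<in>Y. 2 * p * cd Y * (4 * \<kappa> * p * cd Y * cd Z) + 4 * (8 * \<delta> * p\<^sup>2 * (cd Y)\<^sup>2 * cd Z))"
      by (intro sum_mono)
    also have "\<dots> = (8 * \<kappa> + 32 * \<delta>) * p\<^sup>2 * (cd Y) ^ 3 * cd Z"
      by (simp add: algebra_simps power2_eq_square power3_eq_cube)
    finally show ?thesis .
  qed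
  \<comment> \<open>Restricting the sum to edges should cost a factor \<open>p\<close>. To see this,
    the square of \<open>h\<close> is expanded: each product of two excess weights is supported on a
    common neighbourhood, where the deviation of \<open>a\<close> from \<open>p\<close> is under
    control.\<close>
  have ahsq: "(\<Sum>y\<in>Y. \<Sum>z\<in>Z. a y z * (h y z)\<^sup>2) \<le> (8 * \<kappa> + 38 * \<delta>) * p ^ 3 * (cd Y) ^ 3 * cd Z"
  proof -
    have "(\<Sum>y\<in>Y. \<Sum>z\<in>Z. (a y z - p) * (h y z)\<^sup>2)
       = (\<Sum>y\<in>Y. \<Sum>z\<in>Z. \<Sum>u\<in>Y. \<Sum>v\<in>Y. sg y u * sg y v * ((a y z - p) * (?g u z * ?g v z)))"
      unfolding h_def by (simp add: power2_eq_square sum_product sum_distrib_left mult_ac)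
    also have "\<dots> = (\<Sum>u\<in>Y. \<Sum>v\<in>Y. \<Sum>y\<in>Y. sg y u * sg y v * (\<Sum>z\<in>Z. (a y z - p) * (?g u z * ?g v z)))"
    proof -
      have "(\<Sum>y\<in>Y. \<Sum>z\<in>Z. \<Sum>u\<in>Y. \<Sum>v\<in>Y. f y z u v) = (\<Sum>u\<in>Y. \<Sum>v\<in>Y. \<Sum>y\<in>Y. \<Sum>z\<in>Z. f y z u v)"
        for f :: "'a \<Rightarrow> 'a \<Rightarrow> 'a \<Rightarrow> 'a \<Rightarrow> real"
      proof -
        have "(\<Sum>y\<in>Y. \<Sum>z\<in>Z. \<Sum>u\<in>Y. \<Sum>v\<in>Y. f y z u v) = (\<Sum>y\<in>Y. \<Sum>u\<in>Y. \<Sum>z\<in>Z. \<Sum>v\<in>Y. f y z u v)"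
          by (rule sum.cong[OF refl], rule sum.swap)
        also have "\<dots> = (\<Sum>y\<in>Y. \<Sum>u\<in>Y. \<Sum>v\<in>Y. \<Sum>z\<in>Z. f y z u v)"
          by (rule sum.cong[OF refl], rule sum.cong[OF refl], rule sum.swap)
        also have "\<dots> = (\<Sum>u\<in>Y. \<Sum>y\<in>Y. \<Sum>v\<in>Y. \<Sum>z\<in>Z. f y z u v)" by (rule sum.swap)
        also have "\<dots> = (\<Sum>u\<in>Y. \<Sum>v\<in>Y. \<Sum>y\<in>Y. \<Sum>z\<in>Z. f y z u v)"
          by (rule sum.cong[OF refl], rule sum.swap)
        finally show ?thesis .
      qed
      then show ?thesis by (simp add: sum_distrib_left)
    qed
    also have "\<dots> \<le> (\<Sum>u\<in>Y. \<Sum>v\<in>Y. 2 * \<beta> * p * s + 2 * \<beta> * (cd Y / (p * s)) * D u v)"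
    proof (intro sum_mono)
      fix u v
      have "(\<Sum>y\<in>Y. sg y u * sg y v * (\<Sum>z\<in>Z. (a y z - p) * (?g u z * ?g v z)))
        \<le> (\<Sum>y\<in>Y. \<bar>\<Sum>z\<in>Z. (a y z - p) * (?g u z * ?g v z)\<bar>)"
        by (intro sum_mono) (auto simp: sg_def)
      also have "\<dots> \<le> 4 * \<beta> * sqrt (cd Y * D u v)"
        unfolding D_def cod_eq
      proof (rule abs_deviation_sum_supp[OF Y Z])
        fix z
        have "\<bar>?g u z * ?g v z\<bar> \<le> a u z * a v z"
          unfolding abs_mult by (intro mult_mono gb) auto
        then show "\<bar>?g u z * ?g v z\<bar> \<le> of_bool (E u z \<and> E v z)" by (simp add: of_bool_conj)
      qed
      \<comment> \<open>Balanced at the typical codegree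
        \<open>D u v = p ^ 2 * cd Z\<close>.\<close>
      also have "\<dots> \<le> 4 * \<beta> * (((p * s / cd Y) * cd Y + D u v / (p * s / cd Y)) / 2)"
        using s pos p_pos cod_nonneg beta_nonneg unfolding D_def
        by (intro mult_left_mono sqrt_mult_le_weighted) auto
      also have "\<dots> = 2 * \<beta> * p * s + 2 * \<beta> * (cd Y / (p * s)) * D u v"
        using pos p_pos s by (simp add: field_simps)
      finally show "(\<Sum>y\<in>Y. sg y u * sg y v * (\<Sum>z\<in>Z. (a y z - p) * (?g u z * ?g v z)))
        \<le> 2 * \<beta> * p * s + 2 * \<beta> * (cd Y / (p * s)) * D u v" .
    qed
    also have "\<dots> = 2 * \<beta> * p * s * (cd Y)\<^sup>2 + 2 * \<beta> * (cd Y / (p * s)) * (\<Sum>u\<in>Y. \<Sum>v\<in>Y. D u v)"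
      by (simp add: sum.distrib sum_distrib_left power2_eq_square)
    also have "\<dots> \<le> 2 * \<beta> * p * s * (cd Y)\<^sup>2 + 2 * \<beta> * (cd Y / (p * s)) * (2 * p\<^sup>2 * (cd Y)\<^sup>2 * cd Z)"
      unfolding D_def using cod_sum(2)[OF Y Z \<delta> \<beta>] beta_nonneg p_pos s
      by (intro add_left_mono mult_left_mono) auto
    also have "2 * \<beta> * (cd Y / (p * s)) * (2 * p\<^sup>2 * (cd Y)\<^sup>2 * cd Z) = 4 * \<beta> * p * (cd Y)\<^sup>2 * (cd Y * cd Z) / s"
      using p_pos s by (simp add: power2_eq_square)
    also have "\<dots> = 4 * \<beta> * p * (cd Y)\<^sup>2 * s"
      unfolding s(1)[symmetric] using s(2) by simp
    also have "2 * \<beta> * p * s * (cd Y)\<^sup>2 + 4 * \<beta> * p * (cd Y)\<^sup>2 * s = 6 * p * (cd Y)\<^sup>2 * (\<beta> * s)"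
      by (simp add: algebra_simps)
    also have "\<dots> \<le> 6 * p * (cd Y)\<^sup>2 * (\<delta> * p\<^sup>2 * (cd Y * cd Z))"
      using bs p31 \<delta> p_pos by (intro mult_left_mono order.trans[OF bs] mult_right_mono) auto
    finally have "(\<Sum>y\<in>Y. \<Sum>z\<in>Z. (a y z - p) * (h y z)\<^sup>2) \<le> 6 * \<delta> * p ^ 3 * (cd Y) ^ 3 * cd Z"
      by (simp add: power2_eq_square power3_eq_cube mult_ac)
    moreover have "p * (\<Sum>y\<in>Y. \<Sum>z\<in>Z. (h y z)\<^sup>2) \<le> p * ((8 * \<kappa> + 32 * \<delta>) * p\<^sup>2 * (cd Y) ^ 3 * cd Z)"
      using hsq p_pos by (intro mult_left_mono) auto
    moreover have "(\<Sum>y\<in>Y. \<Sum>z\<in>Z. a y z * (h y z)\<^sup>2)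
      = (\<Sum>y\<in>Y. \<Sum>z\<in>Z. (a y z - p) * (h y z)\<^sup>2) + p * (\<Sum>y\<in>Y. \<Sum>z\<in>Z. (h y z)\<^sup>2)"
      by (simp add: sum_distrib_left sum.distrib[symmetric] left_diff_distrib)
    ultimately show ?thesis by (simp add: algebra_simps power2_eq_square power3_eq_cube)
  qed
  \<comment> \<open>The square root is the one from Cauchy-Schwarz; its argument is the product of
    the constants 2 from \<open>e2\<close> and \<open>8 * \<kappa> + 38 * \<delta>\<close> from
    \<open>ahsq\<close>.\<close>
  define \<rho> where "\<rho> = sqrt (16 * \<kappa> + 76 * \<delta>)"
  have \<rho>: "\<rho> * \<rho> = 16 * \<kappa> + 76 * \<delta>" "\<rho> \<ge> 0" unfolding \<rho>_def using \<kappa> \<delta> by auto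
  have absP: "(\<Sum>y\<in>Y. \<Sum>y'\<in>Y. \<bar>P y y'\<bar>) \<le> \<rho> * p\<^sup>2 * (cd Y)\<^sup>2 * cd Z"
  proof (rule power2_le_imp_le)
    have eq: "(\<Sum>y\<in>Y. \<Sum>y'\<in>Y. \<bar>P y y'\<bar>) = (\<Sum>y\<in>Y. \<Sum>z\<in>Z. ?g y z * h y z)"
    proof (rule sum.cong[OF refl])
      fix y
      have "(\<Sum>y'\<in>Y. \<bar>P y y'\<bar>) = (\<Sum>y'\<in>Y. \<Sum>z\<in>Z. sg y y' * (?g y z * ?g y' z))"
        unfolding sum_distrib_left[symmetric] P_def[symmetric] by (intro sum.cong) (auto simp: sg_def)
      also have "\<dots> = (\<Sum>z\<in>Z. \<Sum>y'\<in>Y. sg y y' * (?g y z * ?g y' z))" by (rule sum.swap)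
      also have "\<dots> = (\<Sum>z\<in>Z. ?g y z * h y z)"
        unfolding h_def by (simp add: sum_distrib_left mult_ac)
      finally show "(\<Sum>y'\<in>Y. \<bar>P y y'\<bar>) = (\<Sum>z\<in>Z. ?g y z * h y z)" .
    qed
    \<comment> \<open>The indicator \<open>a\<close> is written twice, so that after Cauchy-Schwarz
      each of the two factors is a sum over edges only.\<close>
    have le: "(\<Sum>y\<in>Y. \<Sum>z\<in>Z. ?g y z * h y z) \<le> (\<Sum>w\<in>Y \<times> Z. a (fst w) (snd w) * (a (fst w) (snd w) * \<bar>h (fst w) (snd w)\<bar>))"
      unfolding sum.cartesian_product
    proof (rule sum_mono, clarsimp simp only: split_def fst_conv snd_conv)
      fix y z
      have "?g y z * h y z \<le> \<bar>?g y z\<bar> * \<bar>h y z\<bar>" by (metis abs_ge_self abs_mult)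
      also have "\<dots> \<le> a y z * \<bar>h y z\<bar>" by (intro mult_right_mono gb) auto
      finally show "?g y z * h y z \<le> a y z * (a y z * \<bar>h y z\<bar>)" by (auto simp: of_bool_def)
    qed
    have "(\<Sum>y\<in>Y. \<Sum>y'\<in>Y. \<bar>P y y'\<bar>)\<^sup>2
      \<le> (\<Sum>w\<in>Y \<times> Z. a (fst w) (snd w) * (a (fst w) (snd w) * \<bar>h (fst w) (snd w)\<bar>))\<^sup>2"
      using le unfolding eq[symmetric] by (intro power_mono) (auto intro: sum_nonneg)
    also have "\<dots> \<le> (\<Sum>w\<in>Y \<times> Z. (a (fst w) (snd w))\<^sup>2) * (\<Sum>w\<in>Y \<times> Z. (a (fst w) (snd w) * \<bar>h (fst w) (snd w)\<bar>)\<^sup>2)"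
      by (rule Cauchy_Schwarz_ineq_sum)
    also have "\<dots> = (\<Sum>y\<in>Y. \<Sum>z\<in>Z. a y z) * (\<Sum>y\<in>Y. \<Sum>z\<in>Z. a y z * (h y z)\<^sup>2)"
      proof -
      have "(a y z)\<^sup>2 = a y z" for y z by (simp add: of_bool_def power2_eq_square)
      then show ?thesis unfolding sum.cartesian_product by (simp add: power_mult_distrib split_def)
    qed
    also have "\<dots> \<le> (2 * p * (cd Y * cd Z)) * ((8 * \<kappa> + 38 * \<delta>) * p ^ 3 * (cd Y) ^ 3 * cd Z)"
      using p_pos by (intro mult_mono e2 ahsq) (auto intro!: sum_nonneg)
    also have "\<dots> = (16 * \<kappa> + 76 * \<delta>) * (p\<^sup>2 * (cd Y)\<^sup>2 * cd Z)\<^sup>2"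
      by (simp add: algebra_simps power2_eq_square power3_eq_cube)
    also have "\<dots> = (\<rho> * p\<^sup>2 * (cd Y)\<^sup>2 * cd Z)\<^sup>2"
      unfolding \<rho>(1)[symmetric] by (simp add: power2_eq_square mult_ac)
    finally show "(\<Sum>y\<in>Y. \<Sum>y'\<in>Y. \<bar>P y y'\<bar>)\<^sup>2 \<le> (\<rho> * p\<^sup>2 * (cd Y)\<^sup>2 * cd Z)\<^sup>2" .
  qed (use \<rho> p_pos in auto)
  define q where "q = p\<^sup>2 * cd Z"
  \<comment> \<open>The square is expanded: \<open>codegree_square_sum\<close> bounds the second
    moment from above, and the first moment is bounded from below as the sum of the squared degrees
    \<open>dg z\<close>. The constant is \<open>24 + 4\<close>.\<close>
  have varD: "(\<Sum>y\<in>Y. \<Sum>y'\<in>Y. (D y y' - q)\<^sup>2) \<le> 28 * \<delta> * p ^ 4 * (cd Y)\<^sup>2 * (cd Z)\<^sup>2"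
  proof -
    have "(\<Sum>y\<in>Y. \<Sum>y'\<in>Y. D y y') = (\<Sum>z\<in>Z. (dg z)\<^sup>2)"
    proof -
      have "(\<Sum>y\<in>Y. \<Sum>y'\<in>Y. D y y') = (\<Sum>y\<in>Y. \<Sum>z\<in>Z. \<Sum>y'\<in>Y. a y z * a y' z)"
        unfolding D_def cod_def by (rule sum.cong[OF refl], rule sum.swap)
      also have "\<dots> = (\<Sum>z\<in>Z. \<Sum>y\<in>Y. \<Sum>y'\<in>Y. a y z * a y' z)" by (rule sum.swap)
      also have "\<dots> = (\<Sum>z\<in>Z. (dg z)\<^sup>2)"
        unfolding dg_def power2_eq_square sum_product using a_sym by (intro sum.cong refl) metis
      finally show ?thesis .
    qed
    moreover have "(1 - 2 * \<delta>) * p\<^sup>2 * (cd Y)\<^sup>2 * cd Z \<le> (\<Sum>z\<in>Z. (dg z)\<^sup>2)"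
    proof -
      have "\<beta> * s \<le> \<delta> * p * (cd Y * cd Z)"
        using bs p31 \<delta> by (intro order.trans[OF bs] mult_right_mono mult_left_mono) auto
      then have "(1 - \<delta>) * p * (cd Y * cd Z) \<le> (\<Sum>z\<in>Z. dg z)"
        using edge_sum[OF Z Y] unfolding dg_def s_def by (simp add: algebra_simps abs_le_iff)
      then have "((1 - \<delta>) * p * (cd Y * cd Z))\<^sup>2 \<le> (\<Sum>z\<in>Z. dg z)\<^sup>2"
        using \<delta> p_pos by (intro power_mono) auto
      also have "\<dots> \<le> (\<Sum>z\<in>Z. (dg z)\<^sup>2) * cd Z" by (rule sum_squared_le_sum_of_squares)
      finally have "((1 - \<delta>)\<^sup>2 * p\<^sup>2 * (cd Y)\<^sup>2 * cd Z) * cd Z \<le> (\<Sum>z\<in>Z. (dg z)\<^sup>2) * cd Z"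
        by (simp add: power2_eq_square mult_ac)
      then have "(1 - \<delta>)\<^sup>2 * p\<^sup>2 * (cd Y)\<^sup>2 * cd Z \<le> (\<Sum>z\<in>Z. (dg z)\<^sup>2)"
        using pos by (subst (asm) mult_le_cancel_right_pos)
      moreover have "(1 - 2 * \<delta>) * p\<^sup>2 * (cd Y)\<^sup>2 * cd Z \<le> (1 - \<delta>)\<^sup>2 * p\<^sup>2 * (cd Y)\<^sup>2 * cd Z"
        by (intro mult_right_mono) (auto simp: power2_eq_square algebra_simps)
      ultimately show ?thesis by simp
    qed
    ultimately have sD: "(1 - 2 * \<delta>) * p\<^sup>2 * (cd Y)\<^sup>2 * cd Z \<le> (\<Sum>y\<in>Y. \<Sum>y'\<in>Y. D y y')" by simp
    have "(\<Sum>y\<in>Y. \<Sum>y'\<in>Y. (D y y' - q)\<^sup>2) = (\<Sum>y\<in>Y. \<Sum>y'\<in>Y. (D y y')\<^sup>2 - 2 * q * D y y' + q\<^sup>2)"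
      by (intro sum.cong refl) (simp add: power2_eq_square algebra_simps)
    also have "\<dots> = (\<Sum>y\<in>Y. \<Sum>y'\<in>Y. (D y y')\<^sup>2) - 2 * q * (\<Sum>y\<in>Y. \<Sum>y'\<in>Y. D y y') + (cd Y)\<^sup>2 * q\<^sup>2"
      by (simp add: sum.distrib sum_subtractf sum_distrib_left power2_eq_square)
    also have "\<dots> \<le> (1 + 24 * \<delta>) * p ^ 4 * (cd Y)\<^sup>2 * (cd Z)\<^sup>2
       - 2 * q * ((1 - 2 * \<delta>) * p\<^sup>2 * (cd Y)\<^sup>2 * cd Z) + (cd Y)\<^sup>2 * q\<^sup>2"
      using codegree_square_sum[OF Y Z \<delta> \<beta>] sD p_pos unfolding D_def q_def
      by (intro add_right_mono diff_mono mult_left_mono) auto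
    also have "\<dots> = 28 * \<delta> * p ^ 4 * (cd Y)\<^sup>2 * (cd Z)\<^sup>2"
      unfolding q_def by (simp add: algebra_simps power2_eq_square power4_eq_xxxx)
    finally show ?thesis .
  qed
  have "C4 ?g Y Z = (\<Sum>y\<in>Y. \<Sum>y'\<in>Y. (P y y')\<^sup>2)" unfolding C4_def P_def ..
  \<comment> \<open>The same truncation as for \<open>hsq\<close>, now with the codegree and twice
    its typical value \<open>q\<close>.\<close>
  also have "\<dots> \<le> (\<Sum>y\<in>Y. \<Sum>y'\<in>Y. 2 * q * \<bar>P y y'\<bar> + 4 * (D y y' - q)\<^sup>2)"
  proof (intro sum_mono)
    fix y y'
    have PP: "(P y y')\<^sup>2 \<le> D y y' * \<bar>P y y'\<bar>"
      using mult_right_mono[OF PD[of y y'], of "\<bar>P y y'\<bar>"] by (simp add: power2_eq_square)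
    have q0: "0 \<le> q" unfolding q_def using p_pos by auto
    have D0: "0 \<le> D y y'" unfolding D_def by (rule cod_nonneg)
    show "(P y y')\<^sup>2 \<le> 2 * q * \<bar>P y y'\<bar> + 4 * (D y y' - q)\<^sup>2"
    proof (cases "D y y' \<le> 2 * q")
      case True
      then have "D y y' * \<bar>P y y'\<bar> \<le> 2 * q * \<bar>P y y'\<bar>" by (intro mult_right_mono) auto
      with PP show ?thesis by (smt (verit) zero_le_power2)
    next
      case False
      then have "(D y y')\<^sup>2 \<le> (2 * (D y y' - q))\<^sup>2"
        using D0 by (intro power_mono) auto
      then have "(D y y')\<^sup>2 \<le> 4 * (D y y' - q)\<^sup>2" by (simp only: power_mult_distrib) simp
      moreover have "D y y' * \<bar>P y y'\<bar> \<le> (D y y')\<^sup>2"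
        unfolding power2_eq_square using PD D0 by (intro mult_left_mono) auto
      moreover have "0 \<le> 2 * q * \<bar>P y y'\<bar>" using q0 by auto
      ultimately show ?thesis using PP by linarith
    qed
  qed
  also have "\<dots> = 2 * q * (\<Sum>y\<in>Y. \<Sum>y'\<in>Y. \<bar>P y y'\<bar>) + 4 * (\<Sum>y\<in>Y. \<Sum>y'\<in>Y. (D y y' - q)\<^sup>2)"
    by (simp add: sum.distrib sum_distrib_left)
  also have "\<dots> \<le> 2 * q * (\<rho> * p\<^sup>2 * (cd Y)\<^sup>2 * cd Z) + 4 * (28 * \<delta> * p ^ 4 * (cd Y)\<^sup>2 * (cd Z)\<^sup>2)"
    using absP varD p_pos unfolding q_def[symmetric] by (intro add_mono mult_left_mono) (auto simp: q_def)
  also have "\<dots> = (2 * \<rho> + 112 * \<delta>) * p ^ 4 * (cd Y)\<^sup>2 * (cd Z)\<^sup>2"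
    unfolding q_def by (simp add: algebra_simps power2_eq_square power4_eq_xxxx)
  finally show ?thesis unfolding \<rho>_def .
qed

end

section \<open>Density increments and regular subpairs\<close>

abbreviation esum :: "('a \<Rightarrow> 'a \<Rightarrow> bool) \<Rightarrow> 'a set \<Rightarrow> 'a set \<Rightarrow> real" where
  "esum R X Y \<equiv> (\<Sum>x\<in>X. \<Sum>y\<in>Y. of_bool (R x y))"

lemma esum_mono:
  assumes "X' \<subseteq> X" "Y' \<subseteq> Y" "finite X" "finite Y"
  shows "esum R X' Y' \<le> esum R X Y"
  using assms by (intro order.trans[OF sum_mono2[of X X'] sum_mono] sum_mono2 sum_nonneg) auto

context jumbled_subgraph
begin

text \<open>Dividing by the actual number of edges of \<open>E\<close>, and not by
  \<open>p * cd A * cd B\<close>, makes the total excess vanish exactly and bounds the density by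
  exactly 1. Without edges the value is 0.\<close>

definition rel_density :: "'a set \<Rightarrow> 'a set \<Rightarrow> real" where
  "rel_density A B = esum R A B / esum E A B"

lemma esum_R_le: "esum R A B \<le> esum E A B"
  by (intro sum_mono) (auto simp: R_E)

lemma rel_density_le: "rel_density A B \<le> 1"
proof -
  have "0 \<le> esum E A B" by (intro sum_nonneg) auto
  then consider "esum E A B = 0" | "0 < esum E A B" by linarith
  then show ?thesis
    unfolding rel_density_def
  proof cases
    case 2
    with esum_R_le[where A = A and B = B] show "esum R A B / esum E A B \<le> 1" by (simp only: divide_le_eq_1_pos)
  qed simp
qed

lemma esum_E_bounds:
  assumes A: "A \<subseteq> V" and B: "B \<subseteq> V" and \<beta>: "\<beta> \<le> \<eta> * p * sqrt (cd A * cd B)"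
  shows "esum E A B \<le> (1 + \<eta>) * p * (cd A * cd B)" "(1 - \<eta>) * p * (cd A * cd B) \<le> esum E A B"
  using edge_sum[OF A B] beta_sqrt_le[OF \<beta>] by (auto simp: algebra_simps abs_le_iff)

text \<open>A violating pair cuts \<open>A \<times> B\<close> into four blocks of total excess 0, so
  one block has positive excess at least a third of the violation. As \<open>E\<close> has at most
  \<open>2 * p * cd A * cd B\<close> edges, this raises the density by
  \<open>\<kappa> / 6\<close>.\<close>

lemma density_increment:
  assumes A: "A \<subseteq> V" and B: "B \<subseteq> V" and ne: "A \<noteq> {}" "B \<noteq> {}" and \<kappa>: "0 < \<kappa>" "\<kappa> \<le> 1"
    and \<beta>: "\<beta> \<le> \<kappa> / 6 * p * sqrt (cd A * cd B)"
    and nreg: "\<not> cut_regular \<kappa> (rel_density A B) A B"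
  obtains A' B' where "A' \<subseteq> A" "B' \<subseteq> B" "\<kappa> / 6 * cd A \<le> cd A'" "\<kappa> / 6 * cd B \<le> cd B'"
    "rel_density A B + \<kappa> / 6 \<le> rel_density A' B'"
proof -
  let ?d = "rel_density A B"
  have pos: "0 < cd A" "0 < cd B" using ne A B fin by (auto simp: card_gt_0_iff)
  have finA: "finite A" and finB: "finite B" using A B fin by auto
  let ?g = "\<lambda>X Y. \<Sum>x\<in>X. \<Sum>y\<in>Y. excess ?d x y"
  have E2: "esum E A B \<le> 2 * p * (cd A * cd B)"
    using \<kappa> p_pos by (intro order.trans[OF esum_E_bounds(1)[OF A B \<beta>]] mult_right_mono) auto
  have "0 < (1 - \<kappa> / 6) * p * (cd A * cd B)" using \<kappa> p_pos pos by auto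
  then have E0: "0 < esum E A B" using esum_E_bounds(2)[OF A B \<beta>] by linarith
  have tot: "?g A B = 0" unfolding excess_sum rel_density_def using E0 by simp
  obtain S T where ST: "S \<subseteq> A" "T \<subseteq> B" "\<kappa> * p * cd A * cd B < \<bar>?g S T\<bar>"
    using nreg unfolding cut_regular_def by (auto simp: not_le)
  have split1: "?g X B = ?g X T + ?g X (B - T)" for X
  proof -
    have "(\<Sum>y\<in>B. excess ?d x y) = (\<Sum>y\<in>T. excess ?d x y) + (\<Sum>y\<in>B - T. excess ?d x y)" for x
      using sum.subset_diff[OF ST(2) finB, of "excess ?d x"] by simp
    then show ?thesis by (simp add: sum.distrib)
  qed
  have split2: "?g A Y = ?g S Y + ?g (A - S) Y" for Y
    using sum.subset_diff[OF ST(1) finA] by (simp add: add.commute)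
  have four: "?g S T + ?g S (B - T) + ?g (A - S) T + ?g (A - S) (B - T) = 0"
    using tot split1[of S] split1[of "A - S"] split2[of B] by linarith
  let ?k = "\<kappa> / 3 * p * cd A * cd B"
  have k: "\<kappa> * p * cd A * cd B = 3 * ?k" by simp
  have "0 < ?k" using \<kappa> p_pos pos by auto
  \<comment> \<open>If the excess of \<open>S\<close> and \<open>T\<close> is negative, the other
    three blocks together compensate for it.\<close>
  then have "?k \<le> ?g S T \<or> ?k \<le> ?g S (B - T) \<or> ?k \<le> ?g (A - S) T \<or> ?k \<le> ?g (A - S) (B - T)"
    using four ST(3) unfolding k by linarith
  then obtain A' B' where A': "A' \<subseteq> A" and B': "B' \<subseteq> B" and g: "?k \<le> ?g A' B'"
    using ST(1,2) by (meson Diff_subset)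
  have g': "?d * esum E A' B' + ?k \<le> esum R A' B'" using g unfolding excess_sum by simp
  have d0: "0 \<le> ?d" unfolding rel_density_def using E0 by (intro divide_nonneg_nonneg sum_nonneg) auto
  have E'0: "0 \<le> esum E A' B'" by (intro sum_nonneg) auto
  have kE: "?k \<le> esum E A' B'"
    using g' esum_R_le[where A = A' and B = B'] mult_nonneg_nonneg[OF d0 E'0] by linarith
  then have E'pos: "0 < esum E A' B'" using \<open>0 < ?k\<close> by linarith
  have E'2: "esum E A' B' \<le> 2 * p * (cd A * cd B)"
    using esum_mono[OF A' B' finA finB, of E] E2 by linarith
  have "\<kappa> / 6 * esum E A' B' \<le> \<kappa> / 6 * (2 * p * (cd A * cd B))"
    using E'2 \<kappa> by (intro mult_left_mono) auto
  then have "(?d + \<kappa> / 6) * esum E A' B' \<le> esum R A' B'" using g' by (simp add: algebra_simps)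
  then have inc: "?d + \<kappa> / 6 \<le> rel_density A' B'" unfolding rel_density_def using E'pos by (simp add: pos_le_divide_eq)
  \<comment> \<open>The positive excess also forces many edges of \<open>E\<close>, so by
    jumbledness the block cannot be thin in either direction.\<close>
  have "?k \<le> p * cd A' * cd B' + \<beta> * sqrt (cd A' * cd B')"
    using kE edge_sum[OF order.trans[OF A' A] order.trans[OF B' B]] by linarith
  also have "\<beta> * sqrt (cd A' * cd B') \<le> \<beta> * sqrt (cd A * cd B)"
    using A' B' finA finB beta_nonneg
    by (intro mult_left_mono real_sqrt_le_mono mult_mono) (auto intro: card_mono)
  also have "\<dots> \<le> \<kappa> / 6 * p * (cd A * cd B)" by (rule beta_sqrt_le[OF \<beta>])
  finally have "p * (\<kappa> / 6 * (cd A * cd B)) \<le> p * (cd A' * cd B')" by (simp add: algebra_simps)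
  then have prod: "\<kappa> / 6 * (cd A * cd B) \<le> cd A' * cd B'" using p_pos by simp
  have "cd A' \<le> cd A" "cd B' \<le> cd B" using A' B' finA finB by (auto intro: card_mono)
  then have "cd A' * cd B' \<le> cd A' * cd B" "cd A' * cd B' \<le> cd A * cd B'"
    by (auto intro: mult_left_mono mult_right_mono)
  then have "cd B * (\<kappa> / 6 * cd A) \<le> cd B * cd A'" "cd A * (\<kappa> / 6 * cd B) \<le> cd A * cd B'"
    using prod by (auto simp: mult_ac)
  then have "\<kappa> / 6 * cd A \<le> cd A'" "\<kappa> / 6 * cd B \<le> cd B'"
    using pos by (simp_all only: mult_le_cancel_left_pos)
  with A' B' inc that show thesis by blast
qed

text \<open>The number \<open>k\<close> counts the increments still possible before the density
  would exceed 1; at \<open>k = 0\<close> a further one is contradictory. Each increment shrinks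
  both sets by at most \<open>\<kappa> / 6\<close>, and the power \<open>Suc k\<close> in the bound
  on \<open>\<beta>\<close> leaves one factor for the last application.\<close>

lemma regular_subpair:
  assumes "A \<subseteq> V" "B \<subseteq> V" "A \<noteq> {}" "B \<noteq> {}" and \<kappa>: "0 < \<kappa>" "\<kappa> \<le> 1"
    and "\<beta> \<le> (\<kappa> / 6) ^ Suc k * p * sqrt (cd A * cd B)" "1 - real k * (\<kappa> / 6) \<le> rel_density A B"
  shows "\<exists>A' B' d. A' \<subseteq> A \<and> B' \<subseteq> B \<and> (\<kappa> / 6) ^ k * cd A \<le> cd A' \<and> (\<kappa> / 6) ^ k * cd B \<le> cd B' \<and>
    rel_density A B \<le> d \<and> d \<le> 1 \<and> cut_regular \<kappa> d A' B'"
  using assms(1-4,7,8)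
proof (induction k arbitrary: A B)
  case (0 A B)
  show ?case
  proof (cases "cut_regular \<kappa> (rel_density A B) A B")
    case True
    show ?thesis
      by (rule exI[of _ A], rule exI[of _ B], rule exI[of _ "rel_density A B"]) (use True in \<open>auto simp: rel_density_le\<close>)
  next
    case False
    have "\<beta> \<le> \<kappa> / 6 * p * sqrt (cd A * cd B)" using 0(5) by simp
    from density_increment[OF 0(1-4) \<kappa> this False]
    obtain A' B' where "rel_density A B + \<kappa> / 6 \<le> rel_density A' B'" by metis
    then show ?thesis using 0(6) \<kappa> rel_density_le[of A' B'] by auto
  qed
next
  case (Suc k A B)
  show ?case
  proof (cases "cut_regular \<kappa> (rel_density A B) A B")
    case True
    have "(\<kappa> / 6) ^ Suc k * cd X \<le> cd X" for X :: "'a set"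
      using \<kappa> by (intro mult_left_le_one_le power_le_one) auto
    then show ?thesis
      by - (rule exI[of _ A], rule exI[of _ B], rule exI[of _ "rel_density A B"], use True in \<open>auto simp: rel_density_le simp del: power_Suc\<close>)
  next
    case False
    have "(\<kappa> / 6) ^ Suc (Suc k) \<le> (\<kappa> / 6) ^ 1" using \<kappa> by (intro power_decreasing) auto
    then have "\<beta> \<le> \<kappa> / 6 * p * sqrt (cd A * cd B)"
      using p_pos by (intro order.trans[OF Suc.prems(5)] mult_right_mono) auto
    from density_increment[OF Suc.prems(1-4) \<kappa> this False]
    obtain A' B' where A': "A' \<subseteq> A" "\<kappa> / 6 * cd A \<le> cd A'" and B': "B' \<subseteq> B" "\<kappa> / 6 * cd B \<le> cd B'"
      and inc: "rel_density A B + \<kappa> / 6 \<le> rel_density A' B'" by metis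
    have pos: "0 < cd A" "0 < cd B" using Suc.prems(1-4) fin by (auto simp: card_gt_0_iff)
    have ne': "A' \<noteq> {}" "B' \<noteq> {}" using A'(2) B'(2) pos \<kappa> by (auto simp: mult_le_0_iff)
    have "\<beta> \<le> (\<kappa> / 6) ^ Suc k * p * sqrt ((\<kappa> / 6 * cd A) * (\<kappa> / 6 * cd B))"
    proof -
      have "sqrt ((\<kappa> / 6 * cd A) * (\<kappa> / 6 * cd B)) = sqrt ((\<kappa> / 6)\<^sup>2 * (cd A * cd B))"
        by (simp add: power2_eq_square mult_ac)
      also have "\<dots> = \<kappa> / 6 * sqrt (cd A * cd B)"
        unfolding real_sqrt_mult[of "(\<kappa> / 6)\<^sup>2"] real_sqrt_abs using \<kappa> by simp
      finally have eq: "sqrt ((\<kappa> / 6 * cd A) * (\<kappa> / 6 * cd B)) = \<kappa> / 6 * sqrt (cd A * cd B)" .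
      show ?thesis using Suc.prems(5) unfolding eq by (simp add: mult_ac)
    qed
    also have "\<dots> \<le> (\<kappa> / 6) ^ Suc k * p * sqrt (cd A' * cd B')"
      using A'(2) B'(2) \<kappa> p_pos by (intro mult_left_mono real_sqrt_le_mono mult_mono) auto
    finally have \<beta>': "\<beta> \<le> (\<kappa> / 6) ^ Suc k * p * sqrt (cd A' * cd B')" .
    have rel_density': "1 - real k * (\<kappa> / 6) \<le> rel_density A' B'" 
    proof -
      have "real (Suc k) * (\<kappa> / 6) = real k * (\<kappa> / 6) + \<kappa> / 6" by (simp add: algebra_simps)
      then show ?thesis using inc Suc.prems(6) by linarith
    qed
    obtain A'' B'' d where *: "A'' \<subseteq> A'" "B'' \<subseteq> B'" "(\<kappa> / 6) ^ k * cd A' \<le> cd A''" "(\<kappa> / 6) ^ k * cd B' \<le> cd B''"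
      "rel_density A' B' \<le> d" "d \<le> 1" "cut_regular \<kappa> d A'' B''"
      using Suc.IH[OF _ _ ne' \<beta>' rel_density'] A'(1) B'(1) Suc.prems(1,2) by blast
    have "(\<kappa> / 6) ^ k * (\<kappa> / 6 * cd A) \<le> (\<kappa> / 6) ^ k * cd A'" "(\<kappa> / 6) ^ k * (\<kappa> / 6 * cd B) \<le> (\<kappa> / 6) ^ k * cd B'"
      using A'(2) B'(2) \<kappa> by (auto intro!: mult_left_mono)
    then have "(\<kappa> / 6) ^ Suc k * cd A \<le> cd A''" "(\<kappa> / 6) ^ Suc k * cd B \<le> cd B''"
      using *(3,4) by (auto simp: mult_ac)
    moreover have "rel_density A B \<le> d" using *(5) inc \<kappa> by auto
    ultimately show ?thesis using * A'(1) B'(1) by (meson order.trans)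
  qed
qed

end

text \<open>Later pairs are regularised inside the sets obtained for earlier pairs, so the first pair
  is made regular with respect to a parameter that survives the shrinking still to come.\<close>

lemma regular_family:
  fixes prs :: "(nat \<times> nat) list" and \<epsilon> \<kappa> :: real
  assumes \<epsilon>: "0 < \<epsilon>" "\<epsilon> \<le> 1" and \<kappa>: "0 < \<kappa>" "\<kappa> \<le> 1" and prs: "\<forall>(i, j)\<in>set prs. i \<noteq> j"
  shows "\<exists>c. 0 < c \<and> c \<le> 1 \<and> (\<forall>(V :: 'a set) E p \<beta> R Vs L. jumbled_subgraph V E p \<beta> R \<longrightarrow> (\<forall>i. Vs i \<subseteq> V) \<longrightarrow>
    0 < L \<longrightarrow> (\<forall>i. L \<le> cd (Vs i)) \<longrightarrow> \<beta> \<le> c * p * L \<longrightarrow>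
    (\<forall>(i, j)\<in>set prs. \<forall>A B. A \<subseteq> Vs i \<longrightarrow> B \<subseteq> Vs j \<longrightarrow> c * cd (Vs i) \<le> cd A \<longrightarrow> c * cd (Vs j) \<le> cd B
       \<longrightarrow> \<epsilon> * p * cd A * cd B \<le> esum R A B) \<longrightarrow>
    (\<exists>Vs'. (\<forall>i. Vs' i \<subseteq> Vs i \<and> c * cd (Vs i) \<le> cd (Vs' i)) \<and>
       (\<forall>(i, j)\<in>set prs. \<exists>d. \<epsilon> / 2 \<le> d \<and> d \<le> 1 \<and> jumbled_subgraph.cut_regular E p R \<kappa> d (Vs' i) (Vs' j))))"
  using prs
proof (induction prs)
  case Nil
  show ?case by (intro exI[of _ 1]) auto
next
  case (Cons q prs)
  obtain i j where q: "q = (i, j)" by force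
  have ij: "i \<noteq> j" using Cons.prems q by auto
  obtain c1 where c1: "0 < c1" "c1 \<le> 1" and IH: "\<And>(V :: 'a set) E p \<beta> R Vs L. jumbled_subgraph V E p \<beta> R \<Longrightarrow> (\<forall>i. Vs i \<subseteq> V) \<Longrightarrow>
    0 < L \<Longrightarrow> (\<forall>i. L \<le> cd (Vs i)) \<Longrightarrow> \<beta> \<le> c1 * p * L \<Longrightarrow>
    (\<forall>(i, j)\<in>set prs. \<forall>A B. A \<subseteq> Vs i \<longrightarrow> B \<subseteq> Vs j \<longrightarrow> c1 * cd (Vs i) \<le> cd A \<longrightarrow> c1 * cd (Vs j) \<le> cd B
       \<longrightarrow> \<epsilon> * p * cd A * cd B \<le> esum R A B) \<Longrightarrow>
    (\<exists>Vs'. (\<forall>i. Vs' i \<subseteq> Vs i \<and> c1 * cd (Vs i) \<le> cd (Vs' i)) \<and>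
       (\<forall>(i, j)\<in>set prs. \<exists>d. \<epsilon> / 2 \<le> d \<and> d \<le> 1 \<and> jumbled_subgraph.cut_regular E p R \<kappa> d (Vs' i) (Vs' j)))"
    using Cons by (auto 0 4)
  \<comment> \<open>The bound of \<open>cut_regular\<close> is relative to the product of the two
    sizes, each of which may still shrink by a factor \<open>c1\<close>.\<close>
  define \<kappa>' where "\<kappa>' = \<kappa> * c1\<^sup>2"
  have \<kappa>': "0 < \<kappa>'" "\<kappa>' \<le> 1" unfolding \<kappa>'_def using \<kappa> c1 by (auto intro!: mult_le_one power_le_one)
  \<comment> \<open>With this \<open>k\<close> the density hypothesis of
    \<open>regular_subpair\<close> holds for every nonnegative density.\<close>
  obtain k :: nat where k: "1 / (\<kappa>' / 6) \<le> real k" using real_arch_simple by blast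
  define e where "e = (\<kappa>' / 6) ^ k"
  have e: "0 < e" "e \<le> 1" unfolding e_def using \<kappa>' by (auto intro!: power_le_one)
  \<comment> \<open>The factor \<open>c1 * e\<close> is the total shrinking;
    \<open>\<kappa>' / 6\<close> provides the additional power in the bound on
    \<open>\<beta>\<close> required by \<open>regular_subpair\<close>.\<close>
  define c where "c = c1 * e * (\<kappa>' / 6)"
  have c: "0 < c" "c \<le> c1 * e" "c \<le> e * (\<kappa>' / 6)" "c \<le> 1" "c \<le> \<kappa>' / 6"
  proof -
    show "0 < c" "c \<le> c1 * e" "c \<le> e * (\<kappa>' / 6)"
      unfolding c_def using c1 e \<kappa>' by (auto simp: mult_left_le mult_left_le_one_le mult.assoc)
    moreover have "e * (\<kappa>' / 6) \<le> \<kappa>' / 6" using e \<kappa>' by (simp add: mult_left_le_one_le)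
    ultimately show "c \<le> 1" "c \<le> \<kappa>' / 6" using \<kappa>' by linarith+
  qed
  show ?case
  proof (intro exI[of _ c] conjI allI impI)
    fix V :: "'a set" and E p \<beta> R Vs L
    assume J: "jumbled_subgraph V E p \<beta> R" and VsV: "\<forall>i. Vs i \<subseteq> V" and L: "0 < L" "\<forall>i. L \<le> cd (Vs i)"
      and \<beta>: "\<beta> \<le> c * p * L"
      and dens: "\<forall>(i, j)\<in>set (q # prs). \<forall>A B. A \<subseteq> Vs i \<longrightarrow> B \<subseteq> Vs j \<longrightarrow> c * cd (Vs i) \<le> cd A \<longrightarrow> c * cd (Vs j) \<le> cd B
       \<longrightarrow> \<epsilon> * p * cd A * cd B \<le> esum R A B"
    interpret jumbled_subgraph V E p \<beta> R by (rule J)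
    have pos: "0 < cd (Vs i)" for i using L order.strict_trans2 by blast
    have ne: "Vs i \<noteq> {}" for i using pos[of i] by auto
    have "L = sqrt (L * L)" using L by simp
    also have "\<dots> \<le> sqrt (cd (Vs i) * cd (Vs j))" using L by (intro real_sqrt_le_mono mult_mono) auto
    finally have Ls: "L \<le> sqrt (cd (Vs i) * cd (Vs j))" .
    have \<beta>c: "\<beta> \<le> c' * p * sqrt (cd (Vs i) * cd (Vs j))" if "c \<le> c'" for c'
      using that c Ls p_pos L by (intro order.trans[OF \<beta>] mult_mono) auto
    have "esum E (Vs i) (Vs j) \<le> (1 + \<kappa>' / 6) * p * (cd (Vs i) * cd (Vs j))"
      using VsV by (intro esum_E_bounds(1) \<beta>c c(5)) auto
    also have "\<dots> \<le> 2 * p * (cd (Vs i) * cd (Vs j))"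
      using \<kappa>' p_pos by (intro mult_right_mono) auto
    finally have E2: "esum E (Vs i) (Vs j) \<le> 2 * p * (cd (Vs i) * cd (Vs j))" .
    have "0 < (1 - \<kappa>' / 6) * p * (cd (Vs i) * cd (Vs j))" using \<kappa>' p_pos pos by auto
    also have "\<dots> \<le> esum E (Vs i) (Vs j)" using VsV by (intro esum_E_bounds(2) \<beta>c c(5)) auto
    finally have E0: "0 < esum E (Vs i) (Vs j)" .
    have "\<epsilon> * p * cd (Vs i) * cd (Vs j) \<le> esum R (Vs i) (Vs j)"
      using dens c pos by (auto simp: q mult_left_le_one_le)
    moreover have "\<epsilon> / 2 * esum E (Vs i) (Vs j) \<le> \<epsilon> / 2 * (2 * p * (cd (Vs i) * cd (Vs j)))"
      using \<epsilon> E2 by (intro mult_left_mono) auto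
    ultimately have rel_density: "\<epsilon> / 2 \<le> rel_density (Vs i) (Vs j)"
      unfolding rel_density_def using E0 by (simp add: pos_le_divide_eq)
    have "1 - real k * (\<kappa>' / 6) \<le> 0" using k \<kappa>' by (simp add: field_simps)
    then have "1 - real k * (\<kappa>' / 6) \<le> rel_density (Vs i) (Vs j)" using rel_density \<epsilon> by linarith
    moreover have "\<beta> \<le> (\<kappa>' / 6) ^ Suc k * p * sqrt (cd (Vs i) * cd (Vs j))"
      using c(3) by (intro \<beta>c) (simp add: e_def mult.commute)
    ultimately obtain A B d where A: "A \<subseteq> Vs i" "e * cd (Vs i) \<le> cd A" and B: "B \<subseteq> Vs j" "e * cd (Vs j) \<le> cd B"
      and d: "\<epsilon> / 2 \<le> d" "d \<le> 1" and reg: "cut_regular \<kappa>' d A B"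
      using regular_subpair[of "Vs i" "Vs j" \<kappa>' k] VsV ne \<kappa>' rel_density unfolding e_def by (meson order.trans)
    define Ws where "Ws = Vs(i := A, j := B)"
    have Ws: "Ws l \<subseteq> Vs l" "e * cd (Vs l) \<le> cd (Ws l)" for l
      unfolding Ws_def using A B e ij by (auto simp: mult_left_le_one_le)
    have WsV: "\<forall>l. Ws l \<subseteq> V" using Ws VsV by blast
    have L1: "\<forall>l. e * L \<le> cd (Ws l)"
      using L(2) e by (intro allI order.trans[OF _ Ws(2)] mult_left_mono) auto
    have \<beta>1: "\<beta> \<le> c1 * p * (e * L)"
    proof -
      have "c * (p * L) \<le> c1 * e * (p * L)" using c(2) p_pos L by (intro mult_right_mono) auto
      then show ?thesis using \<beta> by (simp add: mult_ac)
    qed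
    have cW: "c * cd (Vs l) \<le> c1 * cd (Ws l)" for l
    proof -
      have "c * cd (Vs l) \<le> c1 * e * cd (Vs l)" using c(2) by (intro mult_right_mono) auto
      also have "\<dots> \<le> c1 * cd (Ws l)" using c1 Ws(2)[of l] by (simp add: mult.assoc)
      finally show ?thesis .
    qed
    have dens1: "\<forall>(i, j)\<in>set prs. \<forall>A B. A \<subseteq> Ws i \<longrightarrow> B \<subseteq> Ws j \<longrightarrow> c1 * cd (Ws i) \<le> cd A \<longrightarrow> c1 * cd (Ws j) \<le> cd B
       \<longrightarrow> \<epsilon> * p * cd A * cd B \<le> esum R A B"
    proof (clarify)
      fix i j A B
      assume 1: "(i, j) \<in> set prs" "A \<subseteq> Ws i" "B \<subseteq> Ws j" "c1 * cd (Ws i) \<le> cd A" "c1 * cd (Ws j) \<le> cd B"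
      have "A \<subseteq> Vs i" "B \<subseteq> Vs j" "c * cd (Vs i) \<le> cd A" "c * cd (Vs j) \<le> cd B"
        using 1 Ws(1) cW order.trans by blast+
      then show "\<epsilon> * p * cd A * cd B \<le> esum R A B" using dens 1(1) by auto
    qed
    have "0 < e * L" using e L by auto
    from IH[OF J WsV this L1 \<beta>1 dens1]
    obtain Vs' where Vs': "\<And>l. Vs' l \<subseteq> Ws l" "\<And>l. c1 * cd (Ws l) \<le> cd (Vs' l)"
      and regs: "\<forall>(i, j)\<in>set prs. \<exists>d. \<epsilon> / 2 \<le> d \<and> d \<le> 1 \<and> cut_regular \<kappa> d (Vs' i) (Vs' j)"
      by blast
    have "cut_regular \<kappa> d (Vs' i) (Vs' j)"
      unfolding cut_regular_def
    proof (intro allI impI)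
      fix S T assume S: "S \<subseteq> Vs' i" and T: "T \<subseteq> Vs' j"
      have Wi: "Ws i = A" "Ws j = B" unfolding Ws_def using ij by auto
      have "\<bar>\<Sum>y\<in>S. \<Sum>z\<in>T. excess d y z\<bar> \<le> \<kappa>' * p * cd A * cd B"
        using reg S T Vs'(1)[of i] Vs'(1)[of j] Wi unfolding cut_regular_def by (meson order.trans)
      also have "\<dots> = \<kappa> * p * ((c1 * cd A) * (c1 * cd B))" unfolding \<kappa>'_def by (simp add: power2_eq_square)
      also have "\<dots> \<le> \<kappa> * p * (cd (Vs' i) * cd (Vs' j))"
        using Vs'(2)[of i] Vs'(2)[of j] Wi \<kappa> p_pos c1 by (intro mult_left_mono mult_mono) auto
      finally show "\<bar>\<Sum>y\<in>S. \<Sum>z\<in>T. excess d y z\<bar> \<le> \<kappa> * p * cd (Vs' i) * cd (Vs' j)" by (simp add: mult.assoc)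
    qed
    then have "\<forall>(i, j)\<in>set (q # prs). \<exists>d. \<epsilon> / 2 \<le> d \<and> d \<le> 1 \<and> cut_regular \<kappa> d (Vs' i) (Vs' j)"
      using regs d q by auto
    moreover have "\<forall>l. Vs' l \<subseteq> Vs l \<and> c * cd (Vs l) \<le> cd (Vs' l)"
      using Vs' Ws(1) cW order.trans by blast
    ultimately show "\<exists>Vs'. (\<forall>i. Vs' i \<subseteq> Vs i \<and> c * cd (Vs i) \<le> cd (Vs' i)) \<and>
       (\<forall>(i, j)\<in>set (q # prs). \<exists>d. \<epsilon> / 2 \<le> d \<and> d \<le> 1 \<and> cut_regular \<kappa> d (Vs' i) (Vs' j))"
      by blast
  qed (use c in auto)
qed

section \<open>Embedding one vertex\<close>

lemma markov_count:
  fixes f :: "'a \<Rightarrow> real"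
  assumes "finite X" "\<And>x. x \<in> X \<Longrightarrow> 0 \<le> f x" "0 < t" "sum f X \<le> s * t"
  shows "cd {x\<in>X. t < f x} \<le> s"
proof -
  have "cd {x\<in>X. t < f x} * t \<le> (\<Sum>x\<in>{x\<in>X. t < f x}. f x)"
    using sum_bounded_below[of "{x\<in>X. t < f x}" t f] by (auto simp: less_imp_le)
  also have "\<dots> \<le> sum f X" using assms(1,2) by (intro sum_mono2) auto
  also have "\<dots> \<le> s * t" by (rule assms(4))
  finally show ?thesis using assms(3) by simp
qed

text \<open>\<open>W\<close> and \<open>adj\<close> describe the graph to embed, and
  \<open>col\<close> colours its square; a vertex goes into the host set \<open>Vs\<close> of its
  colour. Per embedded neighbour a candidate set may shrink by the factor \<open>e * p\<close>, and
  the relative 4-cycle bound may grow by the factor \<open>K\<close>. An exceptional event may rule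
  out a proportion \<open>\<theta>\<close> of the choices. The initial \<open>\<kappa>\<close> is so
  small that after the at most \<open>2 * \<Delta>\<close> growth steps of a pair
  \<open>few_small_degrees\<close> still applies; its bound \<open>(d / 4) ^ 4\<close> becomes
  \<open>e ^ 4\<close> because \<open>4 * e\<close> is a lower bound for the densities.\<close>

locale embedding = jumbled_subgraph V E p \<beta> R
  for V :: "'a set" and E p \<beta> R +
  fixes W :: "'b set" and adj :: "'b \<Rightarrow> 'b \<Rightarrow> bool" and col :: "'b \<Rightarrow> nat"
    and Vs :: "nat \<Rightarrow> 'a set" and dd :: "nat \<Rightarrow> nat \<Rightarrow> real" and \<Delta> :: nat
    and e M \<kappa> K \<delta> \<theta> :: real
  assumes finW: "finite W" and adj_sym: "adj x y \<Longrightarrow> adj y x"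
    and deg: "x \<in> W \<Longrightarrow> card {y\<in>W. adj x y} \<le> \<Delta>"
    and col_adj: "x \<in> W \<Longrightarrow> y \<in> W \<Longrightarrow> adj x y \<Longrightarrow> col x \<noteq> col y"
    and col_two: "x \<in> W \<Longrightarrow> y \<in> W \<Longrightarrow> y' \<in> W \<Longrightarrow> adj x y \<Longrightarrow> adj x y' \<Longrightarrow> y \<noteq> y' \<Longrightarrow> col y \<noteq> col y'"
    and VsV: "x \<in> W \<Longrightarrow> Vs (col x) \<subseteq> V"
    and Vs_disj: "x \<in> W \<Longrightarrow> y \<in> W \<Longrightarrow> col x \<noteq> col y \<Longrightarrow> Vs (col x) \<inter> Vs (col y) = {}"
    and dd_sym: "dd i j = dd j i"
    and dd: "x \<in> W \<Longrightarrow> y \<in> W \<Longrightarrow> adj x y \<Longrightarrow> 4 * e \<le> dd (col x) (col y)"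
      "x \<in> W \<Longrightarrow> y \<in> W \<Longrightarrow> adj x y \<Longrightarrow> dd (col x) (col y) \<le> 1"
    and M: "0 < M" "x \<in> W \<Longrightarrow> M \<le> cd (Vs (col x))"
    and init: "x \<in> W \<Longrightarrow> y \<in> W \<Longrightarrow> adj x y \<Longrightarrow>
      C4 (excess (dd (col x) (col y))) (Vs (col x)) (Vs (col y))
        \<le> \<kappa> * p ^ 4 * (cd (Vs (col x)))\<^sup>2 * (cd (Vs (col y)))\<^sup>2"
    and e: "0 < e" "e \<le> 1" and \<delta>: "0 \<le> \<delta>" "\<delta> \<le> 1 / 24" "32 * \<delta> \<le> \<kappa>" "\<delta> \<le> \<theta> / 4" "\<delta> \<le> e"
    and \<theta>: "0 < \<theta>" "\<theta> \<le> 1" "8 * (real \<Delta>)\<^sup>2 * \<theta> \<le> 1"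
    and K: "1 \<le> K" "2 / \<theta> \<le> K * e\<^sup>2" and \<kappa>: "0 < \<kappa>" "\<kappa> * K ^ (2 * \<Delta>) \<le> e ^ 4 * \<theta>\<^sup>2"
    and \<beta>: "\<beta> \<le> \<delta> * e ^ \<Delta> * p ^ (\<Delta> + 2) * M"
begin

definition nbrs :: "'b set \<Rightarrow> 'b \<Rightarrow> nat" where "nbrs S y = card {x\<in>S. adj x y}"

abbreviation h :: "'b \<Rightarrow> 'b \<Rightarrow> 'a \<Rightarrow> 'a \<Rightarrow> real" where "h x y \<equiv> excess (dd (col x) (col y))"

text \<open>The invariant: \<open>S\<close> is embedded by \<open>f\<close>, and \<open>C y\<close>
  is the candidate set of an unembedded \<open>y\<close>. Candidate sets may contain images already
  used; injectivity is ensured when the image is chosen. The 4-cycle bound is relative to the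
  current sizes.\<close>

definition valid :: "'b set \<Rightarrow> ('b \<Rightarrow> 'a) \<Rightarrow> ('b \<Rightarrow> 'a set) \<Rightarrow> bool" where
  "valid S f C \<longleftrightarrow> S \<subseteq> W \<and> inj_on f S \<and> (\<forall>x\<in>S. f x \<in> Vs (col x)) \<and>
     (\<forall>x\<in>S. \<forall>y\<in>S. adj x y \<longrightarrow> R (f x) (f y)) \<and>
     (\<forall>y\<in>W - S. C y \<subseteq> Vs (col y) \<and> (\<forall>x\<in>S. adj x y \<longrightarrow> (\<forall>q\<in>C y. R (f x) q)) \<and>
        (e * p) ^ nbrs S y * M \<le> cd (C y)) \<and>
     (\<forall>y\<in>W - S. \<forall>z\<in>W - S. adj y z \<longrightarrow>
        C4 (h y z) (C y) (C z) \<le> \<kappa> * K ^ (nbrs S y + nbrs S z) * p ^ 4 * (cd (C y))\<^sup>2 * (cd (C z))\<^sup>2)"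

text \<open>Removing the vertices of exceptionally large degree into \<open>C x\<close> keeps the load of every
  remaining vertex under control when \<open>x\<close> is embedded.\<close>

definition shrink :: "('b \<Rightarrow> 'a set) \<Rightarrow> 'b \<Rightarrow> 'a \<Rightarrow> 'b \<Rightarrow> 'a set" where
  "shrink C x v y = (if adj x y then {q\<in>C y. R v q \<and> (\<Sum>u\<in>C x. a q u) \<le> 2 * p * cd (C x)} else C y)"

lemma h_sym: "h x y = h y x"
  by (simp add: dd_sym)

text \<open>Applied to one or two unembedded neighbours, this keeps the exponents of candidate sizes
  away from \<open>\<Delta>\<close>.\<close>

lemma nbrs_le:
  assumes "S \<subseteq> W" "T \<subseteq> W - S" "y \<in> W" "\<And>x. x \<in> T \<Longrightarrow> adj x y"
  shows "nbrs S y + card T \<le> \<Delta>"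
proof -
  have "finite S" "finite T" using assms(1,2) finW by (auto intro: finite_subset)
  then have "nbrs S y + card T = card ({x\<in>S. adj x y} \<union> T)"
    unfolding nbrs_def using assms(2) by (subst card_Un_disjoint) auto
  also have "\<dots> \<le> card {x\<in>W. adj y x}"
    using assms finW by (intro card_mono) (auto intro: adj_sym)
  finally show ?thesis using deg[OF assms(3)] by simp
qed

lemma nbrs_insert:
  assumes "finite S" "x \<notin> S"
  shows "nbrs (insert x S) y = nbrs S y + (if adj x y then 1 else 0)"
proof -
  have "{u\<in>insert x S. adj u y} = (if adj x y then insert x {u\<in>S. adj u y} else {u\<in>S. adj u y})" by auto
  then show ?thesis unfolding nbrs_def using assms by auto
qed

lemma ep: "0 < e * p" "e * p \<le> 1"
  using e p_pos p_le by (auto intro: mult_le_one)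

lemma valid_pos:
  assumes "valid S f C" "y \<in> W - S"
  shows "0 < cd (C y)"
  using assms ep M(1) unfolding valid_def by (smt (verit) mult_pos_pos zero_less_power)

lemma valid_sub:
  assumes "valid S f C" "y \<in> W - S"
  shows "C y \<subseteq> V"
  using assms VsV[of y] unfolding valid_def by blast

text \<open>If both vertices have \<open>j\<close> neighbours to spare, both candidate sets have
  size at least \<open>(e * p) ^ (\<Delta> - j) * M\<close>, and the remaining power of
  \<open>p\<close> in the bound on \<open>\<beta>\<close> is \<open>2 + j\<close>. The case
  \<open>j = 1\<close> serves \<open>C4_inherit_one\<close>, and \<open>j = 2\<close> is needed for
  \<open>C4_inherit_two\<close>.\<close>

lemma beta_le:
  assumes v: "valid S f C" and y: "y \<in> W - S" and z: "z \<in> W - S" and j: "nbrs S y + j \<le> \<Delta>" "nbrs S z + j \<le> \<Delta>"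
  shows "\<beta> \<le> \<delta> * p ^ (2 + j) * sqrt (cd (C y) * cd (C z))"
proof -
  have jD: "j \<le> \<Delta>" using j by simp
  have l: "(e * p) ^ (\<Delta> - j) * M \<le> cd (C u)" if "u \<in> W - S" "nbrs S u + j \<le> \<Delta>" for u
  proof -
    have "(e * p) ^ (\<Delta> - j) * M \<le> (e * p) ^ nbrs S u * M"
      using ep M(1) that by (intro mult_right_mono power_decreasing) auto
    also have "\<dots> \<le> cd (C u)" using v that unfolding valid_def by blast
    finally show ?thesis .
  qed
  have pe: "p ^ (\<Delta> + 2) = p ^ (2 + j) * p ^ (\<Delta> - j)" using jD by (simp add: power_add[symmetric])
  note \<beta>
  also have "\<delta> * e ^ \<Delta> * p ^ (\<Delta> + 2) * M \<le> \<delta> * e ^ (\<Delta> - j) * p ^ (\<Delta> + 2) * M"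
    using e \<delta> p_pos M by (intro mult_right_mono mult_left_mono power_decreasing) auto
  also have "\<dots> = \<delta> * p ^ (2 + j) * ((e * p) ^ (\<Delta> - j) * M)"
    unfolding pe by (simp add: power_mult_distrib)
  also have "(e * p) ^ (\<Delta> - j) * M = sqrt (((e * p) ^ (\<Delta> - j) * M) * ((e * p) ^ (\<Delta> - j) * M))"
    using ep M(1) by simp
  also have "\<delta> * p ^ (2 + j) * \<dots> \<le> \<delta> * p ^ (2 + j) * sqrt (cd (C y) * cd (C z))"
    using l[OF y j(1)] l[OF z j(2)] \<delta> p_pos ep M(1)
    by (intro mult_left_mono real_sqrt_le_mono mult_mono) auto
  finally show ?thesis .
qed

lemma valid_C4_bound:
  assumes "valid S f C" "y \<in> W - S" "z \<in> W - S" "adj y z"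
  shows "\<kappa> * K ^ (nbrs S y + nbrs S z) \<le> e ^ 4 * \<theta>\<^sup>2" "\<kappa> \<le> \<kappa> * K ^ (nbrs S y + nbrs S z)"
proof -
  have "nbrs S y \<le> \<Delta>" "nbrs S z \<le> \<Delta>"
    using nbrs_le[of S "{}"] assms unfolding valid_def by auto
  then show "\<kappa> * K ^ (nbrs S y + nbrs S z) \<le> e ^ 4 * \<theta>\<^sup>2"
    using K \<kappa> by (intro order.trans[OF mult_left_mono[OF power_increasing] \<kappa>(2)]) auto
  show "\<kappa> \<le> \<kappa> * K ^ (nbrs S y + nbrs S z)" using K \<kappa> by simp
qed

lemma few_bad_degree:
  assumes v: "valid S f C" and x: "x \<in> W - S" and y: "y \<in> W - S" and xy: "adj x y"
  shows "cd {v\<in>C x. (\<Sum>q\<in>C y. ra v q) < dd (col x) (col y) / 2 * p * cd (C y)} \<le> \<theta> * cd (C x)"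
proof (rule few_small_degrees)
  let ?d = "dd (col x) (col y)"
  have W: "x \<in> W" "y \<in> W" and S: "S \<subseteq> W" using x y v unfolding valid_def by auto
  show "0 < ?d" "?d \<le> 1" using dd[OF W xy] e by auto
  show "C4 (h x y) (C x) (C y) \<le> \<kappa> * K ^ (nbrs S x + nbrs S y) * p ^ 4 * (cd (C x))\<^sup>2 * (cd (C y))\<^sup>2"
    using v x y xy unfolding valid_def by blast
  have "e ^ 4 \<le> (?d / 4) ^ 4" using dd(1)[OF W xy] e by (intro power_mono) auto
  then show "\<kappa> * K ^ (nbrs S x + nbrs S y) \<le> (?d / 4) ^ 4 * \<theta>\<^sup>2"
    by (intro order.trans[OF valid_C4_bound(1)[OF v x y xy]] mult_right_mono) auto
  have nbrs: "nbrs S x + 1 \<le> \<Delta>" "nbrs S y + 1 \<le> \<Delta>"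
    using nbrs_le[of S "{y}" x] nbrs_le[of S "{x}" y] x y xy adj_sym S by auto
  have "\<delta> * p ^ 3 \<le> \<theta> / 4 * p"
    using \<delta> \<theta> p_pos p_le power_decreasing[of 1 3 p] by (intro mult_mono) auto
  then have "\<delta> * p ^ 3 * sqrt (cd (C x) * cd (C y)) \<le> \<theta> / 4 * p * sqrt (cd (C x) * cd (C y))"
    by (intro mult_right_mono) auto
  then show "\<beta> \<le> \<theta> / 4 * p * sqrt (cd (C x) * cd (C y))"
    using beta_le[OF v x y nbrs] by (simp add: numeral_3_eq_3)
  show "C x \<noteq> {}" "C y \<noteq> {}" using valid_pos[OF v x] valid_pos[OF v y] by auto
qed (use v x y valid_sub \<theta> in auto)

text \<open>Main term and error of \<open>C4_inherit_one\<close> are each at most the old bound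
  times the expected factor, so the average is at most twice that, and Markov's inequality loses a
  further \<open>1 / \<theta>\<close>.\<close>

lemma few_bad_one:
  assumes v: "valid S f C" and x: "x \<in> W - S" and y: "y \<in> W - S" and z: "z \<in> W - S"
    and xy: "adj x y" and yz: "adj y z"
  shows "cd {v\<in>C x. 2 * (\<kappa> * K ^ (nbrs S y + nbrs S z)) / \<theta> * p ^ 6 * (cd (C y))\<^sup>2 * (cd (C z))\<^sup>2
      < C4 (h y z) {q\<in>C y. E v q} (C z)} \<le> \<theta> * cd (C x)"
proof (rule markov_count)
  let ?k = "\<kappa> * K ^ (nbrs S y + nbrs S z)"
  have S: "S \<subseteq> W" using v unfolding valid_def by auto
  have k: "0 < ?k" using \<kappa> K by auto
  note pos = valid_pos[OF v x] valid_pos[OF v y] valid_pos[OF v z]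
  have nbrs: "nbrs S x + 1 \<le> \<Delta>" "nbrs S y + 1 \<le> \<Delta>" "nbrs S z + 1 \<le> \<Delta>"
    using nbrs_le[of S "{y}" x] nbrs_le[of S "{x}" y] nbrs_le[of S "{y}" z] x y z xy yz adj_sym S by auto
  have gb: "\<bar>h y z u w\<bar> \<le> a u w" for u w
    using dd[of y z] y z yz e by (intro excess_le) auto
  \<comment> \<open>The arguments are exchanged because \<open>C4_inherit_one\<close> restricts the
    second set.\<close>
  have "(\<Sum>v\<in>C x. C4 (h y z) {q\<in>C y. E v q} (C z)) = (\<Sum>v\<in>C x. C4 (h y z) (C z) {q\<in>C y. E v q})"
    by (intro sum.cong refl C4_commute excess_sym)
  also have "\<dots> \<le> p\<^sup>2 * cd (C x) * C4 (h y z) (C z) (C y) + 16 * \<delta> * p ^ 6 * cd (C x) * (cd (C z))\<^sup>2 * (cd (C y))\<^sup>2"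
    using beta_le[OF v x y nbrs(1,2)] beta_le[OF v z y nbrs(3,2)]
    by (intro C4_inherit_one valid_sub[OF v] x y z \<delta> gb) (simp_all add: eval_nat_numeral)
  also have "\<dots> \<le> p\<^sup>2 * cd (C x) * (?k * p ^ 4 * (cd (C y))\<^sup>2 * (cd (C z))\<^sup>2) + ?k * p ^ 6 * cd (C x) * (cd (C z))\<^sup>2 * (cd (C y))\<^sup>2"
  proof (intro add_mono mult_right_mono mult_left_mono)
    show "C4 (h y z) (C z) (C y) \<le> ?k * p ^ 4 * (cd (C y))\<^sup>2 * (cd (C z))\<^sup>2"
    proof -
      have "C4 (h y z) (C z) (C y) = C4 (h y z) (C y) (C z)" by (rule C4_commute) (rule excess_sym)
      then show ?thesis using v y z yz unfolding valid_def by auto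
    qed
    show "16 * \<delta> \<le> ?k" using \<delta> valid_C4_bound(2)[OF v y z yz] by linarith
  qed (use p_pos in auto)
  also have "\<dots> = \<theta> * cd (C x) * (2 * ?k / \<theta> * p ^ 6 * (cd (C y))\<^sup>2 * (cd (C z))\<^sup>2)"
    using \<theta> by (simp add: field_simps power_add[symmetric])
  finally show "(\<Sum>v\<in>C x. C4 (h y z) {q\<in>C y. E v q} (C z)) \<le> \<dots>" .
  show "0 < 2 * ?k / \<theta> * p ^ 6 * (cd (C y))\<^sup>2 * (cd (C z))\<^sup>2"
    using k K \<kappa> pos \<theta> p_pos by (intro mult_pos_pos divide_pos_pos zero_less_power) auto
qed (use v x valid_sub fin C4_nonneg in auto)

text \<open>Here \<open>x, y, z\<close> form a triangle of unembedded vertices, so each of them has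
  two neighbours to spare. This supplies the stronger bound on \<open>\<beta>\<close> for the pair
  \<open>x, y\<close>.\<close>

lemma few_bad_two:
  assumes v: "valid S f C" and x: "x \<in> W - S" and y: "y \<in> W - S" and z: "z \<in> W - S"
    and xy: "adj x y" and yz: "adj y z" and xz: "adj x z"
  shows "cd {v\<in>C x. 2 * (\<kappa> * K ^ (nbrs S y + nbrs S z)) / \<theta> * p ^ 8 * (cd (C y))\<^sup>2 * (cd (C z))\<^sup>2
      < C4 (h y z) {q\<in>C y. E v q} {q\<in>C z. E v q}} \<le> \<theta> * cd (C x)"
proof (rule markov_count)
  let ?k = "\<kappa> * K ^ (nbrs S y + nbrs S z)"
  have S: "S \<subseteq> W" using v unfolding valid_def by auto
  have k: "0 < ?k" using \<kappa> K by auto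
  note pos = valid_pos[OF v x] valid_pos[OF v y] valid_pos[OF v z]
  have irr: "x \<noteq> y" "y \<noteq> z" "x \<noteq> z" using col_adj x y z xy yz xz by auto
  have nbrs: "nbrs S x + 2 \<le> \<Delta>" "nbrs S y + 2 \<le> \<Delta>" "nbrs S z + 2 \<le> \<Delta>"
    using nbrs_le[of S "{y, z}" x] nbrs_le[of S "{x, z}" y] nbrs_le[of S "{x, y}" z] x y z xy yz xz adj_sym S irr by auto
  then have nb1: "nbrs S x + 1 \<le> \<Delta>" "nbrs S y + 1 \<le> \<Delta>" "nbrs S z + 1 \<le> \<Delta>" by auto
  have gb: "\<bar>h y z u w\<bar> \<le> a u w" for u w
    using dd[of y z] y z yz e by (intro excess_le) auto
  have "(\<Sum>v\<in>C x. C4 (h y z) {q\<in>C y. E v q} {q\<in>C z. E v q})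
     \<le> p ^ 4 * cd (C x) * C4 (h y z) (C y) (C z) + 32 * \<delta> * p ^ 8 * cd (C x) * (cd (C y))\<^sup>2 * (cd (C z))\<^sup>2"
    using beta_le[OF v x y nbrs(1,2)] beta_le[OF v x z nb1(1,3)] beta_le[OF v y z nb1(2,3)]
    by (intro C4_inherit_two valid_sub[OF v] x y z \<delta> gb) (simp_all add: eval_nat_numeral)
  also have "\<dots> \<le> p ^ 4 * cd (C x) * (?k * p ^ 4 * (cd (C y))\<^sup>2 * (cd (C z))\<^sup>2) + ?k * p ^ 8 * cd (C x) * (cd (C y))\<^sup>2 * (cd (C z))\<^sup>2"
  proof (intro add_mono mult_right_mono mult_left_mono)
    show "C4 (h y z) (C y) (C z) \<le> ?k * p ^ 4 * (cd (C y))\<^sup>2 * (cd (C z))\<^sup>2"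
      using v y z yz unfolding valid_def by blast
    show "32 * \<delta> \<le> ?k" using \<delta> valid_C4_bound(2)[OF v y z yz] by linarith
  qed (use p_pos in auto)
  also have "\<dots> = \<theta> * cd (C x) * (2 * ?k / \<theta> * p ^ 8 * (cd (C y))\<^sup>2 * (cd (C z))\<^sup>2)"
    using \<theta> by (simp add: field_simps power_add[symmetric])
  finally show "(\<Sum>v\<in>C x. C4 (h y z) {q\<in>C y. E v q} {q\<in>C z. E v q}) \<le> \<dots>" .
  show "0 < 2 * ?k / \<theta> * p ^ 8 * (cd (C y))\<^sup>2 * (cd (C z))\<^sup>2"
    using k K \<kappa> pos \<theta> p_pos by (intro mult_pos_pos divide_pos_pos zero_less_power) auto
qed (use v x valid_sub fin C4_nonneg in auto)

text \<open>There are at most \<open>\<Delta>\<close> degree conditions and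
  \<open>\<Delta> * \<Delta>\<close> conditions on pairs, each excluding a proportion of at most
  \<open>\<theta>\<close> of \<open>C x\<close>. Since
  \<open>8 * \<Delta>^2 * \<theta> \<le> 1\<close>, at most a quarter is excluded. Used vertices are
  left to the caller, who controls their number by a potential.\<close>

lemma extend:
  assumes v: "valid S f C" and x: "x \<in> W - S"
  shows "\<exists>B. B \<subseteq> C x \<and> cd B \<le> cd (C x) / 4 \<and>
    (\<forall>v\<in>C x - B - f ` S. valid (insert x S) (f(x := v)) (shrink C x v))"
proof -
  let ?k = "\<lambda>y z. \<kappa> * K ^ (nbrs S y + nbrs S z)"
  define N where "N = {y\<in>W - S. adj x y}"
  define L where "L y = {z\<in>W - S. adj y z}" for y
  define D where "D y = {v\<in>C x. (\<Sum>q\<in>C y. ra v q) < dd (col x) (col y) / 2 * p * cd (C y)}" for y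
  \<comment> \<open>Both candidate sets shrink if \<open>z\<close> is a neighbour of
    \<open>x\<close> too, otherwise only that of \<open>y\<close>; the typical 4-cycle counts scale
    accordingly with \<open>p ^ 8\<close> and \<open>p ^ 6\<close>.\<close>
  define F where "F y z = (if adj x z
     then {v\<in>C x. 2 * ?k y z / \<theta> * p ^ 8 * (cd (C y))\<^sup>2 * (cd (C z))\<^sup>2 < C4 (h y z) {q\<in>C y. E v q} {q\<in>C z. E v q}}
     else {v\<in>C x. 2 * ?k y z / \<theta> * p ^ 6 * (cd (C y))\<^sup>2 * (cd (C z))\<^sup>2 < C4 (h y z) {q\<in>C y. E v q} (C z)})" for y z
  define B where "B = (\<Union>y\<in>N. D y \<union> (\<Union>z\<in>L y. F y z))"
  have S: "S \<subseteq> W" and finS: "finite S" using v finW finite_subset unfolding valid_def by auto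
  have xS: "x \<notin> S" "x \<in> W" using x by auto
  have finCx: "finite (C x)" using valid_sub[OF v x] by (rule fin)
  have finN: "finite N" "finite (L y)" for y unfolding N_def L_def using finW by auto
  have cardN: "card N \<le> \<Delta>"
    unfolding N_def using x finW by (intro order.trans[OF card_mono deg[of x]]) auto
  have cardL: "card (L y) \<le> \<Delta>" if "y \<in> N" for y
    unfolding L_def using that finW by (intro order.trans[OF card_mono deg[of y]]) (auto simp: N_def)
  have D_le: "cd (D y) \<le> \<theta> * cd (C x)" if "y \<in> N" for y
    unfolding D_def using that by (intro few_bad_degree[OF v x]) (auto simp: N_def)
  have F_le: "cd (F y z) \<le> \<theta> * cd (C x)" if "y \<in> N" "z \<in> L y" for y z
    using that few_bad_one[OF v x, of y z] few_bad_two[OF v x, of y z]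
    unfolding F_def by (auto simp: N_def L_def)
  have "card B \<le> (\<Sum>y\<in>N. card (D y \<union> (\<Union>z\<in>L y. F y z)))"
    unfolding B_def by (intro card_UN_le finN)
  also have "\<dots> \<le> (\<Sum>y\<in>N. card (D y) + (\<Sum>z\<in>L y. card (F y z)))"
    by (intro sum_mono order.trans[OF card_Un_le] add_left_mono card_UN_le finN)
  finally have "cd B \<le> real (\<Sum>y\<in>N. card (D y) + (\<Sum>z\<in>L y. card (F y z)))" by (rule of_nat_mono)
  also have "\<dots> = (\<Sum>y\<in>N. cd (D y) + (\<Sum>z\<in>L y. cd (F y z)))" by simp
  also have "\<dots> \<le> (\<Sum>y\<in>N. \<theta> * cd (C x) + real \<Delta> * (\<theta> * cd (C x)))"
  proof (intro sum_mono add_mono D_le)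
    fix y assume y: "y \<in> N"
    have "(\<Sum>z\<in>L y. cd (F y z)) \<le> real (card (L y)) * (\<theta> * cd (C x))"
      by (intro sum_bounded_above F_le y)
    also have "\<dots> \<le> real \<Delta> * (\<theta> * cd (C x))"
      using cardL[OF y] \<theta> by (intro mult_right_mono) auto
    finally show "(\<Sum>z\<in>L y. cd (F y z)) \<le> real \<Delta> * (\<theta> * cd (C x))" .
  qed
  also have "\<dots> = real (card N) * ((1 + real \<Delta>) * \<theta> * cd (C x))" by (simp add: algebra_simps)
  also have "\<dots> \<le> real \<Delta> * ((1 + real \<Delta>) * \<theta> * cd (C x))"
    using cardN \<theta> by (intro mult_right_mono) auto
  also have "\<dots> = (real \<Delta> * (1 + real \<Delta>)) * \<theta> * cd (C x)" by simp
  also have "\<dots> \<le> (2 * (real \<Delta>)\<^sup>2) * \<theta> * cd (C x)"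
  proof (intro mult_right_mono)
    have "real \<Delta> \<le> (real \<Delta>)\<^sup>2" by (cases "\<Delta> = 0") (auto simp: power2_eq_square)
    then show "real \<Delta> * (1 + real \<Delta>) \<le> 2 * (real \<Delta>)\<^sup>2" by (simp add: algebra_simps power2_eq_square)
  qed (use \<theta> in auto)
  also have "\<dots> \<le> cd (C x) / 4"
    using mult_right_mono[OF \<theta>(3), of "cd (C x)"] by simp
  finally have cardB: "cd B \<le> cd (C x) / 4" .
  have BC: "B \<subseteq> C x" unfolding B_def D_def F_def by (auto split: if_splits)
  have "valid (insert x S) (f(x := v')) (shrink C x v')" if v': "v' \<in> C x - B - f ` S" for v'
  proof -
    let ?C = "shrink C x v'" and ?S = "insert x S"
    have nbrs': "nbrs ?S y = nbrs S y + (if adj x y then 1 else 0)" for y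
      using nbrs_insert[OF finS xS(1)] .
    have sub: "?C y \<subseteq> C y" for y unfolding shrink_def by auto
    have subE: "?C y \<subseteq> {q\<in>C y. E v' q}" if "adj x y" for y using that R_E unfolding shrink_def by auto
    \<comment> \<open>The degree condition leaves at least \<open>2 * e * p * cd (C y)\<close>
      neighbours, as densities are at least \<open>4 * e\<close>. Discarding vertices of large
      degree costs at most half of that bound.\<close>
    have grow: "e * p * cd (C y) \<le> cd (?C y)" if y: "y \<in> W - S" and xy: "adj x y" for y
    proof -
      have yN: "y \<in> N" unfolding N_def using y xy by auto
      have finC: "finite (C y)" using valid_sub[OF v y] by (rule fin)
      let ?d = "dd (col x) (col y)"
      have "v' \<notin> D y" using v' yN unfolding B_def by auto
      then have "?d / 2 * p * cd (C y) \<le> (\<Sum>q\<in>C y. ra v' q)" using v' unfolding D_def by auto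
      also have "\<dots> = cd {q\<in>C y. R v' q}" using finC by (simp add: card_filter_eq_sum)
      finally have 1: "?d / 2 * p * cd (C y) \<le> cd {q\<in>C y. R v' q}" .
      let ?O = "{q\<in>C y. 2 * p * cd (C x) < (\<Sum>u\<in>C x. a q u)}"
      have nbrs: "nbrs S x + 1 \<le> \<Delta>" "nbrs S y + 1 \<le> \<Delta>"
        using nbrs_le[of S "{y}" x] nbrs_le[of S "{x}" y] x y xy adj_sym S by auto
      have "cd ?O \<le> \<delta> * p * cd (C y)"
        using beta_le[OF v x y nbrs] \<delta>
        by (intro few_large_degrees valid_sub[OF v] x y) (simp_all add: eval_nat_numeral)
      also have "\<dots> \<le> e * p * cd (C y)" using \<delta> p_pos by (intro mult_right_mono) auto
      finally have 2: "cd ?O \<le> e * p * cd (C y)" .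
      have "{q\<in>C y. R v' q} \<subseteq> ?C y \<union> ?O" unfolding shrink_def using xy by auto
      then have "card {q\<in>C y. R v' q} \<le> card (?C y \<union> ?O)"
        using finC sub[of y] by (intro card_mono) (auto intro: finite_subset)
      also have "\<dots> \<le> card (?C y) + card ?O" by (rule card_Un_le)
      finally have 3: "cd {q\<in>C y. R v' q} \<le> cd (?C y) + cd ?O" by linarith
      have "2 * e * p * cd (C y) \<le> ?d / 2 * p * cd (C y)"
        using dd(1)[of x y] x y xy p_pos by (intro mult_right_mono) auto
      then show ?thesis using 1 2 3 by linarith
    qed
    have size: "(e * p) ^ nbrs ?S y * M \<le> cd (?C y)" if y: "y \<in> W - ?S" for y
    proof -
      have y': "y \<in> W - S" using y by auto
      have o: "(e * p) ^ nbrs S y * M \<le> cd (C y)" using v y' unfolding valid_def by blast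
      show ?thesis
      proof (cases "adj x y")
        case True
        have "(e * p) ^ nbrs ?S y * M = e * p * ((e * p) ^ nbrs S y * M)" unfolding nbrs' using True by simp
        also have "\<dots> \<le> e * p * cd (C y)" using o ep by (intro mult_left_mono) auto
        finally show ?thesis using grow[OF y' True] by simp
      next
        case False
        then show ?thesis using o unfolding nbrs' shrink_def by simp
      qed
    qed
    have one: "C4 (h y z) (?C y) (?C z) \<le> \<kappa> * K ^ (nbrs ?S y + nbrs ?S z) * p ^ 4 * (cd (?C y))\<^sup>2 * (cd (?C z))\<^sup>2"
      if y: "y \<in> W - S" and z: "z \<in> W - S" and yz: "adj y z" and xy: "adj x y" for y z
    proof -
      have yN: "y \<in> N" "z \<in> L y" unfolding N_def L_def using y z yz xy by auto
      then have nF: "v' \<notin> F y z" using v' unfolding B_def by auto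
      have k0: "0 \<le> ?k y z" using \<kappa> K by auto
      have finC: "finite (C y)" "finite (C z)" using valid_sub[OF v] y z fin by auto
      have gy: "(e * p * cd (C y))\<^sup>2 \<le> (cd (?C y))\<^sup>2" using grow[OF y xy] ep by (intro power_mono) auto
      show ?thesis
      proof (cases "adj x z")
        case True
        have gz: "(e * p * cd (C z))\<^sup>2 \<le> (cd (?C z))\<^sup>2" using grow[OF z True] ep by (intro power_mono) auto
        have "C4 (h y z) (?C y) (?C z) \<le> C4 (h y z) {q\<in>C y. E v' q} {q\<in>C z. E v' q}"
          using subE[OF xy] subE[OF True] finC by (intro C4_mono) auto
        also have "\<dots> \<le> 2 * ?k y z / \<theta> * p ^ 8 * (cd (C y))\<^sup>2 * (cd (C z))\<^sup>2"
          using nF v' True unfolding F_def by auto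
        \<comment> \<open>The Markov loss \<open>2 / \<theta>\<close> has to be absorbed together
          with the loss \<open>e ^ 4\<close> from measuring against the squared sizes of the two
          smaller sets. Two embedded neighbours allow the growth \<open>K^2\<close>, and
          \<open>2 / \<theta> \<le> K * e^2\<close> was arranged for this.\<close>
        also have "\<dots> = ?k y z * p ^ 8 * (cd (C y))\<^sup>2 * (cd (C z))\<^sup>2 * (2 / \<theta>)" by simp
        also have "\<dots> \<le> ?k y z * p ^ 8 * (cd (C y))\<^sup>2 * (cd (C z))\<^sup>2 * (K\<^sup>2 * e ^ 4)"
        proof (rule mult_left_mono)
          have t: "1 \<le> 2 / \<theta>" using \<theta> by simp
          have "2 / \<theta> \<le> (2 / \<theta>)\<^sup>2" using t mult_right_mono[OF t, of "2 / \<theta>"] \<theta> by (simp add: power2_eq_square)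
          also have "\<dots> \<le> (K * e\<^sup>2)\<^sup>2" using K \<theta> by (intro power_mono) auto
          finally show "2 / \<theta> \<le> K\<^sup>2 * e ^ 4" by (simp add: power_mult_distrib)
        qed (use k0 p_pos in auto)
        also have "\<dots> = ?k y z * K\<^sup>2 * p ^ 4 * ((e * p * cd (C y))\<^sup>2 * (e * p * cd (C z))\<^sup>2)"
          by (simp add: power_mult_distrib eval_nat_numeral mult_ac)
        also have "\<dots> \<le> ?k y z * K\<^sup>2 * p ^ 4 * ((cd (?C y))\<^sup>2 * (cd (?C z))\<^sup>2)"
          using gy gz k0 p_pos by (intro mult_left_mono mult_mono) auto
        finally show ?thesis unfolding nbrs' using xy True by (simp add: power_add power2_eq_square mult_ac)
      next
        case False
        have Cz: "?C z = C z" unfolding shrink_def using False by simp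
        have "C4 (h y z) (?C y) (?C z) \<le> C4 (h y z) {q\<in>C y. E v' q} (C z)"
          unfolding Cz using subE[OF xy] finC by (intro C4_mono) auto
        also have "\<dots> \<le> 2 * ?k y z / \<theta> * p ^ 6 * (cd (C y))\<^sup>2 * (cd (C z))\<^sup>2"
          using nF v' False unfolding F_def by auto
        also have "\<dots> = ?k y z * p ^ 6 * (cd (C y))\<^sup>2 * (cd (C z))\<^sup>2 * (2 / \<theta>)" by simp
        also have "\<dots> \<le> ?k y z * p ^ 6 * (cd (C y))\<^sup>2 * (cd (C z))\<^sup>2 * (K * e\<^sup>2)"
          using K k0 p_pos by (intro mult_left_mono) auto
        also have "\<dots> = ?k y z * K * p ^ 4 * ((e * p * cd (C y))\<^sup>2 * (cd (C z))\<^sup>2)"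
          by (simp add: power_mult_distrib eval_nat_numeral mult_ac)
        also have "\<dots> \<le> ?k y z * K * p ^ 4 * ((cd (?C y))\<^sup>2 * (cd (C z))\<^sup>2)"
          using gy k0 p_pos K by (intro mult_left_mono mult_right_mono) auto
        finally show ?thesis unfolding nbrs' Cz using xy False by (simp add: power_add mult_ac)
      qed
    qed
    have c4: "C4 (h y z) (?C y) (?C z) \<le> \<kappa> * K ^ (nbrs ?S y + nbrs ?S z) * p ^ 4 * (cd (?C y))\<^sup>2 * (cd (?C z))\<^sup>2"
      if y: "y \<in> W - ?S" and z: "z \<in> W - ?S" and yz: "adj y z" for y z
    proof -
      have y': "y \<in> W - S" and z': "z \<in> W - S" using y z by auto
      consider "adj x y" | "adj x z" | "\<not> adj x y" "\<not> adj x z" by blast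
      then show ?thesis
      proof cases
        case 1
        then show ?thesis using one[OF y' z' yz] by simp
      next
        case 2
        have "C4 (h y z) (?C y) (?C z) = C4 (h z y) (?C z) (?C y)"
          unfolding h_sym[of y z] by (rule C4_commute) (rule excess_sym)
        then show ?thesis using one[OF z' y' adj_sym[OF yz] 2] by (simp add: add.commute mult_ac)
      next
        case 3
        then show ?thesis using v y' z' yz unfolding nbrs' shrink_def valid_def by auto
      qed
    qed
    have old: "\<And>y. y \<in> W - S \<Longrightarrow> C y \<subseteq> Vs (col y)"
      "\<And>u y. y \<in> W - S \<Longrightarrow> u \<in> S \<Longrightarrow> adj u y \<Longrightarrow> (\<forall>q\<in>C y. R (f u) q)"
      "\<And>u. u \<in> S \<Longrightarrow> f u \<in> Vs (col u)" "inj_on f S"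
      "\<And>u w. u \<in> S \<Longrightarrow> w \<in> S \<Longrightarrow> adj u w \<Longrightarrow> R (f u) (f w)"
      using v unfolding valid_def by blast+
    have irr: "\<not> adj x x" using col_adj[of x x] xS by auto
    show ?thesis
      unfolding valid_def
    proof (intro conjI)
      show "?S \<subseteq> W" using S xS by auto
      show "inj_on (f(x := v')) ?S" using old(4) v' xS by (auto simp: inj_on_def)
      show "\<forall>u\<in>?S. (f(x := v')) u \<in> Vs (col u)" using old(1)[OF x] old(3) v' xS by auto
      show "\<forall>u\<in>?S. \<forall>w\<in>?S. adj u w \<longrightarrow> R ((f(x := v')) u) ((f(x := v')) w)"
      proof (intro ballI impI)
        fix u w assume u: "u \<in> ?S" and w: "w \<in> ?S" and uw: "adj u w"
        consider "u = x" "w \<in> S" | "u \<in> S" "w = x" | "u \<in> S" "w \<in> S" using u w uw irr by auto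
        then show "R ((f(x := v')) u) ((f(x := v')) w)"
        proof cases
          case 1
          then have "R (f w) v'" using old(2)[OF x, of w] adj_sym uw v' by auto
          then show ?thesis using 1 xS R_sym by auto
        next
          case 2
          then have "R (f u) v'" using old(2)[OF x, of u] uw v' by auto
          then show ?thesis using 2 xS by auto
        next
          case 3
          then show ?thesis using old(5) uw xS by auto
        qed
      qed
      show "\<forall>y\<in>W - ?S. ?C y \<subseteq> Vs (col y) \<and>
        (\<forall>u\<in>?S. adj u y \<longrightarrow> (\<forall>q\<in>?C y. R ((f(x := v')) u) q)) \<and> (e * p) ^ nbrs ?S y * M \<le> cd (?C y)"
      proof (intro ballI conjI impI)
        fix y assume y: "y \<in> W - ?S"
        then show "?C y \<subseteq> Vs (col y)" using old(1)[of y] sub[of y] by auto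
        show "(e * p) ^ nbrs ?S y * M \<le> cd (?C y)" by (rule size[OF y])
        fix u q assume u: "u \<in> ?S" "adj u y" and q: "q \<in> ?C y"
        show "R ((f(x := v')) u) q"
        proof (cases "u = x")
          case True
          then show ?thesis using u q unfolding shrink_def by auto
        next
          case False
          then show ?thesis using u old(2)[of y u] y sub[of y] q by auto
        qed
      qed
      show "\<forall>y\<in>W - ?S. \<forall>z\<in>W - ?S. adj y z \<longrightarrow>
        C4 (h y z) (?C y) (?C z) \<le> \<kappa> * K ^ (nbrs ?S y + nbrs ?S z) * p ^ 4 * (cd (?C y))\<^sup>2 * (cd (?C z))\<^sup>2"
        using c4 by blast
    qed
  qed
  then show ?thesis using BC cardB by blast
qed

lemma valid_init: "valid {} f (\<lambda>y. Vs (col y))"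
  unfolding valid_def nbrs_def using M init by auto

end

section \<open>Embedding a bounded degree graph\<close>

lemma exists_le_average:
  fixes f :: "'a \<Rightarrow> real"
  assumes "finite X" "X \<noteq> {}" "sum f X \<le> cd X * c"
  shows "\<exists>x\<in>X. f x \<le> c"
proof (rule ccontr)
  assume "\<not> ?thesis"
  then have "(\<Sum>x\<in>X. c) < sum f X" using assms(1,2) by (intro sum_strict_mono) auto
  with assms(3) show False by simp
qed

lemma half_le_ln:
  fixes u :: real
  assumes "0 \<le> u" "u \<le> 1"
  shows "u / 2 \<le> ln (1 + u)"
proof -
  have "- ln (1 + u) = ln (1 / (1 + u))" using assms by (simp add: ln_div)
  also have "\<dots> \<le> 1 / (1 + u) - 1" using assms by (intro ln_le_minus_one) auto
  also have "\<dots> = - (u / (1 + u))" using assms by (simp add: field_simps)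
  finally have "u / (1 + u) \<le> ln (1 + u)" by simp
  moreover have "u / 2 \<le> u / (1 + u)" using assms by (intro divide_left_mono) auto
  ultimately show ?thesis by linarith
qed

context embedding
begin

text \<open>When a neighbour of \<open>y\<close> is embedded, \<open>q\<close> remains in \<open>C y\<close> with probability at most \<open>4 * p\<close>,
  so the load of \<open>q\<close> does not increase on average.\<close>

definition load :: "'b set \<Rightarrow> ('b \<Rightarrow> 'a set) \<Rightarrow> 'a \<Rightarrow> real" where
  "load S C q = (\<Prod>y\<in>W - S. 1 + of_bool (q \<in> C y) * (4 * p) ^ (\<Delta> - nbrs S y))"

definition host :: "'a set" where "host = (\<Union>y\<in>W. Vs (col y))"

definition total_load :: "'b set \<Rightarrow> ('b \<Rightarrow> 'a set) \<Rightarrow> real" where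
  "total_load S C = (\<Sum>q\<in>host. load S C q)"

lemma host_V: "host \<subseteq> V" "finite host"
  unfolding host_def using VsV fin by (auto simp: finW)

lemma load_factor_ge: "1 \<le> 1 + of_bool b * (4 * p) ^ k"
  using p_pos by auto

lemma load_pos: "1 \<le> load S C q"
  unfolding load_def by (rule prod_ge_1) (rule load_factor_ge)

lemma load_le_total:
  assumes "q \<in> host"
  shows "load S C q \<le> total_load S C"
  unfolding total_load_def using assms host_V(2) order.trans[OF zero_le_one load_pos]
  by (intro member_le_sum) auto

lemma initial_load: "total_load {} (\<lambda>y. Vs (col y)) \<le> cd V * exp (cd W * (4 * p) ^ \<Delta>)"
proof -
  have "load {} (\<lambda>y. Vs (col y)) q \<le> exp (cd W * (4 * p) ^ \<Delta>)" for q
  proof -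
    have "load {} (\<lambda>y. Vs (col y)) q \<le> (\<Prod>y\<in>W - {}. exp ((4 * p) ^ \<Delta>))"
      unfolding load_def
    proof (intro prod_mono conjI)
      fix y
      have "1 + of_bool (q \<in> Vs (col y)) * (4 * p) ^ (\<Delta> - nbrs {} y) \<le> 1 + (4 * p) ^ \<Delta>"
        using p_pos by (auto simp: nbrs_def)
      also have "\<dots> \<le> exp ((4 * p) ^ \<Delta>)" by (rule exp_ge_add_one_self)
      finally show "1 + of_bool (q \<in> Vs (col y)) * (4 * p) ^ (\<Delta> - nbrs {} y) \<le> exp ((4 * p) ^ \<Delta>)" .
    qed (use p_pos in auto)
    also have "\<dots> = exp (cd W * (4 * p) ^ \<Delta>)" by (simp add: exp_of_nat_mult)
    finally show ?thesis .
  qed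
  then have "total_load {} (\<lambda>y. Vs (col y)) \<le> cd host * exp (cd W * (4 * p) ^ \<Delta>)"
    unfolding total_load_def by (intro sum_bounded_above)
  also have "\<dots> \<le> cd V * exp (cd W * (4 * p) ^ \<Delta>)"
    using host_V(1) finV by (intro mult_right_mono) (auto intro: card_mono)
  finally show ?thesis .
qed

lemma cand_ge:
  assumes v: "valid S f C" and y: "y \<in> W - S"
  shows "(e * p) ^ \<Delta> * M \<le> cd (C y)"
proof -
  have "nbrs S y \<le> \<Delta>" using nbrs_le[of S "{}" y] v y unfolding valid_def by auto
  then have "(e * p) ^ \<Delta> * M \<le> (e * p) ^ nbrs S y * M"
    using ep M(1) by (intro mult_right_mono power_decreasing) auto
  also have "\<dots> \<le> cd (C y)" using v y unfolding valid_def by blast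
  finally show ?thesis .
qed

text \<open>Up to constants, the left-hand side is the expected number of hits in \<open>C y\<close>
  if every \<open>x\<close> in \<open>X\<close> picks an image at random from \<open>C x\<close>. A
  point \<open>q\<close> of \<open>C y\<close> receives the total weight of
  \<open>1 / cd (C x)\<close> over the sets \<open>C x\<close> containing it. As
  \<open>cd (C x)\<close> is at least of order \<open>p ^ nbrs S x * M\<close>, this weight is at
  most \<open>2 * ln (load S C q)\<close> divided by \<open>(e * p) ^ \<Delta> * M\<close>. The
  logarithm turns the product in \<open>load\<close> into this sum.\<close>

lemma overlap:
  assumes v: "valid S f C" and T: "total_load S C \<le> B" and B: "ln B \<le> (e * p) ^ \<Delta> * M / 100"
    and X: "X \<subseteq> W - S" and y: "y \<in> W - S"
  shows "(\<Sum>x\<in>X. cd (C x \<inter> C y) / cd (C x)) \<le> cd (C y) / 50"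
proof -
  let ?m = "(e * p) ^ \<Delta> * M"
  have m: "0 < ?m" using ep M(1) by simp
  have S: "S \<subseteq> W" using v unfolding valid_def by auto
  have finX: "finite X" using X finW by (auto intro: finite_subset)
  have finC: "finite (C u)" if "u \<in> W - S" for u using valid_sub[OF v that] by (rule fin)
  have nbD: "nbrs S u \<le> \<Delta>" if "u \<in> W - S" for u using nbrs_le[of S "{}" u] S that by auto
  have one: "(\<Sum>x\<in>X. of_bool (q \<in> C x) * p ^ (\<Delta> - nbrs S x)) \<le> 2 * ln B" if q: "q \<in> host" for q
  proof -
    have "(\<Sum>x\<in>X. of_bool (q \<in> C x) * p ^ (\<Delta> - nbrs S x)) \<le> (\<Sum>x\<in>W - S. of_bool (q \<in> C x) * p ^ (\<Delta> - nbrs S x))"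
      using X finW p_pos by (intro sum_mono2) auto
    also have "\<dots> \<le> (\<Sum>x\<in>W - S. 2 * ln (1 + of_bool (q \<in> C x) * (4 * p) ^ (\<Delta> - nbrs S x)))"
    proof (rule sum_mono)
      fix x
      let ?u = "of_bool (q \<in> C x) * p ^ (\<Delta> - nbrs S x)"
      have u: "0 \<le> ?u" "?u \<le> 1" using p_pos p_le by (auto intro: power_le_one)
      have "?u / 2 \<le> ln (1 + ?u)" using u by (rule half_le_ln)
      also have "\<dots> \<le> ln (1 + of_bool (q \<in> C x) * (4 * p) ^ (\<Delta> - nbrs S x))"
      proof (rule ln_mono)
        have "p ^ (\<Delta> - nbrs S x) \<le> (4 * p) ^ (\<Delta> - nbrs S x)" using p_pos by (intro power_mono) auto
        then show "1 + ?u \<le> 1 + of_bool (q \<in> C x) * (4 * p) ^ (\<Delta> - nbrs S x)" by auto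
      qed (use u in linarith)
      finally show "?u \<le> 2 * ln (1 + of_bool (q \<in> C x) * (4 * p) ^ (\<Delta> - nbrs S x))" by simp
    qed
    also have "\<dots> = 2 * ln (load S C q)"
    proof -
      have "ln (load S C q) = (\<Sum>x\<in>W - S. ln (1 + of_bool (q \<in> C x) * (4 * p) ^ (\<Delta> - nbrs S x)))"
        unfolding load_def
      proof (rule ln_prod)
        show "1 + of_bool (q \<in> C x) * (4 * p) ^ (\<Delta> - nbrs S x) \<noteq> 0" for x
          using load_factor_ge[of "q \<in> C x" "\<Delta> - nbrs S x"] by linarith
      qed (use finW in auto)
      then show ?thesis by (simp add: sum_distrib_left)
    qed
    also have "\<dots> \<le> 2 * ln B"
    proof -
      have "ln (load S C q) \<le> ln B"
        using load_le_total[OF q, of S C] T load_pos[of S C q] by (intro ln_mono) linarith+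
      then show ?thesis by simp
    qed
    finally show ?thesis .
  qed
  have inv: "1 / cd (C x) \<le> p ^ (\<Delta> - nbrs S x) / ?m" if x: "x \<in> X" for x
  proof -
    have x': "x \<in> W - S" using x X by auto
    have "?m \<le> p ^ (\<Delta> - nbrs S x) * ((e * p) ^ nbrs S x * M)"
    proof -
      have "e ^ \<Delta> \<le> e ^ nbrs S x" using e nbD[OF x'] by (intro power_decreasing) auto
      then have "e ^ \<Delta> * (p ^ \<Delta> * M) \<le> e ^ nbrs S x * (p ^ \<Delta> * M)"
        using p_pos M(1) by (intro mult_right_mono) auto
      moreover have "p ^ \<Delta> = p ^ (\<Delta> - nbrs S x) * p ^ nbrs S x" using nbD[OF x'] by (simp add: power_add[symmetric])
      ultimately show ?thesis by (simp add: power_mult_distrib mult_ac)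
    qed
    also have "\<dots> \<le> p ^ (\<Delta> - nbrs S x) * cd (C x)"
      using v x' p_pos unfolding valid_def by (intro mult_left_mono) auto
    finally show ?thesis using m valid_pos[OF v x'] by (simp add: field_simps)
  qed
  have "(\<Sum>x\<in>X. cd (C x \<inter> C y) / cd (C x)) = (\<Sum>x\<in>X. \<Sum>q\<in>C y. of_bool (q \<in> C x) * (1 / cd (C x)))"
  proof (rule sum.cong[OF refl])
    fix x
    have "cd (C x \<inter> C y) = (\<Sum>q\<in>C y. of_bool (q \<in> C x))"
      using card_filter_eq_sum[OF finC[OF y], of "\<lambda>q. q \<in> C x"] by (simp add: Int_def conj_commute)
    then show "cd (C x \<inter> C y) / cd (C x) = (\<Sum>q\<in>C y. of_bool (q \<in> C x) * (1 / cd (C x)))"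
      by (simp only: sum_distrib_right[symmetric]) simp
  qed
  also have "\<dots> \<le> (\<Sum>x\<in>X. \<Sum>q\<in>C y. of_bool (q \<in> C x) * (p ^ (\<Delta> - nbrs S x) / ?m))"
    using inv by (intro sum_mono mult_left_mono) auto
  also have "\<dots> = (\<Sum>q\<in>C y. (\<Sum>x\<in>X. of_bool (q \<in> C x) * p ^ (\<Delta> - nbrs S x)) / ?m)"
    by (subst sum.swap) (simp add: sum_divide_distrib)
  also have "\<dots> \<le> (\<Sum>q\<in>C y. 1 / 50)"
  proof (rule sum_mono)
    fix q assume "q \<in> C y"
    then have "q \<in> Vs (col y)" using v y unfolding valid_def by blast
    then have "q \<in> host" unfolding host_def using y by auto
    from one[OF this] B have "(\<Sum>x\<in>X. of_bool (q \<in> C x) * p ^ (\<Delta> - nbrs S x)) \<le> ?m / 50" by linarith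
    then show "(\<Sum>x\<in>X. of_bool (q \<in> C x) * p ^ (\<Delta> - nbrs S x)) / ?m \<le> 1 / 50"
      using m by (simp add: pos_divide_le_eq)
  qed
  finally show ?thesis by simp
qed

text \<open>The neighbours of \<open>x\<close> have distinct colours, hence disjoint host sets, so
  at most one of them has \<open>q\<close> among its candidates and only one factor can change. At
  most \<open>2 * p * cd (C x) \<le> 4 * p * cd G\<close> choices keep \<open>q\<close> there, which
  offsets the exponent dropping by one. The factor of \<open>x\<close> itself disappears, and it was
  at least 1.\<close>

lemma average_load:
  assumes v: "valid S f C" and x: "x \<in> W - S" and G: "G \<subseteq> C x" "cd (C x) \<le> 2 * cd G" and q: "q \<in> host"
  shows "(\<Sum>v\<in>G. load (insert x S) (shrink C x v) q) \<le> cd G * load S C q"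
proof -
  let ?U = "W - insert x S"
  have S: "S \<subseteq> W" and finS: "finite S" using v finW finite_subset unfolding valid_def by auto
  have finU: "finite ?U" using finW by auto
  have xS: "x \<notin> S" using x by auto
  have nbrs': "nbrs (insert x S) y = nbrs S y + (if adj x y then 1 else 0)" for y
    using nbrs_insert[OF finS xS] .
  define old where "old y = 1 + of_bool (q \<in> C y) * (4 * p) ^ (\<Delta> - nbrs S y)" for y
  define new where "new v y = 1 + of_bool (q \<in> shrink C x v y) * (4 * p) ^ (\<Delta> - nbrs (insert x S) y)" for v y
  have old1: "1 \<le> old y" for y unfolding old_def by (rule load_factor_ge)
  have same: "new v y = old y" if "\<not> (adj x y \<and> q \<in> C y)" for v y
    using that unfolding old_def new_def nbrs' shrink_def by auto
  have eqU: "W - S - {x} = ?U" by auto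
  have loadS: "load S C q = old x * (\<Prod>y\<in>?U. old y)"
    using prod.remove[OF finite_Diff[OF finW] x, of old] unfolding eqU load_def old_def[symmetric] .
  have P0: "0 \<le> (\<Prod>y\<in>X. old y)" for X using old1 by (intro prod_nonneg) (auto intro: order.trans[OF zero_le_one])
  have loadS': "(\<Prod>y\<in>?U. old y) \<le> load S C q"
    unfolding loadS using old1[of x] P0[of ?U] mult_right_mono[OF old1[of x] P0[of ?U]] by simp
  have loadN: "load (insert x S) (shrink C x v) q = (\<Prod>y\<in>?U. new v y)" for v
    unfolding load_def new_def ..
  show ?thesis
  proof (cases "\<exists>y\<in>?U. adj x y \<and> q \<in> C y")
    case False
    then have "(\<Prod>y\<in>?U. new v y) = (\<Prod>y\<in>?U. old y)" for v by (intro prod.cong refl same) auto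
    then have "(\<Sum>v\<in>G. load (insert x S) (shrink C x v) q) = cd G * (\<Prod>y\<in>?U. old y)"
      unfolding loadN by simp
    also have "\<dots> \<le> cd G * load S C q" using loadS' by (intro mult_left_mono) auto
    finally show ?thesis .
  next
    case True
    then obtain z where z: "z \<in> ?U" "adj x z" "q \<in> C z" by blast
    have zS: "z \<in> W - S" using z by auto
    have uniq: "\<not> (adj x y \<and> q \<in> C y)" if "y \<in> ?U - {z}" for y
    proof
      assume y: "adj x y \<and> q \<in> C y"
      have "col y \<noteq> col z" using col_two[of x y z] x that z y by auto
      then have "Vs (col y) \<inter> Vs (col z) = {}" using that z by (intro Vs_disj) auto
      moreover have "q \<in> Vs (col y)" "q \<in> Vs (col z)" using v that z y zS unfolding valid_def by blast+
      ultimately show False by auto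
    qed
    have rest: "(\<Prod>y\<in>?U - {z}. new v y) = (\<Prod>y\<in>?U - {z}. old y)" for v
      by (intro prod.cong refl same uniq)
    have nbz: "nbrs S z + 1 \<le> \<Delta>" using nbrs_le[of S "{x}" z] S x z by auto
    have "(\<Sum>v\<in>G. new v z) \<le> cd G * old z"
    \<comment> \<open>A point \<open>q\<close> with more neighbours than this in \<open>C x\<close>
      is discarded by \<open>shrink\<close>, whatever the choice of \<open>v\<close>.\<close>
    proof (cases "(\<Sum>u\<in>C x. a q u) \<le> 2 * p * cd (C x)")
      case True
      have "(\<Sum>v\<in>G. new v z) \<le> (\<Sum>v\<in>G. 1 + a q v * (4 * p) ^ (\<Delta> - nbrs S z - 1))"
      proof (rule sum_mono)
        fix v
        have "of_bool (q \<in> shrink C x v z) \<le> a q v"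
          using R_E[of v q] symE[of v q] z(2) unfolding shrink_def by auto
        then have "of_bool (q \<in> shrink C x v z) * (4 * p) ^ (\<Delta> - nbrs S z - 1) \<le> a q v * (4 * p) ^ (\<Delta> - nbrs S z - 1)"
          using p_pos by (intro mult_right_mono) auto
        moreover have "new v z = 1 + of_bool (q \<in> shrink C x v z) * (4 * p) ^ (\<Delta> - nbrs S z - 1)"
          unfolding new_def nbrs' using z(2) by simp
        ultimately show "new v z \<le> 1 + a q v * (4 * p) ^ (\<Delta> - nbrs S z - 1)" by linarith
      qed
      also have "\<dots> = cd G + (\<Sum>v\<in>G. a q v) * (4 * p) ^ (\<Delta> - nbrs S z - 1)"
        by (simp add: sum.distrib sum_distrib_right)
      also have "\<dots> \<le> cd G + (4 * p * cd G) * (4 * p) ^ (\<Delta> - nbrs S z - 1)"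
      proof (intro add_left_mono mult_right_mono)
        have "(\<Sum>v\<in>G. a q v) \<le> (\<Sum>v\<in>C x. a q v)"
          using G(1) fin[OF valid_sub[OF v x]] by (intro sum_mono2) auto
        also have "\<dots> \<le> 2 * p * (2 * cd G)" using True G(2) p_pos by (intro order.trans[OF True] mult_left_mono) auto
        finally show "(\<Sum>v\<in>G. a q v) \<le> 4 * p * cd G" by simp
      qed (use p_pos in auto)
      also have "\<dots> = cd G * (1 + (4 * p) ^ Suc (\<Delta> - nbrs S z - 1))" by (simp add: algebra_simps)
      also have "Suc (\<Delta> - nbrs S z - 1) = \<Delta> - nbrs S z" using nbz by simp
      finally show ?thesis unfolding old_def using z(3) by simp
    next
      case False
      then have "new v z = 1" for v unfolding new_def shrink_def using z(2) by auto
      then show ?thesis using mult_left_mono[OF old1[of z], of "cd G"] by simp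
    qed
    then have "(\<Sum>v\<in>G. new v z) * (\<Prod>y\<in>?U - {z}. old y) \<le> cd G * old z * (\<Prod>y\<in>?U - {z}. old y)"
      by (rule mult_right_mono[OF _ P0])
    moreover have "(\<Prod>y\<in>?U. F y) = F z * (\<Prod>y\<in>?U - {z}. F y)" for F :: "'b \<Rightarrow> real"
      using finU z(1) by (rule prod.remove)
    ultimately have "(\<Sum>v\<in>G. load (insert x S) (shrink C x v) q) \<le> cd G * (\<Prod>y\<in>?U. old y)"
      unfolding loadN rest[symmetric] by (simp add: sum_distrib_right rest mult.assoc)
    also have "\<dots> \<le> cd G * load S C q" using loadS' by (intro mult_left_mono) auto
    finally show ?thesis .
  qed
qed

text \<open>The second potential, summed over the unembedded vertices \<open>y\<close> of the class that is being
  embedded, bounds the number of vertices of \<open>C y\<close> that are already taken.\<close>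

definition taken :: "'b set \<Rightarrow> ('b \<Rightarrow> 'a set) \<Rightarrow> 'b set \<Rightarrow> ('b \<Rightarrow> 'a) \<Rightarrow> real" where
  "taken X C T f = (\<Sum>y\<in>X - T. 2 ^ card (C y \<inter> f ` T) / (\<Prod>x\<in>T. 1 + 2 * cd (C x \<inter> C y) / cd (C x)))"

text \<open>A hit in \<open>C y\<close> doubles the numerator. Since \<open>G\<close> is at least
  half of \<open>C x\<close>, a random choice hits \<open>C y\<close> with probability at most
  \<open>2 * cd (C x \<inter> C y) / cd (C x)\<close>, and the new factor of the denominator
  compensates for exactly this expected growth.\<close>

lemma average_taken:
  assumes fin: "finite X" "finite T" "\<And>y. y \<in> X \<Longrightarrow> finite (C y)" and x: "x \<in> X - T" and T: "T \<subseteq> X"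
    and G: "G \<subseteq> C x" "cd (C x) \<le> 2 * cd G" "G \<inter> f ` T = {}" "G \<noteq> {}"
  shows "(\<Sum>v\<in>G. taken X C (insert x T) (f(x := v))) \<le> cd G * taken X C T f"
proof -
  define D where "D T y = (\<Prod>x\<in>T. 1 + 2 * cd (C x \<inter> C y) / cd (C x))" for T y
  define t where "t y = 2 ^ card (C y \<inter> f ` T) / D T y" for y
  have Dpos: "0 < D T y" for T y unfolding D_def by (intro prod_pos) (auto intro!: add_pos_nonneg)
  have t0: "0 \<le> t y" for y unfolding t_def using less_imp_le[OF Dpos] by (intro divide_nonneg_nonneg) auto
  have finG: "finite G" using G(1) fin(3) x finite_subset by auto
  have Cx: "0 < cd (C x)" using G fin(3)[of x] x finG by (auto simp: card_gt_0_iff)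
  have *: "(\<Sum>v\<in>G. 2 ^ card (C y \<inter> (f(x := v)) ` insert x T) / D (insert x T) y) \<le> cd G * t y" if y: "y \<in> X" for y
  proof -
    let ?c = "2 ^ card (C y \<inter> f ` T) :: real"
    let ?r = "1 + 2 * cd (C x \<inter> C y) / cd (C x)"
    have im: "(f(x := v)) ` insert x T = insert v (f ` T)" for v using x by auto
    have "(\<Sum>v\<in>G. 2 ^ card (C y \<inter> (f(x := v)) ` insert x T)) = (\<Sum>v\<in>G. ?c * (1 + of_bool (v \<in> C y)))"
    proof (rule sum.cong[OF refl])
      fix v assume "v \<in> G"
      then have "v \<notin> f ` T" using G(3) by auto
      then have "card (C y \<inter> insert v (f ` T)) = card (C y \<inter> f ` T) + of_bool (v \<in> C y)"
        using fin(3)[OF y] by (auto simp: Int_insert_right)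
      then show "2 ^ card (C y \<inter> (f(x := v)) ` insert x T) = ?c * (1 + of_bool (v \<in> C y))"
        unfolding im by (simp add: power_add)
    qed
    also have "\<dots> = ?c * (cd G + cd {v\<in>G. v \<in> C y})"
      using finG by (simp add: sum_distrib_left[symmetric] sum.distrib card_filter_eq_sum)
    also have "\<dots> \<le> ?c * (cd G * ?r)"
    proof (rule mult_left_mono)
      have "card {v\<in>G. v \<in> C y} \<le> card (C x \<inter> C y)"
        using G(1) fin(3) x by (intro card_mono) auto
      then have "cd {v\<in>G. v \<in> C y} \<le> cd (C x \<inter> C y)" by simp
      also have "\<dots> = cd (C x) * (cd (C x \<inter> C y) / cd (C x))" using Cx by simp
      also have "\<dots> \<le> 2 * cd G * (cd (C x \<inter> C y) / cd (C x))"
        using G(2) by (intro mult_right_mono) auto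
      finally show "cd G + cd {v\<in>G. v \<in> C y} \<le> cd G * ?r" by (simp add: algebra_simps)
    qed simp
    finally have "(\<Sum>v\<in>G. 2 ^ card (C y \<inter> (f(x := v)) ` insert x T)) / D (insert x T) y \<le> ?c * (cd G * ?r) / D (insert x T) y"
      using Dpos[of "insert x T" y] by (intro divide_right_mono) auto
    moreover have "D (insert x T) y = ?r * D T y" unfolding D_def using fin(2) x by simp
    moreover have "?r > 0" by (intro add_pos_nonneg) auto
    then have "?c * (cd G * ?r) / (?r * D T y) = cd G * t y" unfolding t_def by simp
    ultimately show ?thesis by (simp only: sum_divide_distrib)
  qed
  have "(\<Sum>v\<in>G. taken X C (insert x T) (f(x := v)))
    = (\<Sum>y\<in>X - insert x T. \<Sum>v\<in>G. 2 ^ card (C y \<inter> (f(x := v)) ` insert x T) / D (insert x T) y)"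
    unfolding taken_def D_def by (rule sum.swap)
  also have "\<dots> \<le> (\<Sum>y\<in>X - insert x T. cd G * t y)" by (intro sum_mono *) auto
  also have "\<dots> \<le> (\<Sum>y\<in>X - T. cd G * t y)"
    using fin(1) t0 by (intro sum_mono2 mult_nonneg_nonneg) auto
  also have "\<dots> = cd G * taken X C T f" unfolding taken_def t_def D_def by (simp add: sum_distrib_left)
  finally show ?thesis .
qed

text \<open>Vertices of one class are pairwise nonadjacent, so their candidate sets stay fixed while
  the class is embedded; \<open>taken\<close> relies on this. The sum of both potentials does not
  increase on average over \<open>G\<close>, hence a single choice serves both.\<close>

lemma embed_class:
  assumes v0: "valid S f C" and S: "S \<inter> {x\<in>W. col x = j} = {}" and X: "X = {x\<in>W. col x = j}"
    and T0: "total_load S C + cd X \<le> B" and B: "ln B \<le> (e * p) ^ \<Delta> * M / 100"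
  shows "\<exists>f' C'. valid (S \<union> X) f' C' \<and> total_load (S \<union> X) C' \<le> total_load S C + cd X"
proof -
  have finX: "finite X" unfolding X using finW by auto
  have XW: "X \<subseteq> W - S" using S unfolding X by auto
  have finC: "finite (C y)" if "y \<in> X" for y using valid_sub[OF v0, of y] XW that fin by auto
  have ov: "(\<Sum>x\<in>Y. cd (C x \<inter> C y) / cd (C x)) \<le> cd (C y) / 50" if "Y \<subseteq> X" "y \<in> X" for Y y
    using overlap[OF v0 _ B, of Y y] T0 XW that by auto
  have "\<exists>f' C'. valid (S \<union> T) f' C' \<and> (\<forall>y\<in>X. C' y = C y) \<and>
      total_load (S \<union> T) C' + taken X C T f' \<le> total_load S C + cd X" if T: "T \<subseteq> X" for T
  proof -
    from T finX have "finite T" by (rule finite_subset)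
    from this T show ?thesis
    proof (induction T)
      case empty
      \<comment> \<open>Every vertex of the class starts with the value 1, so opening a class raises
        the sum of the potentials by its size.\<close>
      have "taken X C {} f = cd X" unfolding taken_def by simp
      then show ?case using v0 by (intro exI[of _ f] exI[of _ C]) auto
    next
      case (insert x T)
      obtain f1 C1 where v: "valid (S \<union> T) f1 C1" and C1: "\<And>y. y \<in> X \<Longrightarrow> C1 y = C y"
        and P: "total_load (S \<union> T) C1 + taken X C T f1 \<le> total_load S C + cd X"
        using insert by auto
      have xX: "x \<in> X" and xT: "x \<notin> T" and TX: "T \<subseteq> X" using insert by auto
      have x: "x \<in> W - (S \<union> T)" using xX xT XW by auto
      have x0: "x \<in> W - S" using x by auto
      have Cx: "C1 x = C x" using C1 xX by simp
      obtain Bd where Bd: "Bd \<subseteq> C1 x" "cd Bd \<le> cd (C1 x) / 4"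
        and ext: "\<And>v. v \<in> C1 x - Bd - f1 ` (S \<union> T) \<Longrightarrow> valid (insert x (S \<union> T)) (f1(x := v)) (shrink C1 x v)"
        using extend[OF v x] by blast
      \<comment> \<open>Earlier classes are embedded into other host sets, so only images of the
        current class can block \<open>C x\<close>.\<close>
      have used: "C x \<inter> f1 ` (S \<union> T) = C x \<inter> f1 ` T"
      proof -
        have "f1 u \<notin> C x" if u: "u \<in> S" for u
        proof -
          have "f1 u \<in> Vs (col u)" "u \<in> W" using v u unfolding valid_def by auto
          moreover have "C x \<subseteq> Vs (col x)" using v0 x0 unfolding valid_def by blast
          moreover have "col u \<noteq> col x" using S u \<open>u \<in> W\<close> xX unfolding X by auto
          ultimately show ?thesis using Vs_disj[of u x] x by auto
        qed
        then show ?thesis by auto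
      qed
      \<comment> \<open>The number of hits times \<open>ln 2\<close> is at most \<open>ln B\<close>
        plus the logarithm of the denominator. The former is at most \<open>cd (C x) / 100\<close>;
        by \<open>overlap\<close> the latter is at most \<open>2 / 50\<close> of
        \<open>cd (C x)\<close>. Together this is \<open>cd (C x) / 20\<close>, and
        \<open>1 / 2 \<le> ln 2\<close>.\<close>
      have used_le: "card (C x \<inter> f1 ` T) \<le> cd (C x) / 4"
      proof -
        let ?D = "\<Prod>u\<in>T. 1 + 2 * cd (C u \<inter> C x) / cd (C u)"
        let ?t = "2 ^ card (C x \<inter> f1 ` T) / ?D"
        have Dpos: "0 < (\<Prod>u\<in>T. 1 + 2 * cd (C u \<inter> C y) / cd (C u))" for y
          by (intro prod_pos) (auto intro!: add_pos_nonneg)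
        have "?t \<le> taken X C T f1"
          unfolding taken_def using finX xX xT Dpos
          by (intro member_le_sum) (auto intro!: divide_nonneg_nonneg less_imp_le)
        also have "\<dots> \<le> B"
        proof -
          have "0 \<le> total_load (S \<union> T) C1"
            unfolding total_load_def by (intro sum_nonneg order.trans[OF zero_le_one load_pos])
          then show ?thesis using P T0 by linarith
        qed
        finally have tB: "?t \<le> B" .
        have tpos: "0 < ?t" using Dpos[of x] by (intro divide_pos_pos) auto
        have "ln ?D = (\<Sum>u\<in>T. ln (1 + 2 * cd (C u \<inter> C x) / cd (C u)))"
        proof (rule ln_prod[OF insert(1)])
          show "1 + 2 * cd (C u \<inter> C x) / cd (C u) \<noteq> 0" for u
            using divide_nonneg_nonneg[of "2 * cd (C u \<inter> C x)" "cd (C u)"] by linarith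
        qed
        also have "\<dots> \<le> (\<Sum>u\<in>T. 2 * (cd (C u \<inter> C x) / cd (C u)))"
          by (intro sum_mono order.trans[OF ln_add_one_self_le_self]) auto
        also have "\<dots> \<le> cd (C x) / 25"
          using ov[OF TX xX] unfolding sum_distrib_left[symmetric] by linarith
        finally have lnD: "ln ?D \<le> cd (C x) / 25" .
        have "real (card (C x \<inter> f1 ` T)) * ln 2 = ln ?t + ln ?D"
          using Dpos[of x] by (subst ln_div) (auto simp: ln_realpow)
        also have "ln ?t \<le> ln B" using tB tpos by (intro ln_mono) auto
        also have "ln B \<le> cd (C x) / 100" using B cand_ge[OF v0 x0] by linarith
        finally have l: "real (card (C x \<inter> f1 ` T)) * ln 2 \<le> cd (C x) / 20" using lnD by linarith
        have "real (card (C x \<inter> f1 ` T)) * (1 / 2) \<le> real (card (C x \<inter> f1 ` T)) * ln 2"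
          using half_le_ln[of 1] by (intro mult_left_mono) auto
        with l show ?thesis by linarith
      qed
      define G where "G = C x - Bd - f1 ` (S \<union> T)"
      have Cpos: "0 < cd (C x)" by (rule valid_pos[OF v0 x0])
      \<comment> \<open>At most a quarter is lost to \<open>Bd\<close> and at most a quarter to used
        vertices. The remaining half is what both averaging lemmas require.\<close>
      have cardG: "cd (C x) \<le> 2 * cd G"
      proof -
        have "C x \<subseteq> G \<union> Bd \<union> (C x \<inter> f1 ` T)" unfolding G_def using used by auto
        then have "card (C x) \<le> card (G \<union> Bd \<union> (C x \<inter> f1 ` T))"
          using finC[OF xX] Bd(1) Cx by (intro card_mono) (auto simp: G_def intro: finite_subset)
        also have "\<dots> \<le> card G + card Bd + card (C x \<inter> f1 ` T)"
          by (intro order.trans[OF card_Un_le] add_right_mono card_Un_le)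
        finally have "cd (C x) \<le> cd G + cd Bd + cd (C x \<inter> f1 ` T)" by linarith
        then show ?thesis using Bd(2) used_le unfolding Cx by linarith
      qed
      have GC: "G \<subseteq> C x" unfolding G_def by auto
      have finG: "finite G" using GC finC[OF xX] by (rule finite_subset)
      have Gne: "G \<noteq> {}" using cardG Cpos by auto
      have "(\<Sum>v\<in>G. total_load (insert x (S \<union> T)) (shrink C1 x v) + taken X C (insert x T) (f1(x := v)))
         = (\<Sum>q\<in>host. \<Sum>v\<in>G. load (insert x (S \<union> T)) (shrink C1 x v) q) + (\<Sum>v\<in>G. taken X C (insert x T) (f1(x := v)))"
        unfolding total_load_def sum.distrib by (simp add: sum.swap[of _ host])
      also have "\<dots> \<le> (\<Sum>q\<in>host. cd G * load (S \<union> T) C1 q) + cd G * taken X C T f1"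
      proof (intro add_mono sum_mono average_load[OF v x] average_taken)
        show "G \<inter> f1 ` T = {}" unfolding G_def by auto
      qed (use GC cardG Cx finX finC insert(1) xX xT TX Gne in auto)
      also have "\<dots> = cd G * (total_load (S \<union> T) C1 + taken X C T f1)"
        unfolding total_load_def by (simp add: sum_distrib_left distrib_left)
      finally obtain w where w: "w \<in> G"
        and P': "total_load (insert x (S \<union> T)) (shrink C1 x w) + taken X C (insert x T) (f1(x := w))
          \<le> total_load (S \<union> T) C1 + taken X C T f1"
        using exists_le_average[OF finG Gne] by blast
      have "valid (S \<union> insert x T) (f1(x := w)) (shrink C1 x w)"
        using ext[of w] w unfolding G_def Cx by simp
      moreover have "shrink C1 x w y = C y" if y: "y \<in> X" for y
        using C1[OF y] col_adj[of x y] x y xX unfolding shrink_def X by auto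
      moreover have "total_load (S \<union> insert x T) (shrink C1 x w) + taken X C (insert x T) (f1(x := w))
          \<le> total_load S C + cd X"
        using P P' unfolding Un_insert_right by linarith
      ultimately show ?case by blast
    qed
  qed
  from this[OF order.refl] obtain f' C' where *: "valid (S \<union> X) f' C'"
    "total_load (S \<union> X) C' + taken X C X f' \<le> total_load S C + cd X" by blast
  \<comment> \<open>No vertex of the class is left to sum over. Thus the load grows by at most the
    class size, and by at most \<open>cd W\<close> over all classes.\<close>
  have "taken X C X f' = 0" unfolding taken_def by simp
  then show ?thesis using * by auto
qed

lemma embed_all:
  assumes B: "cd V * exp (cd W * (4 * p) ^ \<Delta>) + cd W \<le> B" "ln B \<le> (e * p) ^ \<Delta> * M / 100"
  shows "\<exists>f. inj_on f W \<and> (\<forall>x\<in>W. f x \<in> Vs (col x)) \<and> (\<forall>x\<in>W. \<forall>y\<in>W. adj x y \<longrightarrow> R (f x) (f y))"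
proof -
  let ?I = "\<lambda>j. {x\<in>W. col x < j}"
  have "\<exists>f C. valid (?I j) f C \<and> total_load (?I j) C \<le> total_load {} (\<lambda>y. Vs (col y)) + cd (?I j)" for j
  proof (induction j)
    case 0
    show ?case using valid_init by fastforce
  next
    case (Suc j)
    then obtain f C where v: "valid (?I j) f C" and P: "total_load (?I j) C \<le> total_load {} (\<lambda>y. Vs (col y)) + cd (?I j)"
      by blast
    define X where "X = {x\<in>W. col x = j}"
    have un: "?I (Suc j) = ?I j \<union> X" unfolding X_def by auto
    have cards: "cd (?I (Suc j)) = cd (?I j) + cd X"
      unfolding un X_def using finW by (subst card_Un_disjoint) auto
    have "cd (?I (Suc j)) \<le> cd W" using finW by (auto intro: card_mono)
    then have "total_load (?I j) C + cd X \<le> B" using P B(1) initial_load cards by linarith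
    from embed_class[OF v _ X_def this B(2)] obtain f' C' where "valid (?I j \<union> X) f' C'"
      "total_load (?I j \<union> X) C' \<le> total_load (?I j) C + cd X" by auto
    then show ?case unfolding un[symmetric] using P cards by (intro exI[of _ f'] exI[of _ C']) auto
  qed
  \<comment> \<open>For empty \<open>W\<close> the value of \<open>Max\<close> is unspecified; any
    value works, as the set of vertices of smaller colour is empty too.\<close>
  from this[of "Suc (Max (col ` W))"] obtain f C where "valid (?I (Suc (Max (col ` W)))) f C" by blast
  moreover have "?I (Suc (Max (col ` W))) = W" using finW by (auto simp: less_Suc_eq_le)
  ultimately have "valid W f C" by simp
  then show ?thesis unfolding valid_def by (intro exI[of _ f]) auto
qed

end

section \<open>Colourings, disjoint blocks and logarithmic estimates\<close>

lemma greedy_colouring: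
  fixes W :: "'b set"
  assumes "finite W" "\<And>x. x \<in> W \<Longrightarrow> card {y\<in>W. conf x y} \<le> D" "\<And>x y. conf x y \<Longrightarrow> conf y x"
  shows "\<exists>col :: 'b \<Rightarrow> nat. (\<forall>x. col x \<le> D) \<and> (\<forall>x\<in>W. \<forall>y\<in>W. x \<noteq> y \<longrightarrow> conf x y \<longrightarrow> col x \<noteq> col y)"
  using assms(1,2)
proof (induction W)
  case empty
  show ?case by (intro exI[of _ "\<lambda>_. 0"]) auto
next
  case (insert x W)
  have "card {y\<in>W. conf z y} \<le> D" if "z \<in> W" for z
    using insert(1) insert.prems[of z] that
    by (intro order.trans[OF card_mono insert.prems[of z]]) auto
  then obtain col :: "'b \<Rightarrow> nat" where col: "\<forall>x. col x \<le> D"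
    "\<forall>x\<in>W. \<forall>y\<in>W. x \<noteq> y \<longrightarrow> conf x y \<longrightarrow> col x \<noteq> col y"
    using insert.IH by auto
  have "card (col ` {y\<in>W. conf x y}) \<le> card {y\<in>W. conf x y}" using insert(1) by (intro card_image_le) auto
  also have "\<dots> \<le> D"
    using insert(1) by (intro order.trans[OF card_mono insert.prems[of x]]) auto
  also have "\<dots> < card {..D}" by simp
  finally have "\<not> {..D} \<subseteq> col ` {y\<in>W. conf x y}"
    using card_mono[of "col ` {y\<in>W. conf x y}" "{..D}"] insert(1) by (auto simp del: card_atMost)
  then obtain i where i: "i \<le> D" "i \<notin> col ` {y\<in>W. conf x y}" by auto
  then show ?case
    using col insert(2) assms(3) by (intro exI[of _ "col(x := i)"]) auto
qed

text \<open>A greedy colouring of the square of the graph: a vertex conflicts with at most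
  \<open>\<Delta>\<close> neighbours and \<open>\<Delta> * \<Delta>\<close> ends of paths of length
  two.\<close>

lemma square_colouring:
  fixes W :: "'b set"
  assumes finW: "finite W" and deg: "\<And>x. x \<in> W \<Longrightarrow> card {y\<in>W. adj x y} \<le> \<Delta>"
    and sym: "\<And>x y. adj x y \<Longrightarrow> adj y x" and irr: "\<And>x. \<not> adj x x"
  shows "\<exists>col :: 'b \<Rightarrow> nat. (\<forall>x. col x \<le> \<Delta> + \<Delta> * \<Delta>) \<and>
    (\<forall>x\<in>W. \<forall>y\<in>W. adj x y \<longrightarrow> col x \<noteq> col y) \<and>
    (\<forall>x\<in>W. \<forall>y\<in>W. \<forall>y'\<in>W. adj x y \<longrightarrow> adj x y' \<longrightarrow> y \<noteq> y' \<longrightarrow> col y \<noteq> col y')"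
proof -
  define conf where "conf x y \<longleftrightarrow> adj x y \<or> (\<exists>z\<in>W. adj z x \<and> adj z y)" for x y
  have "card {y\<in>W. conf x y} \<le> \<Delta> + \<Delta> * \<Delta>" if x: "x \<in> W" for x
  proof -
    have "{y\<in>W. conf x y} \<subseteq> {y\<in>W. adj x y} \<union> (\<Union>z\<in>{z\<in>W. adj x z}. {y\<in>W. adj z y})"
      unfolding conf_def using sym by auto
    then have "card {y\<in>W. conf x y} \<le> card ({y\<in>W. adj x y} \<union> (\<Union>z\<in>{z\<in>W. adj x z}. {y\<in>W. adj z y}))"
      using finW by (intro card_mono) auto
    also have "\<dots> \<le> card {y\<in>W. adj x y} + (\<Sum>z\<in>{z\<in>W. adj x z}. card {y\<in>W. adj z y})"
      using finW by (intro order.trans[OF card_Un_le] add_left_mono card_UN_le) auto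
    also have "(\<Sum>z\<in>{z\<in>W. adj x z}. card {y\<in>W. adj z y}) \<le> of_nat (card {z\<in>W. adj x z}) * \<Delta>"
      by (rule sum_bounded_above) (auto intro: deg)
    also have "\<dots> \<le> \<Delta> * \<Delta>" using deg[OF x] by auto
    finally show ?thesis using deg[OF x] by simp
  qed
  from greedy_colouring[where conf = conf, OF finW this] obtain col :: "'b \<Rightarrow> nat"
    where col: "\<forall>x. col x \<le> \<Delta> + \<Delta> * \<Delta>" "\<forall>x\<in>W. \<forall>y\<in>W. x \<noteq> y \<longrightarrow> conf x y \<longrightarrow> col x \<noteq> col y"
    unfolding conf_def using sym by blast
  show ?thesis
    using col irr unfolding conf_def by (intro exI[of _ col]) metis
qed

lemma disjoint_blocks:
  assumes "finite V" "m * s \<le> card V"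
  shows "\<exists>Bs :: nat \<Rightarrow> 'a set. (\<forall>i<m. Bs i \<subseteq> V \<and> card (Bs i) = s) \<and> (\<forall>i<m. \<forall>j<m. i \<noteq> j \<longrightarrow> Bs i \<inter> Bs j = {})"
  using assms(2)
proof (induction m)
  case 0
  show ?case by simp
next
  case (Suc m)
  then obtain Bs :: "nat \<Rightarrow> 'a set" where Bs: "\<forall>i<m. Bs i \<subseteq> V \<and> card (Bs i) = s"
    "\<forall>i<m. \<forall>j<m. i \<noteq> j \<longrightarrow> Bs i \<inter> Bs j = {}" by auto
  have "card (\<Union>i<m. Bs i) \<le> (\<Sum>i<m. card (Bs i))" by (intro card_UN_le) auto
  also have "\<dots> = m * s" using Bs by simp
  finally have le: "card (\<Union>i<m. Bs i) \<le> m * s" .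
  have "finite (Bs i)" if "i < m" for i using Bs(1) that assms(1) finite_subset by blast
  then have "finite (\<Union>i<m. Bs i)" by auto
  from diff_card_le_card_Diff[OF this, of V] have "s \<le> card (V - (\<Union>i<m. Bs i))"
    using le Suc.prems by simp
  then obtain T where T: "T \<subseteq> V - (\<Union>i<m. Bs i)" "card T = s"
    by (meson obtain_subset_with_card_n)
  show ?case
    by (rule exI[of _ "Bs(m := T)"]) (use Bs T in \<open>auto simp: less_Suc_eq\<close>)
qed

text \<open>From \<open>ln t = 2 * ln (sqrt t) \<le> 2 * sqrt t\<close>.\<close>

lemma ln_le_scaled:
  fixes t a :: real
  assumes "0 < a" "0 < k" "4 * k\<^sup>2 / a\<^sup>2 \<le> t"
  shows "k * ln t \<le> a * t"
proof -
  have t: "0 < t" using assms by (intro less_le_trans[OF _ assms(3)]) auto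
  have "2 * k / a = sqrt (4 * k\<^sup>2 / a\<^sup>2)" using assms by (simp add: real_sqrt_divide real_sqrt_mult)
  also have "\<dots> \<le> sqrt t" using assms(3) by (rule real_sqrt_le_mono)
  finally have s: "2 * k \<le> a * sqrt t" using assms(1) by (simp add: pos_divide_le_eq mult.commute)
  have "ln t = 2 * ln (sqrt t)" using t by (simp add: ln_sqrt)
  also have "\<dots> \<le> 2 * sqrt t" using ln_bound[of "sqrt t"] t by simp
  finally have "k * ln t \<le> (2 * k) * sqrt t" using assms(2) by (simp add: mult_left_mono)
  also have "\<dots> \<le> a * sqrt t * sqrt t" using s t by (intro mult_right_mono) auto
  finally show ?thesis using t by (simp add: mult.assoc)
qed

text \<open>Put \<open>t = p ^ \<Delta> * N\<close>. Then
  \<open>t ^ (\<Delta> + 1) = (p ^ (\<Delta> + 1) * N) ^ \<Delta> * N\<close>, which is at least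
  \<open>N / \<gamma>\<close> by the last hypothesis. So \<open>ln N\<close> is at most
  \<open>\<Delta> + 1\<close> times \<open>ln t\<close>, and \<open>t\<close> is so large that this
  is at most \<open>a * t\<close>.\<close>

lemma ln_size_bound:
  fixes p N \<gamma> a :: real
  assumes p: "0 < p" and N: "1 \<le> N" and \<gamma>: "0 < \<gamma>" "\<gamma> \<le> 1 / 2" and a: "0 < a" and D: "1 \<le> \<Delta>"
    and small: "\<gamma> \<le> (a\<^sup>2 / (4 * (real \<Delta> + 1)\<^sup>2)) ^ (\<Delta> + 1)" and le: "1 \<le> \<gamma> * p ^ (\<Delta> + 1) * N"
  shows "ln (2 * N) \<le> a * (p ^ \<Delta> * N)" "4 * (real \<Delta> + 1)\<^sup>2 / a\<^sup>2 \<le> p ^ \<Delta> * N"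
proof -
  define t where "t = p ^ \<Delta> * N"
  have t: "0 < t" unfolding t_def using p N by simp
  have "1 / \<gamma> \<le> p ^ (\<Delta> + 1) * N" using le \<gamma> by (simp add: field_simps)
  then have "(1 / \<gamma>) ^ \<Delta> \<le> (p ^ (\<Delta> + 1) * N) ^ \<Delta>" using \<gamma> by (intro power_mono) auto
  then have "(1 / \<gamma>) ^ \<Delta> * N \<le> (p ^ (\<Delta> + 1) * N) ^ \<Delta> * N" using N by (intro mult_right_mono) auto
  also have "\<dots> = t ^ (\<Delta> + 1)"
    unfolding t_def by (simp add: power_mult_distrib power_mult[symmetric] mult_ac)
  finally have 1: "(1 / \<gamma>) ^ \<Delta> * N \<le> t ^ (\<Delta> + 1)" .
  have "(1 / \<gamma>) ^ 1 \<le> (1 / \<gamma>) ^ \<Delta>" using \<gamma> D by (intro power_increasing) auto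
  then have "1 / \<gamma> * N \<le> (1 / \<gamma>) ^ \<Delta> * N" using N by (intro mult_right_mono) auto
  with 1 have 2: "N / \<gamma> \<le> t ^ (\<Delta> + 1)" by simp
  show 3: "4 * (real \<Delta> + 1)\<^sup>2 / a\<^sup>2 \<le> p ^ \<Delta> * N"
  proof -
    define b where "b = a\<^sup>2 / (4 * (real \<Delta> + 1)\<^sup>2)"
    have b: "0 < b" unfolding b_def using a by simp
    have "(1 / b) ^ (\<Delta> + 1) = 1 / b ^ (\<Delta> + 1)" by (simp add: power_one_over)
    also have "\<dots> \<le> 1 / \<gamma>" using small \<gamma> b unfolding b_def[symmetric] by (intro divide_left_mono) auto
    also have "\<dots> \<le> N / \<gamma>" using N \<gamma> by (intro divide_right_mono) auto
    also note 2
    finally have "(1 / b) ^ Suc \<Delta> \<le> t ^ Suc \<Delta>" by simp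
    then have "1 / b \<le> t" by (rule power_le_imp_le_base) (use t in simp)
    then show ?thesis unfolding b_def t_def by simp
  qed
  have "2 * N \<le> N / \<gamma>" using \<gamma> N by (simp add: field_simps)
  with 2 have "ln (2 * N) \<le> ln (t ^ (\<Delta> + 1))" using N by (intro ln_mono) auto
  also have "\<dots> = (real \<Delta> + 1) * ln t" using t by (subst ln_realpow) auto
  also have "\<dots> \<le> a * t" using a 3 unfolding t_def by (intro ln_le_scaled) auto
  finally show "ln (2 * N) \<le> a * (p ^ \<Delta> * N)" unfolding t_def .
qed

section \<open>Embedding into a host that is dense between large sets\<close>

text \<open>The hypothesis \<open>p \<le> \<beta>\<close> enters through
  \<open>ln_size_bound\<close>: combined with the upper bound on \<open>\<beta>\<close> it makes
  candidate sets large compared with the logarithm of the potential.\<close>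

lemma dense_embedding:
  fixes \<Delta> :: nat and \<epsilon> :: real
  assumes \<Delta>: "1 \<le> \<Delta>" and \<epsilon>: "0 < \<epsilon>" "\<epsilon> \<le> 1"
  shows "\<exists>\<mu> \<gamma>. 0 < \<mu> \<and> \<mu> \<le> 1 \<and> 0 < \<gamma> \<and> \<gamma> \<le> 1 \<and>
    (\<forall>(V :: 'a set) E p \<beta> R (W :: 'b set) adj. jumbled_subgraph V E p \<beta> R \<longrightarrow> V \<noteq> {} \<longrightarrow> p \<le> \<beta> \<longrightarrow>
      \<beta> \<le> \<gamma> * p ^ (\<Delta> + 2) * cd V \<longrightarrow> finite W \<longrightarrow> cd W \<le> \<gamma> * cd V \<longrightarrow>
      (\<forall>x y. adj x y \<longrightarrow> adj y x) \<longrightarrow> (\<forall>x. \<not> adj x x) \<longrightarrow> (\<forall>x\<in>W. card {y\<in>W. adj x y} \<le> \<Delta>) \<longrightarrow>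
      (\<forall>A B. A \<subseteq> V \<longrightarrow> B \<subseteq> V \<longrightarrow> A \<inter> B = {} \<longrightarrow> \<mu> * cd V \<le> cd A \<longrightarrow> \<mu> * cd V \<le> cd B \<longrightarrow>
         \<epsilon> * p * cd A * cd B \<le> esum R A B) \<longrightarrow>
      (\<exists>f. inj_on f W \<and> f ` W \<subseteq> V \<and> (\<forall>x\<in>W. \<forall>y\<in>W. adj x y \<longrightarrow> R (f x) (f y))))"
proof -
  \<comment> \<open>The number of colours provided by \<open>square_colouring\<close>, hence the
    number of host sets.\<close>
  define m where "m = Suc (\<Delta> + \<Delta> * \<Delta>)"
  \<comment> \<open>\<open>4 * e\<close> is the lower bound \<open>\<epsilon> / 2\<close> on the
    densities of the regular pairs.\<close>
  define e where "e = \<epsilon> / 8"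
  define \<theta> where "\<theta> = 1 / (8 * (real \<Delta>)\<^sup>2)"
  \<comment> \<open>\<open>K\<close> and \<open>\<kappa>\<close> satisfy the two growth conditions
    of the locale \<open>embedding\<close> with equality.\<close>
  define K where "K = 2 / (\<theta> * e\<^sup>2)"
  define \<kappa> where "\<kappa> = e ^ 4 * \<theta>\<^sup>2 / K ^ (2 * \<Delta>)"
  \<comment> \<open>\<open>\<kappa>'\<close> and \<open>\<delta>\<close> are such that
    \<open>cut_regular_imp_C4\<close> returns at most \<open>\<kappa>\<close>. The square is due to
    the square root there: \<open>16 * \<kappa>'\<close> and \<open>76 * \<delta>\<close> are each
    at most \<open>\<kappa>^2 / 32\<close>.\<close>
  define \<kappa>' where "\<kappa>' = \<kappa>\<^sup>2 / 512"
  define \<delta> where "\<delta> = \<kappa>\<^sup>2 * \<theta> * e / 5000"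
  have D1: "1 \<le> real \<Delta>" using \<Delta> by simp
  have e: "0 < e" "e \<le> 1" unfolding e_def using \<epsilon> by auto
  have \<theta>: "0 < \<theta>" "\<theta> \<le> 1" "8 * (real \<Delta>)\<^sup>2 * \<theta> \<le> 1"
  proof -
    have "1 \<le> (real \<Delta>)\<^sup>2" using power_mono[OF D1, of 2] by simp
    then have D2: "1 \<le> 8 * (real \<Delta>)\<^sup>2" by linarith
    then show "0 < \<theta>" "\<theta> \<le> 1" "8 * (real \<Delta>)\<^sup>2 * \<theta> \<le> 1"
      unfolding \<theta>_def using \<Delta> by (auto simp: divide_le_eq)
  qed
  have K1: "1 \<le> K"
  proof -
    have "\<theta> * e\<^sup>2 \<le> 1 * 1" using \<theta> e by (intro mult_mono power_le_one) auto
    then show ?thesis unfolding K_def using \<theta> e by (simp add: le_divide_eq)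
  qed
  have K2: "2 / \<theta> \<le> K * e\<^sup>2" unfolding K_def using \<theta> e by simp
  have \<kappa>0: "0 < \<kappa>" unfolding \<kappa>_def using e \<theta> K1 by simp
  have \<kappa>K: "\<kappa> * K ^ (2 * \<Delta>) \<le> e ^ 4 * \<theta>\<^sup>2" unfolding \<kappa>_def using K1 by simp
  have \<kappa>1: "\<kappa> \<le> 1"
  proof -
    have "e ^ 4 * \<theta>\<^sup>2 \<le> 1 * 1" using e \<theta> by (intro mult_mono power_le_one) auto
    moreover have "1 \<le> K ^ (2 * \<Delta>)" using K1 by simp
    ultimately show ?thesis unfolding \<kappa>_def by (simp add: divide_le_eq)
  qed
  have \<kappa>': "0 < \<kappa>'" "\<kappa>' \<le> 1"
    unfolding \<kappa>'_def using \<kappa>0 \<kappa>1 power_le_one[of \<kappa> 2] by auto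
  have te: "\<theta> * e \<le> 1" using \<theta> e by (intro mult_le_one) auto
  have \<kappa>2: "\<kappa>\<^sup>2 \<le> \<kappa>" using \<kappa>0 \<kappa>1 by (simp add: power2_eq_square mult_left_le)
  have \<delta>0: "0 < \<delta>" unfolding \<delta>_def using \<kappa>0 \<theta> e by simp
  have \<delta>\<kappa>: "\<delta> \<le> \<kappa>\<^sup>2 / 5000"
    unfolding \<delta>_def using te \<kappa>0 mult_left_mono[OF te, of "\<kappa>\<^sup>2"] by (simp add: mult.assoc)
  have \<delta>\<theta>: "\<delta> \<le> \<theta> / 4"
  proof -
    have "\<kappa>\<^sup>2 * \<theta> * e \<le> 1 * \<theta> * 1" using \<kappa>0 \<kappa>1 \<kappa>2 \<theta> e by (intro mult_mono) auto
    then show ?thesis unfolding \<delta>_def using \<theta>(1) by linarith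
  qed
  have \<delta>e: "\<delta> \<le> e"
  proof -
    have "\<kappa>\<^sup>2 * \<theta> * e \<le> 1 * 1 * e" using \<kappa>0 \<kappa>1 \<kappa>2 \<theta> e by (intro mult_mono) auto
    then show ?thesis unfolding \<delta>_def using e(1) by linarith
  qed
  have \<delta>s: "\<delta> \<le> 1 / 24" "32 * \<delta> \<le> \<kappa>" using \<delta>\<kappa> \<kappa>1 \<kappa>2 \<kappa>0 by linarith+
  have C4c: "2 * sqrt (16 * \<kappa>' + 76 * \<delta>) + 112 * \<delta> \<le> \<kappa>"
  proof -
    have "16 * \<kappa>' + 76 * \<delta> \<le> (\<kappa> / 4)\<^sup>2"
    proof -
      have "(\<kappa> / 4)\<^sup>2 = \<kappa>\<^sup>2 / 16" by (simp add: power_divide)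
      then show ?thesis unfolding \<kappa>'_def using \<delta>\<kappa> \<delta>0 by linarith
    qed
    then have "sqrt (16 * \<kappa>' + 76 * \<delta>) \<le> \<kappa> / 4" using \<kappa>0 by (intro real_le_lsqrt) auto
    then show ?thesis using \<delta>\<kappa> \<kappa>2 \<kappa>0 by linarith
  qed
  \<comment> \<open>Each pair is regularised in one order only; \<open>dd\<close> below is
    symmetrised by \<open>min\<close> and \<open>max\<close>.\<close>
  define prs where "prs = filter (\<lambda>(i, j). i < j) (List.product [0..<m] [0..<m])"
  have set_prs: "set prs = {(i, j). i < j \<and> i < m \<and> j < m}" unfolding prs_def by auto
  have "\<forall>(i, j)\<in>set prs. i \<noteq> j" unfolding set_prs by auto
  from regular_family[where 'a = 'a, OF \<epsilon> \<kappa>' this] obtain c where c: "0 < c" "c \<le> 1" and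
    reg: "\<And>(V :: 'a set) E p \<beta> R Vs L. jumbled_subgraph V E p \<beta> R \<Longrightarrow> (\<forall>i. Vs i \<subseteq> V) \<Longrightarrow>
    0 < L \<Longrightarrow> (\<forall>i. L \<le> cd (Vs i)) \<Longrightarrow> \<beta> \<le> c * p * L \<Longrightarrow>
    (\<forall>(i, j)\<in>set prs. \<forall>A B. A \<subseteq> Vs i \<longrightarrow> B \<subseteq> Vs j \<longrightarrow> c * cd (Vs i) \<le> cd A \<longrightarrow> c * cd (Vs j) \<le> cd B
       \<longrightarrow> \<epsilon> * p * cd A * cd B \<le> esum R A B) \<Longrightarrow>
    (\<exists>Vs'. (\<forall>i. Vs' i \<subseteq> Vs i \<and> c * cd (Vs i) \<le> cd (Vs' i)) \<and>
       (\<forall>(i, j)\<in>set prs. \<exists>d. \<epsilon> / 2 \<le> d \<and> d \<le> 1 \<and> jumbled_subgraph.cut_regular E p R \<kappa>' d (Vs' i) (Vs' j)))"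
    by blast
  \<comment> \<open>A block has at least \<open>cd V / (2 * m)\<close> vertices, and regularisation
    may shrink it by the factor \<open>c\<close>.\<close>
  define \<eta> where "\<eta> = c / (2 * real m)"
  have m: "0 < m" "1 \<le> real m" unfolding m_def by auto
  have \<eta>: "0 < \<eta>" "\<eta> \<le> 1" unfolding \<eta>_def using c m by (auto simp: divide_le_eq)
  \<comment> \<open>The logarithm of the potential has two parts, \<open>ln (2 * N)\<close> and
    \<open>cd W * (4 * p) ^ \<Delta>\<close>. Each will be at most
    \<open>a * (p ^ \<Delta> * N)\<close>, and together they must stay below
    \<open>(e * p) ^ \<Delta> * \<eta> * N / 100\<close>.\<close>
  define a where "a = e ^ \<Delta> * \<eta> / 200"
  define b where "b = (a\<^sup>2 / (4 * (real \<Delta> + 1)\<^sup>2)) ^ (\<Delta> + 1)"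
  have a: "0 < a" unfolding a_def using e \<eta> by simp
  have b: "0 < b" unfolding b_def using a by simp
  define \<gamma> where "\<gamma> = Min {\<delta> * e ^ \<Delta> * \<eta>, a / 4 ^ \<Delta>, b, 1 / 2}"
  have \<gamma>: "0 < \<gamma>" "\<gamma> \<le> \<delta> * e ^ \<Delta> * \<eta>" "\<gamma> \<le> a / 4 ^ \<Delta>" "\<gamma> \<le> b" "\<gamma> \<le> 1 / 2"
  proof -
    show "0 < \<gamma>" unfolding \<gamma>_def using \<delta>0 e \<eta> a b by (simp add: Min_gr_iff)
  qed (unfold \<gamma>_def, (rule Min_le; simp)+)
  have \<eta>\<delta>: "\<gamma> \<le> \<delta> * \<eta>"
  proof -
    have "\<delta> * e ^ \<Delta> * \<eta> \<le> \<delta> * 1 * \<eta>" using \<delta>0 e \<eta> by (intro mult_right_mono mult_left_mono power_le_one) auto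
    then show ?thesis using \<gamma>(2) by simp
  qed
  have \<gamma>\<eta>: "\<gamma> \<le> \<eta>"
  proof -
    have "\<delta> * \<eta> \<le> 1 * \<eta>" using \<delta>s \<eta> by (intro mult_right_mono) auto
    then show ?thesis using \<eta>\<delta> by linarith
  qed
  show ?thesis
  proof (rule exI[of _ \<eta>], rule exI[of _ \<gamma>], intro conjI allI impI)
    fix V :: "'a set" and E p \<beta> R and W :: "'b set" and adj
    assume J: "jumbled_subgraph V E p \<beta> R" and ne: "V \<noteq> {}" and p\<beta>: "p \<le> \<beta>" and \<beta>: "\<beta> \<le> \<gamma> * p ^ (\<Delta> + 2) * cd V"
      and finW: "finite W" and cW: "cd W \<le> \<gamma> * cd V"
      and sym: "\<forall>x y. adj x y \<longrightarrow> adj y x" and irr: "\<forall>x. \<not> adj x x" and deg: "\<forall>x\<in>W. card {y\<in>W. adj x y} \<le> \<Delta>"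
      and dens: "\<forall>A B. A \<subseteq> V \<longrightarrow> B \<subseteq> V \<longrightarrow> A \<inter> B = {} \<longrightarrow> \<eta> * cd V \<le> cd A \<longrightarrow> \<eta> * cd V \<le> cd B \<longrightarrow>
         \<epsilon> * p * cd A * cd B \<le> esum R A B"
    interpret jumbled_subgraph V E p \<beta> R by (rule J)
    define N where "N = cd V"
    have N: "1 \<le> N" unfolding N_def using ne finV by (simp add: Suc_leI card_gt_0_iff)
    have le1: "1 \<le> \<gamma> * p ^ (\<Delta> + 1) * N"
    proof -
      have "p * 1 \<le> p * (\<gamma> * p ^ (\<Delta> + 1) * N)" using p\<beta> \<beta> unfolding N_def by (simp add: mult_ac)
      then show ?thesis using p_pos by simp
    qed
    have lnN: "ln (2 * N) \<le> a * (p ^ \<Delta> * N)" and big: "4 * (real \<Delta> + 1)\<^sup>2 / a\<^sup>2 \<le> p ^ \<Delta> * N"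
      using ln_size_bound[OF p_pos N \<gamma>(1,5) a \<Delta> \<gamma>(4)[unfolded b_def] le1] by auto
    \<comment> \<open>The blocks must be nonempty. The lower bound \<open>big\<close> on
      \<open>p ^ \<Delta> * N\<close> is at least \<open>1 / a^2\<close>, which is at least
      \<open>m\<close> because \<open>a\<close> is at most 1 and at most
      \<open>1 / m\<close>.\<close>
    have Nm: "real m \<le> N"
    proof -
      have "a \<le> 1 / real m"
      proof -
        have "a \<le> 1 * \<eta>" unfolding a_def using e \<eta> mult_right_mono[of "e ^ \<Delta>" 1 \<eta>] power_le_one[of e \<Delta>] by auto
        also have "\<dots> \<le> 1 / real m" unfolding \<eta>_def using c m by (simp add: field_simps)
        finally show ?thesis .
      qed
      moreover have "1 / real m \<le> 1" using m by simp
      ultimately have "a * a \<le> 1 * (1 / real m)" using a by (intro mult_mono) linarith+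
      then have "real m \<le> 1 / a\<^sup>2" using a m by (simp add: field_simps power2_eq_square)
      also have "\<dots> \<le> 4 * (real \<Delta> + 1)\<^sup>2 / a\<^sup>2"
      proof (rule divide_right_mono)
        have "1 \<le> (real \<Delta> + 1)\<^sup>2" by simp
        then show "1 \<le> 4 * (real \<Delta> + 1)\<^sup>2" by linarith
      qed simp
      also note big
      also have "p ^ \<Delta> * N \<le> 1 * N" using p_pos p_le N by (intro mult_right_mono power_le_one) auto
      finally show ?thesis by simp
    qed
    define s where "s = card V div m"
    have "m \<le> card V" using Nm unfolding N_def by simp
    then have s1: "1 \<le> s" unfolding s_def using m by (simp add: Suc_le_eq div_greater_zero_iff)
    have "card V < m * Suc s" unfolding s_def using m by (metis dividend_less_times_div mult_Suc_right)
    also have "\<dots> \<le> m * (2 * s)" using s1 by (intro mult_left_mono) auto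
    finally have "N \<le> real (m * (2 * s))" unfolding N_def by linarith
    then have sN: "\<eta> * N \<le> c * real s"
      unfolding \<eta>_def using c m mult_left_mono[of N "real m * (2 * real s)" c] by (simp add: field_simps)
    have "m * s \<le> card V" unfolding s_def by simp
    from disjoint_blocks[OF finV this] obtain Bs :: "nat \<Rightarrow> 'a set"
      where Bs: "\<forall>i<m. Bs i \<subseteq> V \<and> card (Bs i) = s" "\<forall>i<m. \<forall>j<m. i \<noteq> j \<longrightarrow> Bs i \<inter> Bs j = {}" by blast
    \<comment> \<open>\<open>regular_family\<close> takes sets for all indices; beyond
      \<open>m\<close> a block is repeated, and no pair of \<open>prs\<close> refers to it.\<close>
    define Vs where "Vs i = (if i < m then Bs i else Bs 0)" for i
    have VsV: "\<forall>i. Vs i \<subseteq> V" and cVs: "\<And>i. card (Vs i) = s" unfolding Vs_def using Bs m by auto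
    have pp: "p ^ (\<Delta> + 2) \<le> p" "p ^ (\<Delta> + 2) \<le> p ^ 3"
      using p_pos p_le \<Delta> power_decreasing[of 1 "\<Delta> + 2" p] power_decreasing[of 3 "\<Delta> + 2" p] by auto
    have N0: "0 \<le> N" using N by simp
    have "\<exists>Vs'. (\<forall>i. Vs' i \<subseteq> Vs i \<and> c * cd (Vs i) \<le> cd (Vs' i)) \<and>
       (\<forall>(i, j)\<in>set prs. \<exists>d. \<epsilon> / 2 \<le> d \<and> d \<le> 1 \<and> cut_regular \<kappa>' d (Vs' i) (Vs' j))"
    proof (rule reg[OF J VsV, where L = "real s"])
      have "\<beta> \<le> \<eta> * p * N"
        using \<beta> \<gamma>\<eta> pp(1) \<eta> p_pos N0 unfolding N_def[symmetric]
        by (intro order.trans[OF \<beta>[folded N_def]] mult_mono) auto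
      also have "\<dots> = p * (\<eta> * N)" by simp
      also have "\<dots> \<le> p * (c * real s)" using sN p_pos by (intro mult_left_mono) auto
      finally show "\<beta> \<le> c * p * real s" by (simp add: mult_ac)
      show "\<forall>(i, j)\<in>set prs. \<forall>A B. A \<subseteq> Vs i \<longrightarrow> B \<subseteq> Vs j \<longrightarrow> c * cd (Vs i) \<le> cd A \<longrightarrow> c * cd (Vs j) \<le> cd B
         \<longrightarrow> \<epsilon> * p * cd A * cd B \<le> esum R A B"
      proof clarify
        fix i j A B
        assume ij: "(i, j) \<in> set prs" and A: "A \<subseteq> Vs i" "c * cd (Vs i) \<le> cd A" and B: "B \<subseteq> Vs j" "c * cd (Vs j) \<le> cd B"
        have "Vs i \<inter> Vs j = {}" using ij Bs(2) unfolding set_prs Vs_def by auto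
        then have "A \<inter> B = {}" using A B by auto
        moreover have "A \<subseteq> V" "B \<subseteq> V" using A B VsV by blast+
        moreover have "\<eta> * cd V \<le> cd A" "\<eta> * cd V \<le> cd B" using A B sN unfolding cVs N_def by auto
        ultimately show "\<epsilon> * p * cd A * cd B \<le> esum R A B" using dens by blast
      qed
    qed (use s1 cVs in auto)
    then obtain Ws where Ws0: "\<forall>i. Ws i \<subseteq> Vs i \<and> c * cd (Vs i) \<le> cd (Ws i)"
      and regs0: "\<forall>(i, j)\<in>set prs. \<exists>d. \<epsilon> / 2 \<le> d \<and> d \<le> 1 \<and> cut_regular \<kappa>' d (Ws i) (Ws j)"
      by blast
    have Ws: "Ws i \<subseteq> Vs i" "c * real s \<le> cd (Ws i)" for i using Ws0 cVs by auto
    have regs: "\<exists>d. \<epsilon> / 2 \<le> d \<and> d \<le> 1 \<and> cut_regular \<kappa>' d (Ws i) (Ws j)" if "i < j" "j < m" for i j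
    proof -
      have "(i, j) \<in> set prs" unfolding set_prs using that by simp
      with regs0 show ?thesis by blast
    qed
    define d0 where "d0 i j = (SOME d. \<epsilon> / 2 \<le> d \<and> d \<le> 1 \<and> cut_regular \<kappa>' d (Ws i) (Ws j))" for i j
    have d0: "\<epsilon> / 2 \<le> d0 i j" "d0 i j \<le> 1" "cut_regular \<kappa>' (d0 i j) (Ws i) (Ws j)" if "i < j" "j < m" for i j
      using someI_ex[OF regs[OF that]] unfolding d0_def by auto
    define dd where "dd i j = d0 (min i j) (max i j)" for i j
    have WsV: "Ws i \<subseteq> V" for i using Ws(1)[of i] VsV by blast
    have M: "0 < c * real s" using c s1 by simp
    have Wne: "Ws i \<noteq> {}" for i using Ws(2)[of i] M by auto
    have C4i: "C4 (excess (dd i j)) (Ws i) (Ws j) \<le> \<kappa> * p ^ 4 * (cd (Ws i))\<^sup>2 * (cd (Ws j))\<^sup>2" if ij: "i < j" "j < m" for i j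
    proof -
      have dij: "dd i j = d0 i j" unfolding dd_def using ij by simp
      have "C4 (excess (d0 i j)) (Ws i) (Ws j) \<le> (2 * sqrt (16 * \<kappa>' + 76 * \<delta>) + 112 * \<delta>) * p ^ 4 * (cd (Ws i))\<^sup>2 * (cd (Ws j))\<^sup>2"
      proof (rule cut_regular_imp_C4)
        have "\<beta> \<le> \<delta> * \<eta> * p ^ 3 * N"
          using \<eta>\<delta> pp(2) \<delta>0 \<eta> p_pos N0
          by (intro order.trans[OF \<beta>[folded N_def]] mult_mono) auto
        also have "\<dots> = \<delta> * p ^ 3 * (\<eta> * N)" by simp
        also have "\<dots> \<le> \<delta> * p ^ 3 * sqrt (cd (Ws i) * cd (Ws j))"
        proof (rule mult_left_mono)
          have "\<eta> * N \<le> sqrt ((c * real s) * (c * real s))" using sN M by simp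
          also have "\<dots> \<le> sqrt (cd (Ws i) * cd (Ws j))"
            using Ws(2)[of i] Ws(2)[of j] M by (intro real_sqrt_le_mono mult_mono) auto
          finally show "\<eta> * N \<le> sqrt (cd (Ws i) * cd (Ws j))" .
        qed (use \<delta>0 p_pos in auto)
        finally show "\<beta> \<le> \<delta> * p ^ 3 * sqrt (cd (Ws i) * cd (Ws j))" .
      qed (use WsV Wne d0[OF ij] \<epsilon> \<delta>0 \<delta>s \<kappa>' in auto)
      also have "\<dots> \<le> \<kappa> * p ^ 4 * (cd (Ws i))\<^sup>2 * (cd (Ws j))\<^sup>2"
        using C4c p_pos by (intro mult_right_mono) auto
      finally show ?thesis unfolding dij .
    qed
    have "\<exists>col :: 'b \<Rightarrow> nat. (\<forall>x. col x \<le> \<Delta> + \<Delta> * \<Delta>) \<and>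
      (\<forall>x\<in>W. \<forall>y\<in>W. adj x y \<longrightarrow> col x \<noteq> col y) \<and>
      (\<forall>x\<in>W. \<forall>y\<in>W. \<forall>y'\<in>W. adj x y \<longrightarrow> adj x y' \<longrightarrow> y \<noteq> y' \<longrightarrow> col y \<noteq> col y')"
    proof (rule square_colouring[OF finW])
      show "card {y\<in>W. adj x y} \<le> \<Delta>" if "x \<in> W" for x using deg that by (rule bspec)
      show "adj y x" if "adj x y" for x y using sym that by simp
      show "\<not> adj x x" for x using irr by simp
    qed
    then obtain col :: "'b \<Rightarrow> nat" where col: "\<forall>x. col x \<le> \<Delta> + \<Delta> * \<Delta>" "\<forall>x\<in>W. \<forall>y\<in>W. adj x y \<longrightarrow> col x \<noteq> col y"
      "\<forall>x\<in>W. \<forall>y\<in>W. \<forall>y'\<in>W. adj x y \<longrightarrow> adj x y' \<longrightarrow> y \<noteq> y' \<longrightarrow> col y \<noteq> col y'"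
      by (elim exE conjE)
    have colm: "col x < m" for x using col(1) unfolding m_def by (simp add: less_Suc_eq_le)
    interpret embedding V E p \<beta> R W adj col Ws dd \<Delta> e "c * real s" \<kappa> K \<delta> \<theta>
    proof unfold_locales
      show "adj y x" if "adj x y" for x y using sym that by blast
      show "col x \<noteq> col y" if "x \<in> W" "y \<in> W" "adj x y" for x y using col(2) that by blast
      show "col y \<noteq> col y'" if "x \<in> W" "y \<in> W" "y' \<in> W" "adj x y" "adj x y'" "y \<noteq> y'" for x y y'
        using col(3) that by blast
      show "Ws (col x) \<inter> Ws (col y) = {}" if "col x \<noteq> col y" for x y
      proof -
        have "Bs (col x) \<inter> Bs (col y) = {}" using Bs(2) colm that by simp
        moreover have "Ws (col x) \<subseteq> Bs (col x)" "Ws (col y) \<subseteq> Bs (col y)"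
          using Ws(1)[of "col x"] Ws(1)[of "col y"] colm unfolding Vs_def by auto
        ultimately show ?thesis by blast
      qed
      show "dd i j = dd j i" for i j unfolding dd_def by (simp add: min.commute max.commute)
      fix x y assume xy: "x \<in> W" "y \<in> W" "adj x y"
      have ne: "col x \<noteq> col y" using xy col(2) by blast
      have lt: "min (col x) (col y) < max (col x) (col y)" "max (col x) (col y) < m"
        using ne colm by (auto simp: min_def max_def)
      show "4 * e \<le> dd (col x) (col y)" "dd (col x) (col y) \<le> 1"
        using d0[OF lt] unfolding dd_def e_def by auto
      show "C4 (excess (dd (col x) (col y))) (Ws (col x)) (Ws (col y))
        \<le> \<kappa> * p ^ 4 * (cd (Ws (col x)))\<^sup>2 * (cd (Ws (col y)))\<^sup>2"
      proof (cases "col x < col y")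
        case True
        then show ?thesis by (rule C4i) (rule colm)
      next
        case False
        then have "col y < col x" using ne by simp
        from C4i[OF this colm] show ?thesis
          using C4_commute[OF excess_sym, where Y = "Ws (col y)" and Z = "Ws (col x)"]
          unfolding dd_def by (simp add: min.commute max.commute mult_ac)
      qed
    next
      have "\<beta> \<le> \<delta> * e ^ \<Delta> * \<eta> * p ^ (\<Delta> + 2) * N"
        using \<gamma>(2) p_pos N0 by (intro order.trans[OF \<beta>[folded N_def]] mult_right_mono) auto
      also have "\<dots> = \<delta> * e ^ \<Delta> * p ^ (\<Delta> + 2) * (\<eta> * N)" by simp
      also have "\<dots> \<le> \<delta> * e ^ \<Delta> * p ^ (\<Delta> + 2) * (c * real s)"
        using sN \<delta>0 e p_pos by (intro mult_left_mono) auto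
      finally show "\<beta> \<le> \<delta> * e ^ \<Delta> * p ^ (\<Delta> + 2) * (c * real s)" .
    qed (use finW deg WsV M Ws(2) e \<delta>0 \<delta>s \<delta>\<theta> \<delta>e \<theta> K1 K2 \<kappa>0 \<kappa>K in auto)
    \<comment> \<open>The factor 2 covers the summand \<open>cd W\<close>, which is at most
      \<open>N\<close> and hence at most the exponential term.\<close>
    define B where "B = 2 * N * exp (cd W * (4 * p) ^ \<Delta>)"
    have "cd V * exp (cd W * (4 * p) ^ \<Delta>) + cd W \<le> B"
    proof -
      have "cd W \<le> 1 * N" using cW \<gamma>(5) N0 unfolding N_def[symmetric] by (intro order.trans[OF cW[folded N_def]] mult_right_mono) auto
      also have "\<dots> \<le> N * exp (cd W * (4 * p) ^ \<Delta>)"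
        using N0 p_pos by (simp add: mult_le_cancel_left1)
      finally show ?thesis unfolding B_def N_def by simp
    qed
    moreover have "ln B \<le> (e * p) ^ \<Delta> * (c * real s) / 100"
    proof -
      have "ln B = ln (2 * N) + cd W * (4 * p) ^ \<Delta>" unfolding B_def using N by (subst ln_mult) auto
      also have "cd W * (4 * p) ^ \<Delta> \<le> (a / 4 ^ \<Delta> * N) * (4 * p) ^ \<Delta>"
        using cW[folded N_def] \<gamma>(3) N0 p_pos mult_right_mono[OF \<gamma>(3) N0] by (intro mult_right_mono) auto
      also have "\<dots> = a * (p ^ \<Delta> * N)" by (simp add: power_mult_distrib)
      also have "ln (2 * N) + a * (p ^ \<Delta> * N) \<le> 2 * (a * (p ^ \<Delta> * N))" using lnN by linarith
      also have "\<dots> = (e * p) ^ \<Delta> * (\<eta> * N) / 100" unfolding a_def by (simp add: power_mult_distrib)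
      also have "\<dots> \<le> (e * p) ^ \<Delta> * (c * real s) / 100"
        using sN e p_pos by (intro divide_right_mono mult_left_mono) auto
      finally show ?thesis by simp
    qed
    ultimately obtain f where f: "inj_on f W" "\<forall>x\<in>W. f x \<in> Ws (col x)" "\<forall>x\<in>W. \<forall>y\<in>W. adj x y \<longrightarrow> R (f x) (f y)"
      using embed_all by blast
    then show "\<exists>f. inj_on f W \<and> f ` W \<subseteq> V \<and> (\<forall>x\<in>W. \<forall>y\<in>W. adj x y \<longrightarrow> R (f x) (f y))"
      using WsV by (intro exI[of _ f]) blast
  qed (use \<eta> \<gamma> in auto)
qed

section \<open>The Ramsey argument\<close>

text \<open>Removing an element of maximal value does not increase the average.\<close>

lemma light_subset:
  fixes f :: "'a \<Rightarrow> real"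
  assumes "finite A" "s \<le> card A"
  shows "\<exists>A'\<subseteq>A. card A' = s \<and> cd A * sum f A' \<le> real s * sum f A"
  using assms
proof (induction "card A - s" arbitrary: A)
  case 0
  then have "card A = s" by simp
  then show ?case by (intro exI[of _ A]) auto
next
  case (Suc k A)
  have ne: "A \<noteq> {}" using Suc(2) by auto
  have "Max (f ` A) \<in> f ` A" using Suc.prems(1) ne by (intro Max_in) auto
  then obtain x where xA: "x \<in> A" "Max (f ` A) = f x" by auto
  have x: "x \<in> A" "\<And>y. y \<in> A \<Longrightarrow> f y \<le> f x"
    using xA(1) Suc.prems(1) unfolding xA(2)[symmetric] by auto
  let ?A = "A - {x}"
  have cA: "card A = Suc (card ?A)" using x(1) Suc.prems(1) by (metis card.remove)
  have "k = card ?A - s" "s \<le> card ?A" using Suc(2) Suc.prems(2) cA by auto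
  from Suc(1)[OF this(1) _ this(2)] Suc.prems(1) obtain A' where A': "A' \<subseteq> ?A" "card A' = s" "cd ?A * sum f A' \<le> real s * sum f ?A"
    by auto
  have sA: "sum f A = f x + sum f ?A" using x(1) Suc.prems(1) by (simp add: sum.remove)
  have "sum f ?A \<le> cd ?A * f x" using x(2) by (intro sum_bounded_above) auto
  then have avg: "cd A * sum f ?A \<le> cd ?A * sum f A" unfolding sA cA by (simp add: algebra_simps)
  have "cd A * sum f A' \<le> real s * sum f A"
  proof (cases "cd ?A = 0")
    case True
    then have "?A = {}" using Suc.prems(1) by (metis card_0_eq finite_Diff of_nat_eq_0_iff)
    then have "A' = {}" using A'(1) by blast
    then show ?thesis using A'(2) by simp
  next
    case False
    then have pos: "0 < cd ?A" by auto
    have "cd ?A * (cd A * sum f A') = cd A * (cd ?A * sum f A')" by simp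
    also have "\<dots> \<le> cd A * (real s * sum f ?A)" using A'(3) by (intro mult_left_mono) auto
    also have "\<dots> = real s * (cd A * sum f ?A)" by simp
    also have "\<dots> \<le> real s * (cd ?A * sum f A)" using avg by (intro mult_left_mono) auto
    finally have "cd ?A * (cd A * sum f A') \<le> cd ?A * (real s * sum f A)" by (simp add: mult_ac)
    then show ?thesis using pos by simp
  qed
  then show ?case using A' by (intro exI[of _ A']) auto
qed

lemma esum_swap: "(\<And>x y. R x y \<Longrightarrow> R y x) \<Longrightarrow> esum R A B = esum R B A"
  by (subst sum.swap, intro sum.cong refl) (metis of_bool_eq_iff)

text \<open>The larger set is trimmed to its lightest vertices, so the density bound survives. Equal
  sizes allow the same trick to be iterated with a common size in
  \<open>sparse_sets\<close>.\<close>

lemma equal_sizes: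
  assumes fin: "finite A" "finite B" and R: "\<And>x y. R x y \<Longrightarrow> R y x" and le: "esum R A B \<le> c * cd A * cd B"
    and ne: "A \<noteq> {}" "B \<noteq> {}"
  shows "\<exists>A' B'. A' \<subseteq> A \<and> B' \<subseteq> B \<and> card A' = min (card A) (card B) \<and> card B' = min (card A) (card B) \<and>
    esum R A' B' \<le> c * cd A' * cd B'"
proof -
  let ?s = "min (card A) (card B)"
  have pos: "0 < cd A" "0 < cd B" using fin ne by (auto simp: card_gt_0_iff)
  obtain A' where A': "A' \<subseteq> A" "card A' = ?s" "cd A * esum R A' B \<le> real ?s * esum R A B"
    using light_subset[OF fin(1), of ?s "\<lambda>x. \<Sum>y\<in>B. of_bool (R x y)"] by auto
  have "cd A * esum R A' B \<le> real ?s * (c * cd A * cd B)"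
    using A'(3) mult_left_mono[OF le, of "real ?s"] by linarith
  then have "cd A * esum R A' B \<le> cd A * (c * real ?s * cd B)" by (simp add: mult_ac)
  then have 1: "esum R A' B \<le> c * real ?s * cd B" using pos by (simp only: mult_le_cancel_left_pos)
  obtain B' where B': "B' \<subseteq> B" "card B' = ?s" "cd B * esum R B' A' \<le> real ?s * esum R B A'"
    using light_subset[OF fin(2), of ?s "\<lambda>y. \<Sum>x\<in>A'. of_bool (R y x)"] by auto
  have "cd B * esum R A' B' \<le> real ?s * esum R A' B"
    using B'(3) esum_swap[OF R, where A = A' and B = B] esum_swap[OF R, where A = A' and B = B'] by simp
  also have "\<dots> \<le> real ?s * (c * real ?s * cd B)" using 1 by (intro mult_left_mono) auto
  finally have "cd B * esum R A' B' \<le> cd B * (c * real ?s * real ?s)" by (simp add: mult_ac)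
  then have "esum R A' B' \<le> c * real ?s * real ?s" using pos by (simp only: mult_le_cancel_left_pos)
  then show ?thesis
    using A'(1,2) B'(1,2) by - (rule exI[of _ A'], rule exI[of _ B'], simp)
qed

lemma jumbled_subgraph_subset:
  assumes "jumbled_subgraph V E p \<beta> R" "U \<subseteq> V"
  shows "jumbled_subgraph U E p \<beta> R"
proof -
  interpret jumbled_subgraph V E p \<beta> R by (rule assms(1))
  show ?thesis
  proof unfold_locales
    show "finite U" using assms(2) by (rule fin)
    fix X Y assume "X \<subseteq> U" "Y \<subseteq> U"
    then have "X \<subseteq> V" "Y \<subseteq> V" using assms(2) by auto
    then show "\<bar>\<Sum>x\<in>X. \<Sum>y\<in>Y. of_bool (E x y) - p\<bar> \<le> \<beta> * sqrt (cd X * cd Y)" by (rule jumbled_sum)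
  qed (fact symE p_pos p_le beta_nonneg R_E R_sym)+
qed

text \<open>Embeddings into all of \<open>V\<close> are excluded, so that the condition passes to subsets \<open>U\<close>.\<close>

definition avoids where
  "avoids \<Delta> \<gamma> V E p \<beta> R (W :: 'b set) adj U \<longleftrightarrow>
     jumbled_subgraph V E p \<beta> R \<and> U \<subseteq> V \<and> U \<noteq> {} \<and> p \<le> \<beta> \<and> \<beta> \<le> \<gamma> * p ^ (\<Delta> + 2) * cd U \<and>
     finite W \<and> cd W \<le> \<gamma> * cd U \<and> (\<forall>x y. adj x y \<longrightarrow> adj y x) \<and> (\<forall>x. \<not> adj x x) \<and>
     (\<forall>x\<in>W. card {y\<in>W. adj x y} \<le> \<Delta>) \<and>
     \<not> (\<exists>f. inj_on f W \<and> f ` W \<subseteq> V \<and> (\<forall>x\<in>W. \<forall>y\<in>W. adj x y \<longrightarrow> R (f x) (f y)))"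

lemma avoids_subset:
  assumes a: "avoids \<Delta> \<gamma> V E p \<beta> R W adj U" and U': "U' \<subseteq> U" "U' \<noteq> {}" and c: "c * cd U \<le> cd U'" and \<gamma>: "0 \<le> \<gamma>'" "\<gamma> \<le> \<gamma>' * c"
  shows "avoids \<Delta> \<gamma>' V E p \<beta> R W adj U'"
proof -
  interpret jumbled_subgraph V E p \<beta> R using a unfolding avoids_def by auto
  have le: "\<gamma> * cd U \<le> \<gamma>' * cd U'"
  proof -
    have "\<gamma> * cd U \<le> \<gamma>' * c * cd U" using \<gamma> by (intro mult_right_mono) auto
    also have "\<dots> \<le> \<gamma>' * cd U'" using c \<gamma> by (simp add: mult.assoc mult_left_mono)
    finally show ?thesis .
  qed
  have "\<gamma> * p ^ (\<Delta> + 2) * cd U = p ^ (\<Delta> + 2) * (\<gamma> * cd U)" by simp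
  also have "\<dots> \<le> p ^ (\<Delta> + 2) * (\<gamma>' * cd U')" using le p_pos by (intro mult_left_mono) auto
  finally have "\<gamma> * p ^ (\<Delta> + 2) * cd U \<le> \<gamma>' * p ^ (\<Delta> + 2) * cd U'" by (simp add: mult_ac)
  then have "\<beta> \<le> \<gamma>' * p ^ (\<Delta> + 2) * cd U'" using a unfolding avoids_def by linarith
  moreover have "cd W \<le> \<gamma>' * cd U'" using a le unfolding avoids_def by linarith
  moreover have "U' \<subseteq> V" using a U' unfolding avoids_def by blast
  ultimately show ?thesis using a U'(2) unfolding avoids_def by simp
qed

text \<open>The contrapositive of \<open>dense_embedding\<close>, applied to the graph induced on
  \<open>U\<close>.\<close>

lemma sparse_pair:
  fixes \<Delta> :: nat and \<epsilon> :: real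
  assumes "1 \<le> \<Delta>" "0 < \<epsilon>" "\<epsilon> \<le> 1"
  shows "\<exists>\<mu> \<gamma>. 0 < \<mu> \<and> \<mu> \<le> 1 \<and> 0 < \<gamma> \<and> \<gamma> \<le> 1 \<and>
    (\<forall>(V :: 'a set) E p \<beta> R (W :: 'b set) adj U. avoids \<Delta> \<gamma> V E p \<beta> R W adj U \<longrightarrow>
      (\<exists>A B. A \<subseteq> U \<and> B \<subseteq> U \<and> A \<inter> B = {} \<and> card A = card B \<and> \<mu> * cd U \<le> cd A \<and> esum R A B \<le> \<epsilon> * p * cd A * cd B))"
proof -
  from dense_embedding[OF assms, where 'a = 'a and 'b = 'b]
  obtain \<mu> \<gamma> where c: "0 < \<mu>" "\<mu> \<le> 1" "0 < \<gamma>" "\<gamma> \<le> 1" and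
    emb: "\<forall>(V :: 'a set) E p \<beta> R (W :: 'b set) adj. jumbled_subgraph V E p \<beta> R \<longrightarrow> V \<noteq> {} \<longrightarrow> p \<le> \<beta> \<longrightarrow>
      \<beta> \<le> \<gamma> * p ^ (\<Delta> + 2) * cd V \<longrightarrow> finite W \<longrightarrow> cd W \<le> \<gamma> * cd V \<longrightarrow>
      (\<forall>x y. adj x y \<longrightarrow> adj y x) \<longrightarrow> (\<forall>x. \<not> adj x x) \<longrightarrow> (\<forall>x\<in>W. card {y\<in>W. adj x y} \<le> \<Delta>) \<longrightarrow>
      (\<forall>A B. A \<subseteq> V \<longrightarrow> B \<subseteq> V \<longrightarrow> A \<inter> B = {} \<longrightarrow> \<mu> * cd V \<le> cd A \<longrightarrow> \<mu> * cd V \<le> cd B \<longrightarrow>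
         \<epsilon> * p * cd A * cd B \<le> esum R A B) \<longrightarrow>
      (\<exists>f. inj_on f W \<and> f ` W \<subseteq> V \<and> (\<forall>x\<in>W. \<forall>y\<in>W. adj x y \<longrightarrow> R (f x) (f y)))"
    by (elim exE conjE)
  show ?thesis
  proof (rule exI[of _ \<mu>], rule exI[of _ \<gamma>], intro conjI allI impI)
    fix V :: "'a set" and E p \<beta> R and W :: "'b set" and adj U
    assume av: "avoids \<Delta> \<gamma> V E p \<beta> R W adj U"
    interpret jumbled_subgraph V E p \<beta> R using av unfolding avoids_def by auto
    have UV: "U \<subseteq> V" "U \<noteq> {}" using av unfolding avoids_def by auto
    have finU: "finite U" using UV fin by auto
    have J: "jumbled_subgraph U E p \<beta> R"
      by (rule jumbled_subgraph_subset[OF _ UV(1)]) (use av in \<open>auto simp: avoids_def\<close>)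
    have nof: "\<not> (\<exists>f. inj_on f W \<and> f ` W \<subseteq> U \<and> (\<forall>x\<in>W. \<forall>y\<in>W. adj x y \<longrightarrow> R (f x) (f y)))"
      using av UV unfolding avoids_def by (meson order.trans)
    have "\<not> (\<forall>A B. A \<subseteq> U \<longrightarrow> B \<subseteq> U \<longrightarrow> A \<inter> B = {} \<longrightarrow> \<mu> * cd U \<le> cd A \<longrightarrow> \<mu> * cd U \<le> cd B \<longrightarrow>
         \<epsilon> * p * cd A * cd B \<le> esum R A B)"
    proof (intro notI)
      assume dens: "\<forall>A B. A \<subseteq> U \<longrightarrow> B \<subseteq> U \<longrightarrow> A \<inter> B = {} \<longrightarrow> \<mu> * cd U \<le> cd A \<longrightarrow> \<mu> * cd U \<le> cd B \<longrightarrow>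
         \<epsilon> * p * cd A * cd B \<le> esum R A B"
      note av' = av[unfolded avoids_def]
      note emb' = emb[THEN spec[of _ U], THEN spec[of _ E], THEN spec[of _ p], THEN spec[of _ \<beta>],
          THEN spec[of _ R], THEN spec[of _ W], THEN spec[of _ adj]]
      have "\<exists>f. inj_on f W \<and> f ` W \<subseteq> U \<and> (\<forall>x\<in>W. \<forall>y\<in>W. adj x y \<longrightarrow> R (f x) (f y))"
        by (intro emb'[THEN mp, THEN mp, THEN mp, THEN mp, THEN mp, THEN mp, THEN mp, THEN mp, THEN mp, THEN mp] J dens)
          (use av' in simp_all)
      with nof show False by blast
    qed
    then obtain A B where A: "A \<subseteq> U" "\<mu> * cd U \<le> cd A" and B: "B \<subseteq> U" "\<mu> * cd U \<le> cd B"
      and AB: "A \<inter> B = {}" "esum R A B < \<epsilon> * p * cd A * cd B" by (auto simp: not_le)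
    have finAB: "finite A" "finite B" using A B finU finite_subset by auto
    have "0 < \<mu> * cd U" using c UV finU by (simp add: card_gt_0_iff)
    then have ne: "A \<noteq> {}" "B \<noteq> {}" using A B by auto
    obtain A' B' where 1: "A' \<subseteq> A" "B' \<subseteq> B" "card A' = min (card A) (card B)" "card B' = min (card A) (card B)"
      "esum R A' B' \<le> (\<epsilon> * p) * cd A' * cd B'"
      using equal_sizes[OF finAB R_sym less_imp_le[OF AB(2)] ne] by blast
    show "\<exists>A B. A \<subseteq> U \<and> B \<subseteq> U \<and> A \<inter> B = {} \<and> card A = card B \<and> \<mu> * cd U \<le> cd A \<and> esum R A B \<le> \<epsilon> * p * cd A * cd B"
      by (rule exI[of _ A'], rule exI[of _ B']) (use 1 A B AB in auto)
  qed (use c in auto)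
qed

text \<open>A sparse pair \<open>A, B\<close> is found first, and the other \<open>k\<close> sets
  are then found inside \<open>A\<close>. Their size \<open>s\<close> is at least
  \<open>c * cd A\<close>, so if the pair has density factor \<open>\<epsilon> * c^2\<close>, then
  even all its edges are few enough for two subsets of size \<open>s\<close>.\<close>

lemma sparse_sets:
  fixes \<Delta> k :: nat and \<epsilon> :: real
  assumes \<Delta>: "1 \<le> \<Delta>" and \<epsilon>: "0 < \<epsilon>" "\<epsilon> \<le> 1"
  shows "\<exists>c \<gamma>. 0 < c \<and> c \<le> 1 \<and> 0 < \<gamma> \<and> \<gamma> \<le> 1 \<and>
    (\<forall>(V :: 'a set) E p \<beta> R (W :: 'b set) adj U. avoids \<Delta> \<gamma> V E p \<beta> R W adj U \<longrightarrow>
      (\<exists>As s. (\<forall>i<k. As i \<subseteq> U \<and> card (As i) = s) \<and> s \<le> card U \<and> c * cd U \<le> real s \<and>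
        (\<forall>i<k. \<forall>j<k. i \<noteq> j \<longrightarrow> As i \<inter> As j = {} \<and> esum R (As i) (As j) \<le> \<epsilon> * p * (real s)\<^sup>2)))"
proof (induction k)
  case 0
  show ?case by (rule exI[of _ 1], rule exI[of _ 1]) auto
next
  case (Suc k)
  obtain c \<gamma> where c: "0 < c" "c \<le> 1" "0 < \<gamma>" "\<gamma> \<le> 1" and
    IH: "\<And>(V :: 'a set) E p \<beta> R (W :: 'b set) adj U. avoids \<Delta> \<gamma> V E p \<beta> R W adj U \<Longrightarrow>
      (\<exists>As s. (\<forall>i<k. As i \<subseteq> U \<and> card (As i) = s) \<and> s \<le> card U \<and> c * cd U \<le> real s \<and>
        (\<forall>i<k. \<forall>j<k. i \<noteq> j \<longrightarrow> As i \<inter> As j = {} \<and> esum R (As i) (As j) \<le> \<epsilon> * p * (real s)\<^sup>2))"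
    using Suc.IH by blast
  have \<epsilon>': "0 < \<epsilon> * c\<^sup>2" "\<epsilon> * c\<^sup>2 \<le> 1" using \<epsilon> c by (auto intro!: mult_le_one power_le_one)
  obtain \<mu> \<gamma>1 where \<mu>: "0 < \<mu>" "\<mu> \<le> 1" "0 < \<gamma>1" "\<gamma>1 \<le> 1" and
    pair: "\<And>(V :: 'a set) E p \<beta> R (W :: 'b set) adj U. avoids \<Delta> \<gamma>1 V E p \<beta> R W adj U \<Longrightarrow>
      (\<exists>A B. A \<subseteq> U \<and> B \<subseteq> U \<and> A \<inter> B = {} \<and> card A = card B \<and> \<mu> * cd U \<le> cd A \<and> esum R A B \<le> \<epsilon> * c\<^sup>2 * p * cd A * cd B)"
    using sparse_pair[OF \<Delta> \<epsilon>', where 'a = 'a and 'b = 'b] by blast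
  define \<gamma>' where "\<gamma>' = min \<gamma>1 (\<gamma> * \<mu>)"
  have \<gamma>': "0 < \<gamma>'" "\<gamma>' \<le> 1" "\<gamma>' \<le> \<gamma>1" "\<gamma>' \<le> \<gamma> * \<mu>" unfolding \<gamma>'_def using c \<mu> by auto
  show ?case
  proof (rule exI[of _ "c * \<mu>"], rule exI[of _ \<gamma>'], intro conjI allI impI)
    fix V :: "'a set" and E p \<beta> R and W :: "'b set" and adj U
    assume av: "avoids \<Delta> \<gamma>' V E p \<beta> R W adj U"
    interpret jumbled_subgraph V E p \<beta> R using av unfolding avoids_def by auto
    have UV: "U \<subseteq> V" "U \<noteq> {}" using av unfolding avoids_def by auto
    have finU: "finite U" using UV fin by auto
    have "avoids \<Delta> \<gamma>1 V E p \<beta> R W adj U"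
      by (rule avoids_subset[OF av, where c = 1]) (use UV \<mu> \<gamma>' in auto)
    from pair[OF this] obtain A B where A: "A \<subseteq> U" "\<mu> * cd U \<le> cd A" and B: "B \<subseteq> U" "card A = card B"
      and AB: "A \<inter> B = {}" "esum R A B \<le> \<epsilon> * c\<^sup>2 * p * cd A * cd B" by blast
    have finAB: "finite A" "finite B" using A B finU finite_subset by auto
    have "0 < \<mu> * cd U" using \<mu> UV finU by (simp add: card_gt_0_iff)
    then have ne: "A \<noteq> {}" using A by auto
    have "avoids \<Delta> \<gamma> V E p \<beta> R W adj A"
      by (rule avoids_subset[OF av, where c = \<mu>]) (use A ne c \<gamma>' in auto)
    from IH[OF this] obtain As s where As: "\<forall>i<k. As i \<subseteq> A \<and> card (As i) = s" "s \<le> card A" "c * cd A \<le> real s"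
      "\<forall>i<k. \<forall>j<k. i \<noteq> j \<longrightarrow> As i \<inter> As j = {} \<and> esum R (As i) (As j) \<le> \<epsilon> * p * (real s)\<^sup>2" by blast
    \<comment> \<open>The last set must have the size dictated by the induction hypothesis;
      \<open>B\<close> is large enough because \<open>A\<close> and \<open>B\<close> have equal
      size.\<close>
    obtain B' where B': "B' \<subseteq> B" "card B' = s" using As(2) B(2) by (metis obtain_subset_with_card_n)
    have cross: "esum R (As i) B' \<le> \<epsilon> * p * (real s)\<^sup>2" "esum R B' (As i) \<le> \<epsilon> * p * (real s)\<^sup>2" "As i \<inter> B' = {}" if i: "i < k" for i
    proof -
      have "esum R (As i) B' \<le> esum R A B" using As(1) i B' finAB by (intro esum_mono) auto
      also have "\<dots> \<le> \<epsilon> * p * (c * cd A)\<^sup>2" using AB(2) B(2) by (simp add: power_mult_distrib power2_eq_square mult_ac)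
      also have "\<dots> \<le> \<epsilon> * p * (real s)\<^sup>2" using As(3) \<epsilon> p_pos c by (intro mult_left_mono power_mono) auto
      finally show 1: "esum R (As i) B' \<le> \<epsilon> * p * (real s)\<^sup>2" .
      then show "esum R B' (As i) \<le> \<epsilon> * p * (real s)\<^sup>2" using esum_swap[OF R_sym, where A = B' and B = "As i"] by simp
      show "As i \<inter> B' = {}" using As(1) i B' AB by blast
    qed
    have s1: "c * \<mu> * cd U \<le> real s"
    proof -
      have "c * (\<mu> * cd U) \<le> c * cd A" using A(2) c by (intro mult_left_mono) auto
      then show ?thesis using As(3) by (simp add: mult_ac)
    qed
    have sU: "s \<le> card U" using As(2) A(1) finU by (meson card_mono order.trans)
    show "\<exists>As s. (\<forall>i<Suc k. As i \<subseteq> U \<and> card (As i) = s) \<and> s \<le> card U \<and> c * \<mu> * cd U \<le> real s \<and>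
        (\<forall>i<Suc k. \<forall>j<Suc k. i \<noteq> j \<longrightarrow> As i \<inter> As j = {} \<and> esum R (As i) (As j) \<le> \<epsilon> * p * (real s)\<^sup>2)"
    proof (rule exI[of _ "As(k := B')"], rule exI[of _ s], intro conjI allI impI)
      fix i j assume ij: "i < Suc k" "j < Suc k" "i \<noteq> j"
      consider "i < k" "j < k" | "i = k" "j < k" | "i < k" "j = k" using ij by linarith
      then show "(As(k := B')) i \<inter> (As(k := B')) j = {}" "esum R ((As(k := B')) i) ((As(k := B')) j) \<le> \<epsilon> * p * (real s)\<^sup>2"
        using As(4) ij cross by (cases; auto simp: Int_commute)+
    next
      fix i assume "i < Suc k"
      then show "(As(k := B')) i \<subseteq> U" "card ((As(k := B')) i) = s"
        using As(1) A B B' by (auto simp: less_Suc_eq)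
    qed (use s1 sU in auto)
  qed (use c \<mu> \<gamma>' in \<open>auto intro: mult_le_one\<close>)
qed

lemma esum_UNION:
  fixes B :: "'i \<Rightarrow> 'a set"
  assumes "finite I" "\<And>i. i \<in> I \<Longrightarrow> finite (B i)" "\<And>i j. i \<in> I \<Longrightarrow> j \<in> I \<Longrightarrow> i \<noteq> j \<Longrightarrow> B i \<inter> B j = {}"
  shows "esum R (\<Union>i\<in>I. B i) (\<Union>i\<in>I. B i) = (\<Sum>i\<in>I. \<Sum>j\<in>I. esum R (B i) (B j))"
proof -
  have U: "sum f (\<Union>i\<in>I. B i) = (\<Sum>i\<in>I. sum f (B i))" for f :: "'a \<Rightarrow> real"
    using assms by (intro sum.UNION_disjoint) auto
  have "esum R (\<Union>i\<in>I. B i) (\<Union>i\<in>I. B i) = (\<Sum>i\<in>I. \<Sum>x\<in>B i. \<Sum>j\<in>I. \<Sum>y\<in>B j. of_bool (R x y))"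
    unfolding U ..
  also have "\<dots> = (\<Sum>i\<in>I. \<Sum>j\<in>I. esum R (B i) (B j))"
    by (rule sum.cong[OF refl], rule sum.swap)
  finally show ?thesis .
qed

text \<open>The earlier colours are made sparse on \<open>U\<close>, then the new colour on a union
  \<open>T\<close> of many sets inside \<open>U\<close>. The shrinking factor \<open>c1\<close> of
  the second step depends only on \<open>\<epsilon>\<close> and \<open>k\<close>, so the density for
  the earlier colours can be chosen after it, small enough to survive the passage to
  \<open>T\<close>.\<close>

lemma sparse_subset:
  fixes \<Delta> i :: nat
  assumes \<Delta>: "1 \<le> \<Delta>"
  shows "\<forall>\<epsilon>>0. \<epsilon> \<le> 1 \<longrightarrow> (\<exists>c \<gamma>. 0 < c \<and> c \<le> 1 \<and> 0 < \<gamma> \<and> \<gamma> \<le> 1 \<and>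
    (\<forall>(V :: 'a set) E p \<beta> Rs (Ws :: nat \<Rightarrow> 'b set) adjs. (\<forall>j<i. avoids \<Delta> \<gamma> V E p \<beta> (Rs j) (Ws j) (adjs j) V) \<longrightarrow>
      (\<exists>U\<subseteq>V. c * cd V \<le> cd U \<and> (\<forall>j<i. esum (Rs j) U U \<le> \<epsilon> * p * (cd U)\<^sup>2))))"
proof (induction i)
  case 0
  show ?case
    by (intro allI impI, rule exI[of _ 1], rule exI[of _ 1]) auto
next
  case (Suc i)
  show ?case
  proof (intro allI impI)
    fix \<epsilon> :: real assume \<epsilon>: "0 < \<epsilon>" "\<epsilon> \<le> 1"
    \<comment> \<open>Inside a single part only the trivial bound \<open>2 * p * (real s)^2\<close>
      is available. With \<open>8 / \<epsilon>\<close> parts the \<open>k\<close> diagonal terms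
      weigh no more than the \<open>k^2\<close> terms with factor \<open>\<epsilon> / 4\<close>,
      which gives \<open>\<epsilon> / 2\<close> in total.\<close>
    obtain k :: nat where k: "8 / \<epsilon> \<le> real k" using real_arch_simple by blast
    have k0: "0 < real k" using \<epsilon> by (intro less_le_trans[OF _ k]) auto
    have k8: "8 \<le> \<epsilon> * real k" using k \<epsilon> by (simp add: pos_divide_le_eq mult.commute)
    have e4: "0 < \<epsilon> / 4" "\<epsilon> / 4 \<le> 1" using \<epsilon> by auto
    from sparse_sets[OF \<Delta> e4, where 'a = 'a and 'b = 'b and k = k]
    obtain c1 \<gamma>1 where c1: "0 < c1" "c1 \<le> 1" "0 < \<gamma>1" "\<gamma>1 \<le> 1" and
      sets: "\<forall>(V :: 'a set) E p \<beta> R (W :: 'b set) adj U. avoids \<Delta> \<gamma>1 V E p \<beta> R W adj U \<longrightarrow>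
      (\<exists>As s. (\<forall>i<k. As i \<subseteq> U \<and> card (As i) = s) \<and> s \<le> card U \<and> c1 * cd U \<le> real s \<and>
        (\<forall>i<k. \<forall>j<k. i \<noteq> j \<longrightarrow> As i \<inter> As j = {} \<and> esum R (As i) (As j) \<le> \<epsilon> / 4 * p * (real s)\<^sup>2))"
      by (elim exE conjE)
    \<comment> \<open>As \<open>T\<close> has at least \<open>c1 * cd U\<close> vertices,
      \<open>\<epsilon> * c1^2\<close> relative to \<open>U\<close> is at most
      \<open>\<epsilon>\<close> relative to \<open>T\<close>.\<close>
    have e2: "0 < \<epsilon> * c1\<^sup>2" "\<epsilon> * c1\<^sup>2 \<le> 1" using \<epsilon> c1 by (auto intro!: mult_le_one power_le_one)
    from Suc.IH[THEN spec, THEN mp, OF e2(1), THEN mp, OF e2(2)]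
    obtain c2 \<gamma>2 where c2: "0 < c2" "c2 \<le> 1" "0 < \<gamma>2" "\<gamma>2 \<le> 1" and
      IH: "\<forall>(V :: 'a set) E p \<beta> Rs (Ws :: nat \<Rightarrow> 'b set) adjs. (\<forall>j<i. avoids \<Delta> \<gamma>2 V E p \<beta> (Rs j) (Ws j) (adjs j) V) \<longrightarrow>
      (\<exists>U\<subseteq>V. c2 * cd V \<le> cd U \<and> (\<forall>j<i. esum (Rs j) U U \<le> \<epsilon> * c1\<^sup>2 * p * (cd U)\<^sup>2))"
      by (elim exE conjE)
    define \<gamma> where "\<gamma> = min \<gamma>2 (min (\<gamma>1 * c2) (c1 * c2))"
    have \<gamma>: "0 < \<gamma>" "\<gamma> \<le> 1" "\<gamma> \<le> \<gamma>2" "\<gamma> \<le> \<gamma>1 * c2" "\<gamma> \<le> c1 * c2" unfolding \<gamma>_def using c1 c2 by auto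
    show "\<exists>c \<gamma>. 0 < c \<and> c \<le> 1 \<and> 0 < \<gamma> \<and> \<gamma> \<le> 1 \<and>
      (\<forall>(V :: 'a set) E p \<beta> Rs (Ws :: nat \<Rightarrow> 'b set) adjs. (\<forall>j<Suc i. avoids \<Delta> \<gamma> V E p \<beta> (Rs j) (Ws j) (adjs j) V) \<longrightarrow>
      (\<exists>U\<subseteq>V. c * cd V \<le> cd U \<and> (\<forall>j<Suc i. esum (Rs j) U U \<le> \<epsilon> * p * (cd U)\<^sup>2)))"
    proof (rule exI[of _ "c1 * c2"], rule exI[of _ \<gamma>], intro conjI allI impI)
      fix V :: "'a set" and E p \<beta> Rs and Ws :: "nat \<Rightarrow> 'b set" and adjs
      assume av: "\<forall>j<Suc i. avoids \<Delta> \<gamma> V E p \<beta> (Rs j) (Ws j) (adjs j) V"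
      then have avi: "avoids \<Delta> \<gamma> V E p \<beta> (Rs i) (Ws i) (adjs i) V" by simp
      interpret jumbled_subgraph V E p \<beta> "Rs i" using avi unfolding avoids_def by auto
      have ne: "V \<noteq> {}" and \<beta>: "\<beta> \<le> \<gamma> * p ^ (\<Delta> + 2) * cd V" using avi unfolding avoids_def by auto
      have Vpos: "0 < cd V" using ne finV by (simp add: card_gt_0_iff)
      have "\<forall>j<i. avoids \<Delta> \<gamma>2 V E p \<beta> (Rs j) (Ws j) (adjs j) V"
      proof (intro allI impI)
        fix j assume "j < i"
        then have "avoids \<Delta> \<gamma> V E p \<beta> (Rs j) (Ws j) (adjs j) V" using av by simp
        then show "avoids \<Delta> \<gamma>2 V E p \<beta> (Rs j) (Ws j) (adjs j) V"
          by (rule avoids_subset[where c = 1]) (use ne c2 \<gamma> in auto)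
      qed
      from IH[THEN spec, THEN spec, THEN spec, THEN spec, THEN spec, THEN spec, THEN spec, THEN mp, OF this]
      obtain U where U: "U \<subseteq> V" "c2 * cd V \<le> cd U" "\<forall>j<i. esum (Rs j) U U \<le> \<epsilon> * c1\<^sup>2 * p * (cd U)\<^sup>2"
        by blast
      have Upos: "0 < cd U" using U(2) Vpos c2 by (smt (verit) mult_pos_pos)
      have Une: "U \<noteq> {}" using Upos by auto
      have finU: "finite U" using U(1) by (rule fin)
      have "avoids \<Delta> \<gamma>1 V E p \<beta> (Rs i) (Ws i) (adjs i) U"
        by (rule avoids_subset[OF avi U(1) Une U(2)]) (use c1 \<gamma> in auto)
      from sets[rule_format, OF this] obtain As s where As: "\<forall>a<k. As a \<subseteq> U \<and> card (As a) = s" "c1 * cd U \<le> real s"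
        "\<forall>a<k. \<forall>b<k. a \<noteq> b \<longrightarrow> As a \<inter> As b = {} \<and> esum (Rs i) (As a) (As b) \<le> \<epsilon> / 4 * p * (real s)\<^sup>2" by blast
      define T where "T = (\<Union>a<k. As a)"
      have finA: "finite (As a)" if "a < k" for a using As(1) that finU finite_subset by blast
      have TU: "T \<subseteq> U" unfolding T_def using As(1) by auto
      have "card T = (\<Sum>a<k. card (As a))"
        unfolding T_def using finA As(3) by (intro card_UN_disjoint) auto
      then have cT: "cd T = real k * real s" using As(1) by simp
      have k1: "1 \<le> real k" using k0 by simp
      have sT: "real s \<le> cd T" unfolding cT using mult_right_mono[OF k1, of "real s"] by simp
      have "\<beta> \<le> p * real s"
      proof -
        have "p ^ (\<Delta> + 2) \<le> p ^ 1" using p_pos p_le by (intro power_decreasing) auto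
        then have "\<gamma> * p ^ (\<Delta> + 2) * cd V \<le> (c1 * c2) * p * cd V"
          using \<gamma> p_pos c1 c2 by (intro mult_right_mono mult_mono) auto
        also have "\<dots> = p * (c1 * (c2 * cd V))" by simp
        also have "\<dots> \<le> p * (c1 * cd U)" using U(2) p_pos c1 by (intro mult_left_mono) auto
        also have "\<dots> \<le> p * real s" using As(2) p_pos by (intro mult_left_mono) auto
        finally show ?thesis using \<beta> by linarith
      qed
      then have \<beta>s: "\<beta> * real s \<le> p * (real s)\<^sup>2"
        using mult_right_mono[of \<beta> "p * real s" "real s"] by (simp add: power2_eq_square)
      \<comment> \<open>Nothing is known about \<open>Rs i\<close> inside a part, so all edges of
        \<open>E\<close> are counted; this is where \<open>\<beta> \<le> p * real s\<close> is
        needed.\<close>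
      have diag: "esum (Rs i) (As a) (As a) \<le> 2 * p * (real s)\<^sup>2" if a: "a < k" for a
      proof -
        have "As a \<subseteq> V" "card (As a) = s" using As(1) a U(1) by blast+
        then have "esum E (As a) (As a) \<le> p * real s * real s + \<beta> * sqrt (real s * real s)"
          using edge_sum[of "As a" "As a"] by (simp add: abs_le_iff)
        also have "\<dots> \<le> 2 * p * (real s)\<^sup>2" using \<beta>s by (simp add: power2_eq_square)
        finally show ?thesis using esum_R_le[where A = "As a" and B = "As a"] by linarith
      qed
      have off: "esum (Rs i) (As a) (As b) \<le> of_bool (a = b) * (2 * p * (real s)\<^sup>2) + \<epsilon> / 4 * p * (real s)\<^sup>2"
        if "a < k" "b < k" for a b
      proof (cases "a = b")
        case True
        have "0 \<le> \<epsilon> / 4 * p * (real s)\<^sup>2" using \<epsilon> p_pos by simp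
        then show ?thesis using diag[OF that(1)] True by simp
      next
        case False
        then show ?thesis using As(3) that by simp
      qed
      have Ti: "esum (Rs i) T T \<le> \<epsilon> * p * (cd T)\<^sup>2"
      proof -
        have "esum (Rs i) T T = (\<Sum>a<k. \<Sum>b<k. esum (Rs i) (As a) (As b))"
          unfolding T_def using finA As(3) by (intro esum_UNION) auto
        also have "\<dots> \<le> (\<Sum>a<k. \<Sum>b<k. of_bool (a = b) * (2 * p * (real s)\<^sup>2) + \<epsilon> / 4 * p * (real s)\<^sup>2)"
          by (intro sum_mono off) auto
        also have "\<dots> = real k * (2 * p * (real s)\<^sup>2) + real k * (real k * (\<epsilon> / 4 * p * (real s)\<^sup>2))"
        proof -
          have "(\<Sum>b<k. of_bool (a = b) * u + w) = u + real k * w" if "a < k" for a and u w :: real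
          proof -
            have "(\<Sum>b<k. of_bool (a = b) * u) = (\<Sum>b<k. if a = b then u else 0)"
              by (intro sum.cong) auto
            also have "\<dots> = u" using that by simp
            finally show ?thesis by (simp add: sum.distrib)
          qed
          then have "(\<Sum>a<k. \<Sum>b<k. of_bool (a = b) * u + w) = (\<Sum>a<k. u + real k * w)" for u w :: real
            by (intro sum.cong) auto
          then show ?thesis by (simp only: sum.distrib sum_constant card_lessThan)
        qed
        also have "real k * (2 * p * (real s)\<^sup>2) \<le> real k * (real k * (\<epsilon> / 4 * p * (real s)\<^sup>2))"
        proof -
          have "8 * (real k * (p * (real s)\<^sup>2)) \<le> (\<epsilon> * real k) * (real k * (p * (real s)\<^sup>2))"
            using k8 p_pos by (intro mult_right_mono) auto
          then show ?thesis by (simp add: algebra_simps)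
        qed
        also have "real k * (real k * (\<epsilon> / 4 * p * (real s)\<^sup>2)) + real k * (real k * (\<epsilon> / 4 * p * (real s)\<^sup>2))
          = \<epsilon> / 2 * p * (cd T)\<^sup>2" unfolding cT by (simp add: power2_eq_square)
        also have "\<dots> \<le> \<epsilon> * p * (cd T)\<^sup>2" using \<epsilon> p_pos by (intro mult_right_mono) auto
        finally show ?thesis by simp
      qed
      have Tj: "esum (Rs j) T T \<le> \<epsilon> * p * (cd T)\<^sup>2" if j: "j < i" for j
      proof -
        have "esum (Rs j) T T \<le> esum (Rs j) U U" using TU finU by (intro esum_mono)
        also have "\<dots> \<le> \<epsilon> * c1\<^sup>2 * p * (cd U)\<^sup>2" using U(3) j by simp
        also have "\<dots> = \<epsilon> * p * (c1 * cd U)\<^sup>2" by (simp add: power_mult_distrib)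
        also have "\<dots> \<le> \<epsilon> * p * (cd T)\<^sup>2"
          using As(2) sT \<epsilon> p_pos c1 by (intro mult_left_mono power_mono) auto
        finally show ?thesis .
      qed
      have "c1 * c2 * cd V \<le> cd T"
      proof -
        have "c1 * (c2 * cd V) \<le> c1 * cd U" using U(2) c1 by (intro mult_left_mono) auto
        then show ?thesis using As(2) sT by (simp add: mult.assoc)
      qed
      then show "\<exists>U\<subseteq>V. c1 * c2 * cd V \<le> cd U \<and> (\<forall>j<Suc i. esum (Rs j) U U \<le> \<epsilon> * p * (cd U)\<^sup>2)"
        using TU U(1) Ti Tj by (intro exI[of _ T]) (auto simp: less_Suc_eq)
    qed (use c1 c2 \<gamma> in \<open>auto intro: mult_le_one\<close>)
  qed
qed

section \<open>From graphs as edge sets to the relational setting, and the theorem\<close>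

lemma edge_count_esum:
  assumes "finite X" "finite Y"
  shows "real (edge_count G X Y) = esum (\<lambda>x y. {x, y} \<in> edges G) X Y"
proof -
  have "{(x, y). x \<in> X \<and> y \<in> Y \<and> {x, y} \<in> edges G} = (SIGMA x:X. {y\<in>Y. {x, y} \<in> edges G})" by auto
  then have "edge_count G X Y = (\<Sum>x\<in>X. card {y\<in>Y. {x, y} \<in> edges G})"
    unfolding edge_count_def using assms by (simp add: card_SigmaI)
  then show ?thesis using card_filter_eq_sum[OF assms(2)] by simp
qed

lemma jumbled_subgraph_of_colour:
  assumes "finite (verts G)" "0 < p" "p \<le> 1" "0 \<le> \<beta>" "bijumbled p \<beta> G"
  shows "jumbled_subgraph (verts G) (\<lambda>x y. {x, y} \<in> edges G) p \<beta> (\<lambda>x y. {x, y} \<in> edges G \<and> col {x, y} = i)"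
proof unfold_locales
  fix X Y assume XY: "X \<subseteq> verts G" "Y \<subseteq> verts G"
  then have "finite X" "finite Y" using assms(1) finite_subset by auto
  then have "(\<Sum>x\<in>X. \<Sum>y\<in>Y. of_bool ({x, y} \<in> edges G) - p) = real (edge_count G X Y) - p * cd X * cd Y"
    by (simp add: edge_count_esum sum_subtractf)
  then show "\<bar>\<Sum>x\<in>X. \<Sum>y\<in>Y. of_bool ({x, y} \<in> edges G) - p\<bar> \<le> \<beta> * sqrt (cd X * cd Y)"
    using assms(5) XY unfolding bijumbled_def by simp
qed (use assms in \<open>auto simp: insert_commute\<close>)

lemma card_neighbours_le_degree:
  assumes "simple_graph H"
  shows "card {y\<in>verts H. {x, y} \<in> edges H} \<le> degree H x"
  unfolding degree_def
proof (rule card_inj_on_le[where f = "\<lambda>y. {x, y}"])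
  have "edges H \<subseteq> Pow (verts H)" "finite (Pow (verts H))" using assms unfolding simple_graph_def by auto
  then have "finite (edges H)" by (rule finite_subset)
  then show "finite {e \<in> edges H. x \<in> e}" by simp
qed (auto simp: inj_on_def doubleton_eq_iff)

lemma contains_copyI:
  assumes H: "simple_graph H" and f: "inj_on f (verts H)" "f ` verts H \<subseteq> verts G"
    and E: "\<And>x y. x \<in> verts H \<Longrightarrow> y \<in> verts H \<Longrightarrow> {x, y} \<in> edges H \<Longrightarrow> {f x, f y} \<in> edges G"
  shows "contains_copy G H"
  unfolding contains_copy_def
proof (intro exI[of _ f] conjI ballI f)
  fix e assume e: "e \<in> edges H"
  then have "card e = 2" "e \<subseteq> verts H" using H unfolding simple_graph_def by auto
  then obtain x y where "e = {x, y}" "x \<in> verts H" "y \<in> verts H" by (auto simp: card_2_iff)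
  then show "f ` e \<in> edges G" using E e by auto
qed

text \<open>The condition \<open>r \<ge> 1\<close> excludes the case of no colour class, in which
  \<open>n = 0\<close> is a counterexample. For \<open>p\<close> far above 1 the error term would
  exceed \<open>p * card X * card Y\<close>, so that even an edgeless graph would count as
  bijumbled; hence \<open>p \<le> 1\<close>.\<close>

theorem theorem1p4:
  fixes r \<Delta> :: nat
  assumes "r \<ge> 1"
  shows "\<exists>C::nat. C \<ge> 1 \<and>
    (\<forall>(n::nat) (p::real) (G::nat graph).
       0 < p \<longrightarrow> p \<le> 1 \<longrightarrow> simple_graph G \<longrightarrow> card (verts G) = C * n \<longrightarrow>
       bijumbled p (1 / real C * p powr (max 4 ((3 * real \<Delta> + 1) / 2)) * real n) G \<longrightarrow>
       partition_universal r G (bounded_degree_graphs n \<Delta> :: nat graph set))"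
proof -
  \<comment> \<open>The argument needs the exponent \<open>D + 2\<close>. For
    \<open>\<Delta> \<le> 2\<close> this is 4, and for \<open>\<Delta> \<ge> 3\<close> it is
    \<open>\<Delta> + 2 \<le> (3 * \<Delta> + 1) / 2\<close>.\<close>
  define D where "D = max 2 \<Delta>"
  have D: "1 \<le> D" "\<Delta> \<le> D" unfolding D_def by auto
  \<comment> \<open>If each of the \<open>r\<close> colours has at most this relative density, all
    of them together have at most half of the expected edges.\<close>
  define \<epsilon> where "\<epsilon> = 1 / (2 * real r)"
  have \<epsilon>: "0 < \<epsilon>" "\<epsilon> \<le> 1" unfolding \<epsilon>_def using assms by auto
  from sparse_subset[OF D(1), where 'a = nat and 'b = nat and i = r, THEN spec[of _ \<epsilon>], THEN mp, OF \<epsilon>(1), THEN mp, OF \<epsilon>(2)]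
  obtain c \<gamma> where c: "0 < c" "c \<le> 1" "0 < \<gamma>" "\<gamma> \<le> 1" and
    main: "\<forall>(V :: nat set) E p \<beta> Rs (Ws :: nat \<Rightarrow> nat set) adjs.
      (\<forall>j<r. avoids D \<gamma> V E p \<beta> (Rs j) (Ws j) (adjs j) V) \<longrightarrow>
      (\<exists>U\<subseteq>V. c * cd V \<le> cd U \<and> (\<forall>j<r. esum (Rs j) U U \<le> \<epsilon> * p * (cd U)\<^sup>2))"
    by (elim exE conjE)
  \<comment> \<open>The bound \<open>c / 8\<close> ensures that on the final set the jumbledness
    error is at most an eighth of the expected number of edges, well below the missing half.\<close>
  define g where "g = min \<gamma> (c / 8)"
  have g: "0 < g" "g \<le> \<gamma>" "g \<le> c / 8" "g \<le> 1" unfolding g_def using c by auto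
  obtain C :: nat where C: "1 / g \<le> real C" using real_arch_simple by blast
  have C1: "1 \<le> real C" using C g by (smt (verit) le_divide_eq_1_pos)
  have gC: "1 \<le> g * real C" using C g by (simp add: pos_divide_le_eq mult.commute)
  have Cg: "1 / real C \<le> g" using gC C1 by (simp add: pos_divide_le_eq)
  show ?thesis
  proof (intro exI[of _ C] conjI allI impI)
    show "C \<ge> 1" using C1 by simp
    fix n :: nat and p :: real and G :: "nat graph"
    assume p: "0 < p" "p \<le> 1" and G: "simple_graph G" and cV: "card (verts G) = C * n"
      and bij: "bijumbled p (1 / real C * p powr (max 4 ((3 * real \<Delta> + 1) / 2)) * real n) G"
    define \<beta> where "\<beta> = 1 / real C * p powr (max 4 ((3 * real \<Delta> + 1) / 2)) * real n"
    have finV: "finite (verts G)" using G unfolding simple_graph_def by auto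
    show "partition_universal r G (bounded_degree_graphs n \<Delta> :: nat graph set)"
    proof (cases "n = 0")
      \<comment> \<open>For \<open>n = 0\<close> the graph has no vertices, and
        \<open>sparse_subset\<close> is of no use because \<open>avoids\<close> asks for a nonempty
        set. The only graph to be embedded is empty.\<close>
      case True
      have "contains_copy K H" if "H \<in> bounded_degree_graphs n \<Delta>" for K H :: "nat graph"
        using that True unfolding bounded_degree_graphs_def
        by (intro contains_copyI[where f = id]) (auto simp: simple_graph_def)
      then show ?thesis using assms unfolding partition_universal_def by (auto intro!: exI[of _ 0])
    next
      case False
      show ?thesis
      proof (rule ccontr)
        assume "\<not> ?thesis"
        then obtain col where col: "\<forall>e\<in>edges G. col e < r"
          and "\<forall>i<r. \<exists>H\<in>(bounded_degree_graphs n \<Delta> :: nat graph set). \<not> contains_copy (colour_class G col i) H"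
          unfolding partition_universal_def by blast
        then obtain H :: "nat \<Rightarrow> nat graph" where H: "\<And>i. i < r \<Longrightarrow> H i \<in> bounded_degree_graphs n \<Delta>"
          "\<And>i. i < r \<Longrightarrow> \<not> contains_copy (colour_class G col i) (H i)" by metis
        define E where "E x y \<longleftrightarrow> {x, y} \<in> edges G" for x y
        define R where "R i x y \<longleftrightarrow> {x, y} \<in> edges G \<and> col {x, y} = i" for i x y
        define adj where "adj i x y \<longleftrightarrow> {x, y} \<in> edges (H i)" for i x y
        let ?V = "verts G"
        have \<beta>0: "0 \<le> \<beta>" unfolding \<beta>_def using C1 by auto
        have J: "jumbled_subgraph ?V E p \<beta> (R i)" for i
          using jumbled_subgraph_of_colour[OF finV p \<beta>0 bij[folded \<beta>_def], of col i]
          unfolding E_def[abs_def] R_def[abs_def] .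
        have cVr: "cd ?V = real C * real n" using cV by simp
        have n1: "1 \<le> real n" using False by simp
        have Vpos: "0 < cd ?V" unfolding cVr using C1 n1 by simp
        then have Vne: "?V \<noteq> {}" by auto
        have nV: "real n \<le> cd ?V" unfolding cVr using mult_right_mono[OF C1, of "real n"] by simp
        have \<beta>le: "\<beta> \<le> g * p ^ (D + 2) * cd ?V"
        proof -
          have "p powr (max 4 ((3 * real \<Delta> + 1) / 2)) \<le> p powr (real (D + 2))"
          proof (rule powr_mono')
            show "real (D + 2) \<le> max 4 ((3 * real \<Delta> + 1) / 2)"
            proof (cases "\<Delta> \<le> 2")
              case True
              then have "D = 2" unfolding D_def by simp
              then show ?thesis by simp
            next
              case False
              then have "D = \<Delta>" "3 \<le> real \<Delta>" unfolding D_def by auto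
              then show ?thesis by (simp add: le_max_iff_disj)
            qed
          qed (use p in auto)
          also have "\<dots> = p ^ (D + 2)" using p(1) by (rule powr_realpow)
          finally have "\<beta> \<le> g * p ^ (D + 2) * real n"
            unfolding \<beta>_def using Cg g p by (intro mult_right_mono mult_mono) auto
          also have "\<dots> \<le> g * p ^ (D + 2) * cd ?V" using nV g p by (intro mult_left_mono) auto
          finally show ?thesis .
        qed
        \<comment> \<open>A graph without loops has no edge between \<open>{v}\<close> and
          \<open>{v}\<close>, where bijumbledness predicts \<open>p\<close> up to an error
          \<open>\<beta>\<close>.\<close>
        have p\<beta>: "p \<le> \<beta>"
        proof -
          obtain v where v: "v \<in> ?V" using Vne by blast
          have "edge_count G {v} {v} = 0"
            using G unfolding edge_count_def simple_graph_def by (fastforce simp: card_eq_0_iff)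
          then show ?thesis using bij[folded \<beta>_def] v unfolding bijumbled_def
            by (auto dest!: spec[of _ "{v}"])
        qed
        have av: "avoids D \<gamma> ?V E p \<beta> (R j) (verts (H j)) (adj j) ?V" if j: "j < r" for j
        proof -
          have Hj: "simple_graph (H j)" "card (verts (H j)) = n" "\<And>v. v \<in> verts (H j) \<Longrightarrow> degree (H j) v \<le> \<Delta>"
            using H(1)[OF j] unfolding bounded_degree_graphs_def by auto
          show ?thesis
            unfolding avoids_def
          proof (intro conjI J Vne p\<beta> order.refl allI ballI impI)
            have "g * p ^ (D + 2) * cd ?V \<le> \<gamma> * p ^ (D + 2) * cd ?V"
              using g p by (intro mult_right_mono) auto
            then show "\<beta> \<le> \<gamma> * p ^ (D + 2) * cd ?V" using \<beta>le by linarith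
            show "finite (verts (H j))" using Hj(1) unfolding simple_graph_def by simp
            have "1 * real n \<le> (\<gamma> * real C) * real n"
              using gC g C1 by (intro mult_right_mono) (auto intro: order.trans mult_right_mono)
            then show "cd (verts (H j)) \<le> \<gamma> * cd ?V" unfolding cVr Hj(2) by simp
            show "adj j y x" if "adj j x y" for x y using that unfolding adj_def by (simp add: insert_commute)
            show "\<not> adj j x x" for x using Hj(1) unfolding adj_def simple_graph_def by fastforce
            show "card {y\<in>verts (H j). adj j x y} \<le> D" if "x \<in> verts (H j)" for x
              using card_neighbours_le_degree[OF Hj(1), of x] Hj(3)[OF that] D(2) unfolding adj_def by linarith
            show "\<not> (\<exists>f. inj_on f (verts (H j)) \<and> f ` verts (H j) \<subseteq> ?V \<and>
              (\<forall>x\<in>verts (H j). \<forall>y\<in>verts (H j). adj j x y \<longrightarrow> R j (f x) (f y)))"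
            proof
              assume "\<exists>f. inj_on f (verts (H j)) \<and> f ` verts (H j) \<subseteq> ?V \<and>
                (\<forall>x\<in>verts (H j). \<forall>y\<in>verts (H j). adj j x y \<longrightarrow> R j (f x) (f y))"
              then have "contains_copy (colour_class G col j) (H j)"
                unfolding adj_def R_def by (elim exE conjE, intro contains_copyI[OF Hj(1)]) (auto simp: colour_class_def)
              with H(2)[OF j] show False ..
            qed
          qed
        qed
        obtain U where U: "U \<subseteq> ?V" "c * cd ?V \<le> cd U" "\<And>j. j < r \<Longrightarrow> esum (R j) U U \<le> \<epsilon> * p * (cd U)\<^sup>2"
        proof -
          have "\<forall>j<r. avoids D \<gamma> ?V E p \<beta> (R j) (verts (H j)) (adj j) ?V" using av by simp
          from main[THEN spec, THEN spec, THEN spec, THEN spec, THEN spec,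
              THEN spec[of _ "\<lambda>j. verts (H j)"], THEN spec, THEN mp, OF this]
          show ?thesis using that by blast
        qed
        have "0 < c * cd ?V" using c Vpos by simp
        then have Upos: "0 < cd U" using U(2) by linarith
        interpret jumbled_subgraph ?V E p \<beta> "R 0" by (rule J)
        have "esum E U U = (\<Sum>j<r. esum (R j) U U)"
        proof -
          have "of_bool (E x y) = (\<Sum>j<r. of_bool (R j x y) :: real)" for x y
          proof (cases "E x y")
            case True
            then have "col {x, y} < r" using col unfolding E_def by auto
            then show ?thesis using True unfolding E_def R_def by (simp add: of_bool_def)
          next
            case False
            then show ?thesis unfolding E_def R_def by simp
          qed
          then have "esum E U U = (\<Sum>x\<in>U. \<Sum>y\<in>U. \<Sum>j<r. of_bool (R j x y))" by simp
          also have "\<dots> = (\<Sum>x\<in>U. \<Sum>j<r. \<Sum>y\<in>U. of_bool (R j x y))"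
            by (rule sum.cong[OF refl], rule sum.swap)
          also have "\<dots> = (\<Sum>j<r. esum (R j) U U)" by (rule sum.swap)
          finally show ?thesis .
        qed
        also have "\<dots> \<le> (\<Sum>j<r. \<epsilon> * p * (cd U)\<^sup>2)" by (intro sum_mono U(3)) auto
        also have "\<dots> = p * (cd U)\<^sup>2 / 2" unfolding \<epsilon>_def using assms by simp
        finally have up: "esum E U U \<le> p * (cd U)\<^sup>2 / 2" .
        have low: "p * (cd U)\<^sup>2 - \<beta> * cd U \<le> esum E U U"
          using edge_sum[OF U(1) U(1)] by (simp add: power2_eq_square)
        have "\<beta> \<le> p * cd U / 8"
        proof -
          have "p ^ (D + 2) \<le> p ^ 1" using p by (intro power_decreasing) auto
          then have "g * p ^ (D + 2) * cd ?V \<le> (c / 8) * p * cd ?V"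
            using g p c by (intro mult_right_mono mult_mono) auto
          also have "\<dots> = p * (c * cd ?V) / 8" by simp
          also have "\<dots> \<le> p * cd U / 8" using U(2) p by (intro divide_right_mono mult_left_mono) auto
          finally show ?thesis using \<beta>le by linarith
        qed
        then have "\<beta> * cd U \<le> p * (cd U)\<^sup>2 / 8"
          using mult_right_mono[of \<beta> "p * cd U / 8" "cd U"] by (simp add: power2_eq_square)
        moreover have "0 < p * (cd U)\<^sup>2" using p Upos by simp
        ultimately show False using up low by linarith
      qed
    qed
  qed
qed

end
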